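(* Consider a $(\mu,N,K)$ SC-PIR system with $M=\mu N\in[2:N]$ an integer. Given any parameters $\{\alpha_{\mathcal S}:\alpha_{\mathcal S}\in[0,1],\ \mathcal S\subseteq[1:N]\}$, the following two conditions are necessary and sufficient conditions for the storage design (with $H(W_{k,\mathcal S})=\alpha_{\mathcal S}L$ for all $k\in[1:K]$ and $\mathcal S\subseteq[1:N]$) of a capacity-achieving SC-PIR scheme: (P1) all the packets are stored exactly at $M$ servers, i.e. $\alpha_{\mathcal S}=0$ for all $\mathcal S\subseteq[1:N]$ with $|\mathcal S|\neq M$; (P2) the storage capacity at all servers is used up, i.e. $\sum_{\mathcal S\subseteq[1:N],\,n\in\mathcal S}\alpha_{\mathcal S}=\mu$ for all $n\in[1:N]$.
   Context: Notation: $[a:b]=\{a,a+1,\dots,b\}$; entropies are in base $q$, where $q$ is a prime power; $A_{1:N}=(A_1,\dots,A_N)$. A scheme for the $(\mu,N,K)$ SC-PIR (storage constrained private information retrieval) system, with $N$ servers, $K$ files and normalized storage capacity $\mu\in[1/N,1]$, consists of the following. Files: $W_1,\dots,W_K\in\mathbb F_q^{L}$ are independent, each made of $L$ i.i.d. uniform symbols (the file size $L$ may be arbitrarily large). Storage: each file $W_k$ is partitioned into $F$ disjoint packets $W_{k,1},\dots,W_{k,F}$, with $H(W_{k,i})$ not depending on $k$; $F$ is the sub-packetization. Server $n\in[1:N]$ stores $Z_n=\{W_{k,i}:k\in[1:K],i\in\mathcal Z_n\}$ for some $\mathcal Z_n\subseteq[1:F]$; every packet is stored at at least one server, and $H(Z_n)\le\mu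 KL$ for all $n$. Retrieval: for each desired index $\theta\in[1:K]$ there are random queries $Q_{1:N}^{[\theta]}$ and answers $A_{1:N}^{[\theta]}$ with $I(Q_{1:N}^{[\theta]};W_{1:K})=0$; $H(A_n^{[\theta]}|Q_n^{[\theta]},Z_n)=0$ for all $n$; decodability $H(W_\theta|A_{1:N}^{[\theta]},Q_{1:N}^{[\theta]})=0$; and privacy: for every $n$, the distribution of $(Q_n^{[\theta]},A_n^{[\theta]},Z_n)$ does not depend on $\theta$. The retrieval rate is $R=L/D$, where $D=\sum_{n=1}^N H(A_n^{[\theta]})$ is the average download cost from the $N$ servers over random queries. The capacity $C^*$ is the supremum of achievable rates; for $M=\mu N\in[1:N]$ an integer it is known that $C^*=\left(1+\frac1M+\dots+\frac1{M^{K-1}}\right)^{-1}$. A scheme is capacity-achieving if its rate equals $C^*$. For $\mathcal S\subseteq[1:N]$, $W_{k,\mathcal S}=\{W_{k,i}:i\in(\bigcap_{n\in\mathcal S}\mathcal Z_n)\setminus(\bigcup_{m\in[1:N]\setminus\mathcal S}\mathcal Z_m)\}$ is the set of packets of $W_k$ stored exclusively by the servers in $\mathcal S$ ($W_{k,\emptyset}=\emptyset$); the normalized size $\alpha_{\mathcal S}=H(W_{k,\mathcal S})/L$ does not depend on $k$.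
   Formalization: The formal version assumes K ≥ 2 (for K = 1 any storage achieves C* = 1, so necessity fails); the exact equivalence is for rational α_S, and for real α_S the design is a limit of designs of capacity-achieving schemes, since α_S L must be an integer. *)

theory Defs
  imports "HOL-Probability.Probability"
begin

text \<open>
  Data of a storage constrained PIR scheme. Servers, files, packets and symbol positions are
  numbered from 1. The random variables live on the probability space \<open>M\<close>; entropies have base \<open>b\<close>.
  \<^item> \<open>W k j\<close> is the \<open>j\<close>-th symbol of the \<open>k\<close>-th file, \<open>L\<close> is the file size;
  \<^item> \<open>pkt k i\<close> is the set of positions of the symbols that form the \<open>i\<close>-th packet of file \<open>k\<close>;
  \<^item> \<open>st n\<close> is the set of indices of the packets stored at server \<open>n\<close>;
  \<^item> \<open>Q \<theta> n\<close> and \<open>A \<theta> n\<close> are the query to and the answer of server \<open>n\<close> when file \<open>\<theta>\<close> is desired.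
\<close>

locale sc_pir = information_space M b
  for M :: "'w measure" and b :: real +
  fixes \<mu> :: real and N K L F :: nat
    and W :: "nat \<Rightarrow> nat \<Rightarrow> 'w \<Rightarrow> 'f::{field,finite}"
    and pkt :: "nat \<Rightarrow> nat \<Rightarrow> nat set"
    and st :: "nat \<Rightarrow> nat set"
    and Q :: "nat \<Rightarrow> nat \<Rightarrow> 'w \<Rightarrow> 'q"
    and A :: "nat \<Rightarrow> nat \<Rightarrow> 'w \<Rightarrow> 'a"
begin

definition file_rv :: "nat \<Rightarrow> 'w \<Rightarrow> nat \<Rightarrow> 'f" where
  "file_rv k \<omega> = (\<lambda>j\<in>{1..L}. W k j \<omega>)"

definition all_files :: "'w \<Rightarrow> nat \<Rightarrow> nat \<Rightarrow> 'f" where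
  "all_files \<omega> = (\<lambda>k\<in>{1..K}. file_rv k \<omega>)"

definition packet :: "nat \<Rightarrow> nat \<Rightarrow> 'w \<Rightarrow> nat \<Rightarrow> 'f" where
  "packet k i \<omega> = (\<lambda>j\<in>pkt k i. W k j \<omega>)"

definition storage :: "nat \<Rightarrow> 'w \<Rightarrow> nat \<Rightarrow> nat \<Rightarrow> nat \<Rightarrow> 'f" where
  "storage n \<omega> = (\<lambda>k\<in>{1..K}. \<lambda>i\<in>st n. packet k i \<omega>)"

definition queries :: "nat \<Rightarrow> 'w \<Rightarrow> nat \<Rightarrow> 'q" where
  "queries \<theta> \<omega> = (\<lambda>n\<in>{1..N}. Q \<theta> n \<omega>)"

definition answers :: "nat \<Rightarrow> 'w \<Rightarrow> nat \<Rightarrow> 'a" where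
  "answers \<theta> \<omega> = (\<lambda>n\<in>{1..N}. A \<theta> n \<omega>)"

text \<open>
  Intersecting with \<open>{1..F}\<close> only matters for \<open>S = {}\<close>, where \<open>\<Inter>n\<in>S. st n\<close> is \<open>UNIV\<close>: as every
  packet is stored somewhere, \<open>exclusive {}\<close> is empty.
\<close>

definition exclusive :: "nat set \<Rightarrow> nat set" where
  "exclusive S = {1..F} \<inter> (\<Inter>n\<in>S. st n) - (\<Union>m\<in>{1..N} - S. st m)"

definition exclusive_part :: "nat \<Rightarrow> nat set \<Rightarrow> 'w \<Rightarrow> nat \<Rightarrow> nat \<Rightarrow> 'f" where
  "exclusive_part k S \<omega> = (\<lambda>i\<in>exclusive S. packet k i \<omega>)"

definition storage_design :: "(nat set \<Rightarrow> real) \<Rightarrow> bool" where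
  "storage_design \<alpha> \<longleftrightarrow>
     (\<forall>k\<in>{1..K}. \<forall>S. S \<subseteq> {1..N} \<longrightarrow> \<H>(exclusive_part k S) = \<alpha> S * real L)"

definition download :: "nat \<Rightarrow> real" where
  "download \<theta> = (\<Sum>n=1..N. \<H>(A \<theta> n))"

text \<open>By privacy the download cost does not depend on the desired file, so index 1 is as good as any.\<close>

definition rate :: real where
  "rate = real L / download 1"

end

locale sc_pir_scheme = sc_pir M b \<mu> N K L F W pkt st Q A
  for M :: "'w measure" and b :: real and \<mu> :: real and N K L F :: nat
    and W :: "nat \<Rightarrow> nat \<Rightarrow> 'w \<Rightarrow> 'f::{field,finite}"
    and pkt :: "nat \<Rightarrow> nat \<Rightarrow> nat set"
    and st :: "nat \<Rightarrow> nat set"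
    and Q :: "nat \<Rightarrow> nat \<Rightarrow> 'w \<Rightarrow> 'q"
    and A :: "nat \<Rightarrow> nat \<Rightarrow> 'w \<Rightarrow> 'a" +
  assumes base: "b = real CARD('f)"
    and pos: "1 \<le> N" "1 \<le> K" "1 \<le> L"
    and capacity_range: "1 / real N \<le> \<mu>" "\<mu> \<le> 1"
    and symbols_indep:
      "indep_vars (\<lambda>_. count_space UNIV) (\<lambda>(k, j). W k j) ({1..K} \<times> {1..L})"
    and symbols_uniform:
      "\<And>k j. k \<in> {1..K} \<Longrightarrow> j \<in> {1..L} \<Longrightarrow>
         distr M (count_space UNIV) (W k j) = uniform_count_measure UNIV"
    and packets_partition:
      "\<And>k. k \<in> {1..K} \<Longrightarrow> partition_on {1..L} (pkt k ` {1..F}) \<and> inj_on (pkt k) {1..F}"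
    and packets_entropy:
      "\<And>k k' i. k \<in> {1..K} \<Longrightarrow> k' \<in> {1..K} \<Longrightarrow> i \<in> {1..F} \<Longrightarrow> \<H>(packet k i) = \<H>(packet k' i)"
    and stored_packets: "(\<Union>n\<in>{1..N}. st n) = {1..F}"
    and storage_capacity: "\<And>n. n \<in> {1..N} \<Longrightarrow> \<H>(storage n) \<le> \<mu> * real K * real L"
    and finite_alphabets:
      "\<And>\<theta> n. \<theta> \<in> {1..K} \<Longrightarrow> n \<in> {1..N} \<Longrightarrow>
         simple_function M (Q \<theta> n) \<and> simple_function M (A \<theta> n)"
    and queries_indep_files: "\<And>\<theta>. \<theta> \<in> {1..K} \<Longrightarrow> \<I>(queries \<theta> ; all_files) = 0"
    and answer_determined:
      "\<And>\<theta> n. \<theta> \<in> {1..K} \<Longrightarrow> n \<in> {1..N} \<Longrightarrow> \<H>(A \<theta> n | (\<lambda>\<omega>. (Q \<theta> n \<omega>, storage n \<omega>))) = 0"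
    and decodability:
      "\<And>\<theta>. \<theta> \<in> {1..K} \<Longrightarrow> \<H>(file_rv \<theta> | (\<lambda>\<omega>. (answers \<theta> \<omega>, queries \<theta> \<omega>))) = 0"
    and privacy:
      "\<And>\<theta> \<theta>' n. \<theta> \<in> {1..K} \<Longrightarrow> \<theta>' \<in> {1..K} \<Longrightarrow> n \<in> {1..N} \<Longrightarrow>
         distr M (count_space UNIV) (\<lambda>\<omega>. (Q \<theta> n \<omega>, A \<theta> n \<omega>, storage n \<omega>)) =
         distr M (count_space UNIV) (\<lambda>\<omega>. (Q \<theta>' n \<omega>, A \<theta>' n \<omega>, storage n \<omega>))"

text \<open>
  All random variables of a scheme are finitely many and take finitely many values. Hence it is no
  restriction to take \<open>nat\<close> as the type of sample points, of queries and of answers when schemes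
  are quantified existentially. The argument of type \<open>'f itself\<close> selects the field.
\<close>

definition achievable_rate ::
  "'f::{field,finite} itself \<Rightarrow> real \<Rightarrow> nat \<Rightarrow> nat \<Rightarrow> real \<Rightarrow> bool" where
  "achievable_rate _ \<mu> N K R \<longleftrightarrow>
     (\<exists>(M :: nat measure) b L F (W :: nat \<Rightarrow> nat \<Rightarrow> nat \<Rightarrow> 'f) pkt st
        (Q :: nat \<Rightarrow> nat \<Rightarrow> nat \<Rightarrow> nat) (A :: nat \<Rightarrow> nat \<Rightarrow> nat \<Rightarrow> nat).
        sc_pir_scheme M b \<mu> N K L F W pkt st Q A \<and> sc_pir.rate M b N L A = R)"

definition capacity :: "'f::{field,finite} itself \<Rightarrow> real \<Rightarrow> nat \<Rightarrow> nat \<Rightarrow> real" where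
  "capacity TF \<mu> N K = Sup {R. achievable_rate TF \<mu> N K R}"

definition capacity_achieving_design ::
  "'f::{field,finite} itself \<Rightarrow> real \<Rightarrow> nat \<Rightarrow> nat \<Rightarrow> (nat set \<Rightarrow> real) \<Rightarrow> bool" where
  "capacity_achieving_design TF \<mu> N K \<alpha> \<longleftrightarrow>
     (\<exists>(M :: nat measure) b L F (W :: nat \<Rightarrow> nat \<Rightarrow> nat \<Rightarrow> 'f) pkt st
        (Q :: nat \<Rightarrow> nat \<Rightarrow> nat \<Rightarrow> nat) (A :: nat \<Rightarrow> nat \<Rightarrow> nat \<Rightarrow> nat).
        sc_pir_scheme M b \<mu> N K L F W pkt st Q A \<and>
        sc_pir.rate M b N L A = capacity TF \<mu> N K \<and>
        sc_pir.storage_design M b N K L F W pkt st \<alpha>)"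

text \<open>
  A packet consists of whole symbols, so an exact storage design of a scheme with file size \<open>L\<close> has
  all \<open>\<alpha> S * L\<close> integral. Real parameters are therefore approached by schemes, each of which is
  exactly capacity-achieving, with arbitrarily large \<open>L\<close>.
\<close>

definition limit_capacity_achieving_design ::
  "'f::{field,finite} itself \<Rightarrow> real \<Rightarrow> nat \<Rightarrow> nat \<Rightarrow> (nat set \<Rightarrow> real) \<Rightarrow> bool" where
  "limit_capacity_achieving_design TF \<mu> N K \<alpha> \<longleftrightarrow>
     (\<forall>\<epsilon>>0. \<exists>\<beta>. capacity_achieving_design TF \<mu> N K \<beta> \<and> (\<forall>S. S \<subseteq> {1..N} \<longrightarrow> \<bar>\<beta> S - \<alpha> S\<bar> \<le> \<epsilon>))"

definition stored_at_exactly :: "nat \<Rightarrow> nat \<Rightarrow> (nat set \<Rightarrow> real) \<Rightarrow> bool" where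
  "stored_at_exactly M N \<alpha> \<longleftrightarrow> (\<forall>S. S \<subseteq> {1..N} \<and> card S \<noteq> M \<longrightarrow> \<alpha> S = 0)"

definition storage_used_up :: "real \<Rightarrow> nat \<Rightarrow> (nat set \<Rightarrow> real) \<Rightarrow> bool" where
  "storage_used_up \<mu> N \<alpha> \<longleftrightarrow> (\<forall>n\<in>{1..N}. (\<Sum>S | S \<subseteq> {1..N} \<and> n \<in> S. \<alpha> S) = \<mu>)"

end

theory Submission
  imports Defs "HOL-Analysis.Kronecker_Approximation_Theorem"
begin

text \<open>
  Necessity. Let \<open>U k P\<close> (\<open>residual\<close> below) be the entropy of all answers for the desired file \<open>k\<close>, given the queries,
  the files \<open>1, \<dots>, k\<close> and the contents of the servers in \<open>P\<close>. Revealing first the answer and then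
  the contents of a server \<open>m\<close> outside \<open>P\<close> gives \<open>U k P \<ge> H (A k m | \<dots>) + U k (P \<union> {m})\<close>. By privacy the
  desired file \<open>k\<close> may be replaced by \<open>k + 1\<close> in the first summand, and the sum of these summands over
  all \<open>m\<close> outside \<open>P\<close> is by decodability at least \<open>H (W (k + 1) | Z P) + U (k + 1) P\<close>. Averaging over
  \<open>m\<close> and induction on \<open>K - k\<close> and on the complement of \<open>P\<close> give
  \<open>D \<ge> L * (\<Sum>S. \<alpha> S * f (card S))\<close> with \<open>f l = (\<Sum>i<K. 1 / l ^ i)\<close>. As \<open>f\<close> is strictly convex and strictly
  decreasing, the bound \<open>D \<ge> L * f M\<close> follows, and equality forces (P1) and (P2).

  Sufficiency. For each set \<open>S\<close> of \<open>M\<close> servers, the part stored exactly at \<open>S\<close> consists of blocks indexed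
  by \<open>\<tau> \<in> (\<int>/M)\<^sup>K\<close>, each with symbols \<open>1, \<dots>, M - 1\<close>; put symbol \<open>0\<close> to be zero. With a uniform
  \<open>R \<in> (\<int>/M)\<^sup>K\<close>, the server of rank \<open>p\<close> in \<open>S\<close> receives the uniform vector \<open>v = R + p e\<^sub>\<theta>\<close> and returns
  \<open>\<Sum>k. W k [block t + v] [symbol t k]\<close> for all \<open>t \<noteq> 0\<close>. Fixing the block \<open>t + v\<close>, the servers in \<open>S\<close> return
  the same interference plus each of the symbols of file \<open>\<theta>\<close>, including the zero symbol. Each of the
  \<open>M\<close> answers has \<open>M ^ K - 1\<close> symbols, for \<open>(M - 1) * M ^ K\<close> symbols of the file, which is the optimal rate. Real parameters are
  approximated by rational ones with (P1) and (P2), by Dirichlet's simultaneous approximation theorem.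
\<close>

section \<open>Entropies of simple functions\<close>

context information_space
begin

text \<open>Dependence is required pointwise on the sample space, not almost surely: reordering or
  repackaging a tuple then amounts to comparing fibres, and entropies compare through
  \<open>entropy_mono\<close> and \<open>entropy_eqI\<close>.\<close>

definition determined_by :: "('a \<Rightarrow> 'x) \<Rightarrow> ('a \<Rightarrow> 'y) \<Rightarrow> bool" where
  "determined_by X Y \<longleftrightarrow> (\<forall>\<omega>\<in>space M. \<forall>\<omega>'\<in>space M. Y \<omega> = Y \<omega>' \<longrightarrow> X \<omega> = X \<omega>')"

lemma determined_byI:
  "(\<And>\<omega> \<omega>'. \<omega> \<in> space M \<Longrightarrow> \<omega>' \<in> space M \<Longrightarrow> Y \<omega> = Y \<omega>' \<Longrightarrow> X \<omega> = X \<omega>') \<Longrightarrow> determined_by X Y"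
  unfolding determined_by_def by blast

lemma determined_byD:
  "determined_by X Y \<Longrightarrow> \<omega> \<in> space M \<Longrightarrow> \<omega>' \<in> space M \<Longrightarrow> Y \<omega> = Y \<omega>' \<Longrightarrow> X \<omega> = X \<omega>'"
  unfolding determined_by_def by blast

lemma determined_by_factor:
  assumes "determined_by X Y"
  obtains f where "\<And>\<omega>. \<omega> \<in> space M \<Longrightarrow> X \<omega> = f (Y \<omega>)"
proof -
  define f where "f y = X (inv_into (space M) Y y)" for y
  have "X \<omega> = f (Y \<omega>)" if "\<omega> \<in> space M" for \<omega>
    unfolding f_def
    by (rule determined_byD[OF assms that])
      (use that in \<open>auto intro: inv_into_into simp: f_inv_into_f\<close>)
  then show thesis by (rule that)
qed

lemma simple_function_determined_by:
  assumes "simple_function M Y" "determined_by X Y"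
  shows "simple_function M X"
proof -
  obtain f where f: "\<And>\<omega>. \<omega> \<in> space M \<Longrightarrow> X \<omega> = f (Y \<omega>)"
    using determined_by_factor[OF assms(2)] by blast
  have "simple_function M X = simple_function M (f \<circ> Y)"
    by (rule simple_function_cong) (simp add: f)
  then show ?thesis using simple_function_compose[OF assms(1), of f] by simp
qed

lemma entropy_cong_space:
  assumes "\<And>\<omega>. \<omega> \<in> space M \<Longrightarrow> X \<omega> = X' \<omega>"
  shows "\<H>(X) = \<H>(X')"
proof -
  have *: "X ` space M = X' ` space M" using assms by (auto simp: image_iff)
  have "distr M (count_space (X ` space M)) X = distr M (count_space (X' ` space M)) X'"
    by (rule distr_cong) (simp_all add: assms *)
  then show ?thesis unfolding entropy_def by (simp add: *)
qed

lemma entropy_mono: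
  assumes "simple_function M Y" "determined_by X Y"
  shows "\<H>(X) \<le> \<H>(Y)"
proof -
  obtain f where f: "\<And>\<omega>. \<omega> \<in> space M \<Longrightarrow> X \<omega> = f (Y \<omega>)"
    using determined_by_factor[OF assms(2)] by blast
  have "\<H>(X) = \<H>(f \<circ> Y)" by (rule entropy_cong_space) (simp add: f)
  also have "\<dots> \<le> \<H>(Y)" by (rule entropy_data_processing[OF assms(1)])
  finally show ?thesis .
qed

lemma entropy_eqI:
  assumes "simple_function M Y" "determined_by X Y" "determined_by Y X"
  shows "\<H>(X) = \<H>(Y)"
  by (rule antisym) (use assms simple_function_determined_by[OF assms(1,2)] entropy_mono in blast)+

text \<open>Grouping the values \<open>w\<close> by \<open>g w\<close> adds up the probabilities
  inside each fibre of \<open>g\<close>. The entropies of all coarsenings of \<open>W\<close>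
  thereby become sums over one index set, the values of \<open>W\<close>.\<close>

lemma entropy_as_sum_over_refinement:
  assumes W: "simple_function M W" and V: "V = g \<circ> W"
  shows "\<H>(V) = - (\<Sum>w\<in>W ` space M. prob (W -` {w} \<inter> space M) * log b (prob (V -` {g w} \<inter> space M)))"
proof -
  let ?P = "\<lambda>w. prob (W -` {w} \<inter> space M)" and ?Q = "\<lambda>v. prob (V -` {v} \<inter> space M)"
  have sV: "simple_function M V" unfolding V by (rule simple_function_compose[OF W])
  have fin: "finite (W ` space M)" using W by (simp add: simple_functionD)
  have meas: "W -` {w} \<inter> space M \<in> events" for w using simple_functionD(2)[OF W] by auto
  have Q: "?Q v = (\<Sum>w | w \<in> W ` space M \<and> g w = v. ?P w)" for v
  proof -
    have "V -` {v} \<inter> space M = (\<Union>w\<in>{w \<in> W ` space M. g w = v}. W -` {w} \<inter> space M)"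
      unfolding V by auto
    also have "prob \<dots> = (\<Sum>w | w \<in> W ` space M \<and> g w = v. ?P w)"
      by (rule finite_measure_finite_Union) (use fin meas in \<open>auto simp: disjoint_family_on_def\<close>)
    finally show ?thesis .
  qed
  have "\<H>(V) = - (\<Sum>v\<in>V ` space M. ?Q v * log b (?Q v))"
    by (rule entropy_simple_distributed[OF simple_distributedI[OF sV measure_nonneg refl]])
  also have "(\<Sum>v\<in>V ` space M. ?Q v * log b (?Q v)) =
      (\<Sum>v\<in>g ` W ` space M. \<Sum>w | w \<in> W ` space M \<and> g w = v. ?P w * log b (?Q (g w)))"
  proof (rule sum.cong)
    fix v assume "v \<in> g ` W ` space M"
    have "?Q v * log b (?Q v) = (\<Sum>w | w \<in> W ` space M \<and> g w = v. ?P w) * log b (?Q v)"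
      by (subst Q) simp
    also have "\<dots> = (\<Sum>w | w \<in> W ` space M \<and> g w = v. ?P w * log b (?Q (g w)))"
      by (simp add: sum_distrib_right)
    finally show "?Q v * log b (?Q v) = (\<Sum>w | w \<in> W ` space M \<and> g w = v. ?P w * log b (?Q (g w)))" .
  qed (simp add: V image_comp)
  also have "\<dots> = (\<Sum>w\<in>W ` space M. ?P w * log b (?Q (g w)))"
    by (rule sum.image_gen[OF fin, symmetric])
  finally show ?thesis .
qed

text \<open>All four entropies are expanded over the values of the triple, where the identity holds
  term by term.\<close>

lemma conditional_mutual_information_eq_entropies:
  assumes X: "simple_function M X" and Y: "simple_function M Y" and Z: "simple_function M Z"
  shows "\<I>(X ; Y | Z) = \<H>(\<lambda>x. (X x, Z x)) + \<H>(\<lambda>x. (Y x, Z x)) - \<H>(\<lambda>x. (X x, Y x, Z x)) - \<H>(Z)"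
proof -
  let ?W = "\<lambda>x. (X x, Y x, Z x)" and ?XZ = "\<lambda>x. (X x, Z x)" and ?YZ = "\<lambda>x. (Y x, Z x)"
  let ?P = "\<lambda>V v. prob (V -` {v} \<inter> space M)"
  have sXZ: "simple_function M ?XZ" and sYZ: "simple_function M ?YZ" using X Y Z by auto
  have sW: "simple_function M ?W" using X sYZ by auto
  have pos: "?P V (g w) > 0" if "V = g \<circ> ?W" "?P ?W w > 0" "simple_function M V" for V g w
  proof -
    have "?P ?W w \<le> ?P V (g w)"
      by (rule finite_measure_mono) (use that simple_functionD(2)[OF that(3)] in auto)
    with that(2) show ?thesis by simp
  qed
  have "\<I>(X ; Y | Z) = (\<Sum>(x, y, z)\<in>?W ` space M.
      ?P ?W (x, y, z) * log b (?P ?W (x, y, z) / (?P ?XZ (x, z) * (?P ?YZ (y, z) / ?P Z z))))"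
    by (rule conditional_mutual_information_eq; rule simple_distributedI[OF _ measure_nonneg refl]; fact)
  also have "\<dots> = (\<Sum>w\<in>?W ` space M. ?P ?W w * log b (?P ?W w)
      - ?P ?W w * log b (?P ?XZ (fst w, snd (snd w))) - ?P ?W w * log b (?P ?YZ (snd w))
      + ?P ?W w * log b (?P Z (snd (snd w))))"
  proof (rule sum.cong[OF refl], clarify)
    fix x y z
    let ?a = "?P ?W (x, y, z)" and ?b = "?P ?XZ (x, z)" and ?c = "?P ?YZ (y, z)" and ?d = "?P Z z"
    have "?a * log b (?a / (?b * (?c / ?d))) = ?a * log b ?a - ?a * log b ?b - ?a * log b ?c + ?a * log b ?d"
    \<comment> \<open>Terms of probability zero vanish; for the others the three coarser events have
      positive probability too, so the logarithm splits.\<close>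
    proof (cases "?a = 0")
      case False
      then have a: "?a > 0" using measure_nonneg[of M] by (simp add: less_le)
      have "?b > 0" using pos[of ?XZ "\<lambda>w. (fst w, snd (snd w))" "(x, y, z)"] a sXZ by (auto simp: comp_def)
      moreover have "?c > 0" using pos[of ?YZ snd "(x, y, z)"] a sYZ by (auto simp: comp_def)
      moreover have "?d > 0" using pos[of Z "\<lambda>w. snd (snd w)" "(x, y, z)"] a Z by (auto simp: comp_def)
      ultimately have "log b (?a / (?b * (?c / ?d))) = log b ?a - (log b ?b + (log b ?c - log b ?d))"
        using a by (simp add: log_divide_pos log_mult_pos)
      then show ?thesis by (simp only: right_diff_distrib distrib_left)
    qed simp
    then show "?a * log b (?a / (?b * (?c / ?d))) = ?a * log b ?a
      - ?a * log b (?P ?XZ (fst (x, y, z), snd (snd (x, y, z))))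
      - ?a * log b (?P ?YZ (snd (x, y, z))) + ?a * log b (?P Z (snd (snd (x, y, z))))"
      by simp
  qed
  also have "\<dots> = - \<H>(?W) + \<H>(?XZ) + \<H>(?YZ) - \<H>(Z)"
    using entropy_as_sum_over_refinement[OF sW, of ?W id]
      entropy_as_sum_over_refinement[OF sW, of ?XZ "\<lambda>w. (fst w, snd (snd w))"]
      entropy_as_sum_over_refinement[OF sW, of ?YZ snd]
      entropy_as_sum_over_refinement[OF sW, of Z "\<lambda>w. snd (snd w)"]
    by (simp add: comp_def sum.distrib sum_subtractf)
  finally show ?thesis by simp
qed

text \<open>This is nonnegativity of \<open>\<I>(X ; Y | Z)\<close>. Asking only that
  \<open>U\<close> be determined by the pair and \<open>Z\<close> by each component lets unions and
  intersections of index sets be inserted directly.\<close>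

lemma entropy_submodular:
  assumes X: "simple_function M X" and Y: "simple_function M Y"
    and U: "determined_by U (\<lambda>\<omega>. (X \<omega>, Y \<omega>))"
    and Z: "determined_by Z X" "determined_by Z Y"
  shows "\<H>(U) + \<H>(Z) \<le> \<H>(X) + \<H>(Y)"
proof -
  have sZ: "simple_function M Z" by (rule simple_function_determined_by[OF X Z(1)])
  have sXYZ: "simple_function M (\<lambda>\<omega>. (X \<omega>, Y \<omega>, Z \<omega>))"
    using X Y sZ by auto
  have "0 \<le> \<I>(X ; Y | Z)"
    by (rule conditional_mutual_information_nonneg) fact+
  also note conditional_mutual_information_eq_entropies[OF X Y sZ]
  also have "\<H>(\<lambda>\<omega>. (X \<omega>, Z \<omega>)) = \<H>(X)"
    by (rule entropy_eqI[OF X]) (use Z in \<open>unfold determined_by_def prod.inject, blast+\<close>)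
  also have "\<H>(\<lambda>x. (Y x, Z x)) = \<H>(Y)"
    by (rule entropy_eqI[OF Y]) (use Z in \<open>unfold determined_by_def prod.inject, blast+\<close>)
  finally have "\<H>(\<lambda>\<omega>. (X \<omega>, Y \<omega>, Z \<omega>)) + \<H>(Z) \<le> \<H>(X) + \<H>(Y)" by simp
  moreover have "\<H>(U) \<le> \<H>(\<lambda>\<omega>. (X \<omega>, Y \<omega>, Z \<omega>))"
    by (rule entropy_mono[OF sXYZ]) (use U in \<open>unfold determined_by_def prod.inject, blast\<close>)
  ultimately show ?thesis by simp
qed

lemma conditional_entropy_eq_diff:
  assumes "simple_function M X" "simple_function M Y"
  shows "\<H>(X | Y) = \<H>(\<lambda>\<omega>. (Y \<omega>, X \<omega>)) - \<H>(Y)"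
  using entropy_chain_rule[OF assms(2,1)] by simp

lemma conditional_entropy_determined_by:
  assumes "simple_function M X" "simple_function M Y" "determined_by X Y"
  shows "\<H>(X | Y) = 0"
proof -
  have "\<H>(\<lambda>\<omega>. (Y \<omega>, X \<omega>)) = \<H>(Y)"
    by (rule entropy_eqI[OF assms(2)]) (use assms(3) in \<open>unfold determined_by_def prod.inject, blast+\<close>)
  then show ?thesis using conditional_entropy_eq_diff[OF assms(1,2)] by simp
qed

text \<open>Values outside the range have probability zero and contribute nothing, so variables with
  different ranges can be summed over a common set.\<close>

lemma entropy_sum_superset:
  assumes "simple_function M X" "finite T" "X ` space M \<subseteq> T"
  shows "\<H>(X) = - (\<Sum>x\<in>T. prob (X -` {x} \<inter> space M) * log b (prob (X -` {x} \<inter> space M)))"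
proof -
  have "\<H>(X) = - (\<Sum>x\<in>X ` space M. prob (X -` {x} \<inter> space M) * log b (prob (X -` {x} \<inter> space M)))"
    by (rule entropy_simple_distributed[OF simple_distributedI[OF assms(1) measure_nonneg refl]])
  also have "(\<Sum>x\<in>X ` space M. prob (X -` {x} \<inter> space M) * log b (prob (X -` {x} \<inter> space M))) =
    (\<Sum>x\<in>T. prob (X -` {x} \<inter> space M) * log b (prob (X -` {x} \<inter> space M)))"
  proof (rule sum.mono_neutral_left[OF assms(2,3)], rule ballI)
    fix x assume "x \<in> T - X ` space M"
    then have "X -` {x} \<inter> space M = {}" by auto
    then show "prob (X -` {x} \<inter> space M) * log b (prob (X -` {x} \<inter> space M)) = 0" by simp
  qed
  finally show ?thesis .
qed

lemma entropy_eq_of_distr_eq: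
  assumes X: "simple_function M X" and Y: "simple_function M Y"
    and eq: "distr M (count_space UNIV) X = distr M (count_space UNIV) Y"
  shows "\<H>(X) = \<H>(Y)"
proof -
  have X': "random_variable (count_space UNIV) X" and Y': "random_variable (count_space UNIV) Y"
    using X Y measurable_simple_function by blast+
  have "prob (X -` {x} \<inter> space M) = prob (Y -` {x} \<inter> space M)" for x
    using measure_distr[OF X', of "{x}"] measure_distr[OF Y', of "{x}"] eq by simp
  moreover have "finite (X ` space M \<union> Y ` space M)"
    using X Y by (simp add: simple_functionD)
  ultimately show ?thesis
    using entropy_sum_superset[OF X, of "X ` space M \<union> Y ` space M"]
      entropy_sum_superset[OF Y, of "X ` space M \<union> Y ` space M"] by simp
qed

lemma entropy_le_log_card:
  assumes X: "simple_function M X" and "finite T" "X ` space M \<subseteq> T"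
  shows "\<H>(X) \<le> log b (real (card T))"
proof -
  have "\<H>(X) \<le> log b (real (card (X ` space M)))"
    by (rule entropy_le_card[OF simple_distributedI[OF X measure_nonneg refl]])
  also have "\<dots> \<le> log b (real (card T))"
  proof -
    have "0 < card (X ` space M)"
      using X not_empty by (auto simp: card_gt_0_iff simple_functionD)
    then show ?thesis
      using card_mono[OF assms(2,3)] b_gt_1 by simp
  qed
  finally show ?thesis .
qed

lemma entropy_uniform_on:
  assumes X: "simple_function M X" and "finite T" "X ` space M \<subseteq> T" "T \<noteq> {}"
    and u: "\<And>x. x \<in> T \<Longrightarrow> prob (X -` {x} \<inter> space M) = 1 / real (card T)"
  shows "\<H>(X) = log b (real (card T))"
proof -
  have c: "0 < real (card T)" using assms by (auto simp: card_gt_0_iff)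
  have "\<H>(X) = - (\<Sum>x\<in>T. (1 / real (card T)) * log b (1 / real (card T)))"
    unfolding entropy_sum_superset[OF assms(1-3)] by (simp add: u)
  also have "\<dots> = log b (real (card T))"
    using c b_gt_1 by (simp add: log_divide)
  finally show ?thesis .
qed

lemma mutual_information_eq_zero_iff:
  assumes "simple_function M X" "simple_function M Y"
  shows "\<I>(X ; Y) = 0 \<longleftrightarrow> \<H>(\<lambda>\<omega>. (X \<omega>, Y \<omega>)) = \<H>(X) + \<H>(Y)"
proof -
  have "\<H>(\<lambda>\<omega>. (Y \<omega>, X \<omega>)) = \<H>(\<lambda>\<omega>. (X \<omega>, Y \<omega>))"
    by (rule entropy_eqI) (use assms in \<open>auto intro!: determined_byI\<close>)
  then show ?thesis
    using mutual_information_eq_entropy_conditional_entropy[OF assms]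
      conditional_entropy_eq_diff[OF assms] by auto
qed

end

section \<open>Symbols and packets\<close>

lemma restrict_eq_restrict_iff: "restrict f B = restrict g B \<longleftrightarrow> (\<forall>x\<in>B. f x = g x)"
  by (auto simp: restrict_def fun_eq_iff)

lemma simple_function_restrict:
  assumes "finite B" "\<And>n. n \<in> B \<Longrightarrow> simple_function M (X n)"
  shows "simple_function M (\<lambda>\<omega>. \<lambda>n\<in>B. X n \<omega>)"
  using assms
proof (induction B)
  case empty
  then show ?case by simp
next
  case (insert b B)
  have "(\<lambda>\<omega>. \<lambda>n\<in>insert b B. X n \<omega>) = (\<lambda>\<omega>. (\<lambda>n\<in>B. X n \<omega>)(b := X b \<omega>))"
    by (auto simp: fun_eq_iff restrict_def)
  moreover have "simple_function M (\<lambda>\<omega>. (\<lambda>n\<in>B. X n \<omega>)(b := X b \<omega>))"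
    using simple_function_compose2[of M "\<lambda>\<omega>. \<lambda>n\<in>B. X n \<omega>" "X b" "\<lambda>f x. f(b := x)"] insert by simp
  ultimately show ?case by (simp only:)
qed

context sc_pir
begin

section \<open>Symbol vectors, stored positions and joint variables\<close>

definition symbols :: "(nat \<times> nat) set \<Rightarrow> 'w \<Rightarrow> nat \<times> nat \<Rightarrow> 'f" where
  "symbols J \<omega> = (\<lambda>(k, j)\<in>J. W k j \<omega>)"

definition stored :: "nat \<Rightarrow> (nat \<times> nat) set" where
  "stored n = {(k, j). k \<in> {1..K} \<and> (\<exists>i\<in>st n. j \<in> pkt k i)}"

text \<open>The answering servers, the queried servers and the known file positions enter as three
  sets, so that submodularity becomes a statement about unions and intersections of these
  sets.\<close>

definition joint :: "nat \<Rightarrow> nat set \<Rightarrow> nat set \<Rightarrow> (nat \<times> nat) set \<Rightarrow>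
    'w \<Rightarrow> (nat \<Rightarrow> 'a) \<times> (nat \<Rightarrow> 'q) \<times> (nat \<times> nat \<Rightarrow> 'f)" where
  "joint \<theta> B C J \<omega> = (\<lambda>n\<in>B. A \<theta> n \<omega>, \<lambda>n\<in>C. Q \<theta> n \<omega>, symbols J \<omega>)"

definition joint_entropy :: "nat \<Rightarrow> nat set \<Rightarrow> nat set \<Rightarrow> (nat \<times> nat) set \<Rightarrow> real" where
  "joint_entropy \<theta> B C J = \<H>(joint \<theta> B C J)"

definition packet_type :: "nat \<Rightarrow> nat set" where
  "packet_type i = {n \<in> {1..N}. i \<in> st n}"

text \<open>Counted in file \<open>1\<close>: in a scheme the size of a packet does not depend on
  the file. For a storage design \<open>\<alpha>\<close> this number is
  \<open>\<alpha> S * L\<close>.\<close>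

definition type_size :: "nat set \<Rightarrow> nat" where
  "type_size S = (\<Sum>i\<in>exclusive S. card (pkt 1 i))"

lemma symbols_eq_iff: "symbols J \<omega> = symbols J \<omega>' \<longleftrightarrow> (\<forall>(k, j)\<in>J. W k j \<omega> = W k j \<omega>')"
  by (auto simp: symbols_def restrict_eq_restrict_iff)

lemma joint_eq_iff:
  "joint \<theta> B C J \<omega> = joint \<theta> B C J \<omega>' \<longleftrightarrow>
     (\<forall>n\<in>B. A \<theta> n \<omega> = A \<theta> n \<omega>') \<and> (\<forall>n\<in>C. Q \<theta> n \<omega> = Q \<theta> n \<omega>') \<and>
     (\<forall>(k, j)\<in>J. W k j \<omega> = W k j \<omega>')"
  by (auto simp: joint_def symbols_eq_iff restrict_eq_restrict_iff)

lemma storage_eq_iff: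
  "storage n \<omega> = storage n \<omega>' \<longleftrightarrow> (\<forall>(k, j)\<in>stored n. W k j \<omega> = W k j \<omega>')"
  unfolding storage_def packet_def stored_def restrict_eq_restrict_iff by blast

lemma packet_eq_iff: "packet k i \<omega> = packet k i \<omega>' \<longleftrightarrow> (\<forall>(k, j)\<in>Pair k ` pkt k i. W k j \<omega> = W k j \<omega>')"
  unfolding packet_def restrict_eq_restrict_iff by auto

lemma exclusive_eq_packet_type:
  assumes "S \<subseteq> {1..N}"
  shows "exclusive S = {i \<in> {1..F}. packet_type i = S}"
  using assms unfolding exclusive_def packet_type_def by auto

end

text \<open>The axioms that concern the symbols alone. Entropies of symbol vectors are thereby
  available for the constructed scheme before its remaining axioms are verified.\<close>

locale sc_pir_symbols = sc_pir M b \<mu> N K L F W pkt st Q A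
  for M :: "'w measure" and b :: real and \<mu> :: real and N K L F :: nat
    and W :: "nat \<Rightarrow> nat \<Rightarrow> 'w \<Rightarrow> 'f::{field,finite}"
    and pkt :: "nat \<Rightarrow> nat \<Rightarrow> nat set"
    and st :: "nat \<Rightarrow> nat set"
    and Q :: "nat \<Rightarrow> nat \<Rightarrow> 'w \<Rightarrow> 'q"
    and A :: "nat \<Rightarrow> nat \<Rightarrow> 'w \<Rightarrow> 'a" +
  assumes base: "b = real CARD('f)"
    and symbols_indep:
      "indep_vars (\<lambda>_. count_space UNIV) (\<lambda>(k, j). W k j) ({1..K} \<times> {1..L})"
    and symbols_uniform:
      "\<And>k j. k \<in> {1..K} \<Longrightarrow> j \<in> {1..L} \<Longrightarrow>
         distr M (count_space UNIV) (W k j) = uniform_count_measure UNIV"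
begin

abbreviation "all_symbols \<equiv> {1..K} \<times> {1..L}"

lemma simple_W: "k \<in> {1..K} \<Longrightarrow> j \<in> {1..L} \<Longrightarrow> simple_function M (W k j)"
proof -
  assume "k \<in> {1..K}" "j \<in> {1..L}"
  then have "random_variable (count_space UNIV) (W k j)"
    using symbols_indep unfolding indep_vars_def2 by fastforce
  then have "W k j -` {x} \<inter> space M \<in> events" for x
    using measurable_sets by fastforce
  then show ?thesis unfolding simple_function_def by simp
qed

lemma simple_symbols:
  assumes "J \<subseteq> all_symbols"
  shows "simple_function M (symbols J)"
proof -
  have "finite J" using assms finite_subset by blast
  moreover have "simple_function M ((\<lambda>(k, j). W k j) p)" if "p \<in> J" for p
    using that assms simple_W by auto
  ultimately have "simple_function M (\<lambda>\<omega>. \<lambda>p\<in>J. (\<lambda>(k, j). W k j) p \<omega>)"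
    by (rule simple_function_restrict)
  moreover have "(\<lambda>\<omega>. \<lambda>p\<in>J. (\<lambda>(k, j). W k j) p \<omega>) = symbols J"
    by (auto simp: fun_eq_iff symbols_def restrict_def)
  ultimately show ?thesis by simp
qed

lemma prob_symbols:
  assumes J: "J \<subseteq> all_symbols" and x: "x \<in> J \<rightarrow>\<^sub>E UNIV"
  shows "prob (symbols J -` {x} \<inter> space M) = 1 / real CARD('f) ^ card J"
\<comment> \<open>The product formula below intersects over a nonempty index set, so the empty
  vector is treated apart.\<close>
proof (cases "J = {}")
  case True
  then have "symbols J -` {x} \<inter> space M = space M" using x by (auto simp: symbols_def)
  then show ?thesis using True by (simp add: prob_space)
next
  case False
  have fin: "finite J" using J finite_subset by blast
  have "indep_vars (\<lambda>_. count_space UNIV) (\<lambda>(k, j). W k j) J"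
    by (rule indep_vars_subset[OF symbols_indep J])
  then have "prob (\<Inter>p\<in>J. (\<lambda>(k, j). W k j) p -` {x p} \<inter> space M) =
      (\<Prod>p\<in>J. prob ((\<lambda>(k, j). W k j) p -` {x p} \<inter> space M))"
    by (rule indep_varsD_finite) (use False fin in auto)
  also have "(\<Inter>p\<in>J. (\<lambda>(k, j). W k j) p -` {x p} \<inter> space M) = symbols J -` {x} \<inter> space M"
  proof -
    have *: "symbols J \<omega> = x \<longleftrightarrow> (\<forall>p\<in>J. (\<lambda>(k, j). W k j) p \<omega> = x p)" for \<omega>
    proof -
      have "x = restrict x J" using x by (simp add: PiE_restrict)
      then have "symbols J \<omega> = x \<longleftrightarrow> symbols J \<omega> = restrict x J" by simp
      also have "\<dots> \<longleftrightarrow> (\<forall>p\<in>J. (\<lambda>(k, j). W k j) p \<omega> = x p)"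
        unfolding symbols_def restrict_eq_restrict_iff by (auto simp: case_prod_beta)
      finally show ?thesis .
    qed
    show ?thesis
    proof (rule set_eqI)
      fix \<omega>
      show "\<omega> \<in> (\<Inter>p\<in>J. (\<lambda>(k, j). W k j) p -` {x p} \<inter> space M) \<longleftrightarrow> \<omega> \<in> symbols J -` {x} \<inter> space M"
        using *[of \<omega>] False by blast
    qed
  qed
  also have "(\<Prod>p\<in>J. prob ((\<lambda>(k, j). W k j) p -` {x p} \<inter> space M)) = (\<Prod>p\<in>J. 1 / real CARD('f))"
  proof (rule prod.cong[OF refl])
    fix p assume "p \<in> J"
    then obtain k j where p: "p = (k, j)" "k \<in> {1..K}" "j \<in> {1..L}" using J by auto
    have rv: "random_variable (count_space UNIV) (W k j)"
      using simple_W[OF p(2,3)] measurable_simple_function by blast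
    have "prob (W k j -` {x p} \<inter> space M) = measure (distr M (count_space UNIV) (W k j)) {x p}"
      using measure_distr[OF rv, of "{x p}"] by simp
    also have "\<dots> = 1 / real CARD('f)"
      unfolding symbols_uniform[OF p(2,3)] by (simp add: measure_uniform_count_measure)
    finally show "prob ((\<lambda>(k, j). W k j) p -` {x p} \<inter> space M) = 1 / real CARD('f)"
      by (simp add: p(1))
  qed
  finally show ?thesis by (simp add: power_one_over)
qed

text \<open>The vector is uniform on \<open>CARD('f) ^ card J\<close> values and the base is the
  field size, so entropy counts symbols.\<close>

lemma entropy_symbols:
  assumes J: "J \<subseteq> all_symbols"
  shows "\<H>(symbols J) = real (card J)"
proof -
  have fin: "finite J" using J finite_subset by blast
  have c: "card (J \<rightarrow>\<^sub>E (UNIV :: 'f set)) = CARD('f) ^ card J"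
    by (simp add: card_PiE fin)
  have "\<H>(symbols J) = log b (real (card (J \<rightarrow>\<^sub>E (UNIV :: 'f set))))"
  proof (rule entropy_uniform_on[OF simple_symbols[OF J]])
    show "symbols J ` space M \<subseteq> J \<rightarrow>\<^sub>E UNIV" by (auto simp: symbols_def)
    show "finite (J \<rightarrow>\<^sub>E (UNIV :: 'f set))" by (intro finite_PiE) (simp_all add: fin)
    show "J \<rightarrow>\<^sub>E (UNIV :: 'f set) \<noteq> {}" by (simp add: PiE_eq_empty_iff)
    show "prob (symbols J -` {x} \<inter> space M) = 1 / real (card (J \<rightarrow>\<^sub>E (UNIV :: 'f set)))"
      if "x \<in> J \<rightarrow>\<^sub>E UNIV" for x
      using prob_symbols[OF J that] by (simp add: c)
  qed
  also have "\<dots> = real (card J)"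
    unfolding c using base b_gt_1 by (simp add: log_nat_power log_eq_one)
  finally show ?thesis .
qed

text \<open>A variable that identifies exactly the same samples as the symbols in \<open>J\<close>
  has their entropy, whatever its type. Files, packets, storages and exclusive parts are of this
  kind.\<close>

lemma entropy_of_symbols_eqI:
  assumes "J \<subseteq> all_symbols"
    and "\<And>\<omega> \<omega>'. X \<omega> = X \<omega>' \<longleftrightarrow> (\<forall>(k, j)\<in>J. W k j \<omega> = W k j \<omega>')"
  shows "simple_function M X" "\<H>(X) = real (card J)"
proof -
  have *: "determined_by X (symbols J)" "determined_by (symbols J) X"
    by (rule determined_byI; simp add: assms(2) symbols_eq_iff)+
  show "simple_function M X"
    by (rule simple_function_determined_by[OF simple_symbols[OF assms(1)] *(1)])
  show "\<H>(X) = real (card J)"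
    using entropy_eqI[OF simple_symbols[OF assms(1)] *] entropy_symbols[OF assms(1)] by simp
qed

end

sublocale sc_pir_scheme \<subseteq> sc_pir_symbols
  by unfold_locales (fact base symbols_indep symbols_uniform)+

section \<open>Packet sizes and storage loads\<close>

context sc_pir_scheme
begin

lemma st_subset: "n \<in> {1..N} \<Longrightarrow> st n \<subseteq> {1..F}"
  using stored_packets by blast

lemma pkt_subset: "k \<in> {1..K} \<Longrightarrow> i \<in> {1..F} \<Longrightarrow> pkt k i \<subseteq> {1..L}"
  using packets_partition[of k] unfolding partition_on_def by blast

lemma stored_subset: "n \<in> {1..N} \<Longrightarrow> stored n \<subseteq> all_symbols"
  unfolding stored_def using st_subset pkt_subset by fast

text \<open>\<open>partition_on\<close> speaks of the set of blocks only; injectivity of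
  \<open>pkt k\<close> keeps two indices from naming the same block.\<close>

lemma disjoint_pkt:
  assumes "k \<in> {1..K}" "i \<in> {1..F}" "i' \<in> {1..F}" "i \<noteq> i'"
  shows "pkt k i \<inter> pkt k i' = {}"
proof -
  have "pkt k i \<noteq> pkt k i'"
    using packets_partition[OF assms(1)] assms by (auto dest: inj_onD)
  then show ?thesis
    using packets_partition[OF assms(1)] assms(2,3) unfolding partition_on_def disjoint_def by blast
qed

lemma simple_Q: "\<theta> \<in> {1..K} \<Longrightarrow> n \<in> {1..N} \<Longrightarrow> simple_function M (Q \<theta> n)"
  using finite_alphabets by blast

lemma simple_A: "\<theta> \<in> {1..K} \<Longrightarrow> n \<in> {1..N} \<Longrightarrow> simple_function M (A \<theta> n)"
  using finite_alphabets by blast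

lemma simple_joint:
  assumes "\<theta> \<in> {1..K}" "B \<subseteq> {1..N}" "C \<subseteq> {1..N}" "J \<subseteq> all_symbols"
  shows "simple_function M (joint \<theta> B C J)"
proof -
  have "finite B" "finite C" using assms finite_subset by blast+
  then show ?thesis
    unfolding joint_def[abs_def]
    by (intro simple_function_Pair simple_function_restrict simple_symbols)
      (use assms simple_A simple_Q in auto)
qed

lemma joint_entropy_mono:
  assumes "\<theta> \<in> {1..K}" "B' \<subseteq> {1..N}" "C' \<subseteq> {1..N}" "J' \<subseteq> all_symbols"
    and "B \<subseteq> B'" "C \<subseteq> C'" "J \<subseteq> J'"
  shows "joint_entropy \<theta> B C J \<le> joint_entropy \<theta> B' C' J'"
  unfolding joint_entropy_def
  by (rule entropy_mono[OF simple_joint], (fact)+, rule determined_byI)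
    (use assms(5-7) in \<open>unfold joint_eq_iff, blast\<close>)

lemma joint_entropy_submodular:
  assumes "\<theta> \<in> {1..K}" "B \<subseteq> {1..N}" "C \<subseteq> {1..N}" "J \<subseteq> all_symbols"
    and "B' \<subseteq> {1..N}" "C' \<subseteq> {1..N}" "J' \<subseteq> all_symbols"
  shows "joint_entropy \<theta> (B \<union> B') (C \<union> C') (J \<union> J') + joint_entropy \<theta> (B \<inter> B') (C \<inter> C') (J \<inter> J')
    \<le> joint_entropy \<theta> B C J + joint_entropy \<theta> B' C' J'"
  unfolding joint_entropy_def
proof (rule entropy_submodular)
  show "determined_by (joint \<theta> (B \<union> B') (C \<union> C') (J \<union> J'))
      (\<lambda>\<omega>. (joint \<theta> B C J \<omega>, joint \<theta> B' C' J' \<omega>))"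
    by (rule determined_byI) (unfold prod.inject joint_eq_iff, blast)
qed (use assms simple_joint in \<open>auto intro!: determined_byI simp: joint_eq_iff\<close>)

lemma joint_entropy_submodular':
  assumes "\<theta> \<in> {1..K}" "B \<subseteq> {1..N}" "C \<subseteq> {1..N}" "J \<subseteq> all_symbols"
    and "B' \<subseteq> {1..N}" "C' \<subseteq> {1..N}" "J' \<subseteq> all_symbols"
    and "U = B \<union> B'" "V = C \<union> C'" "X = J \<union> J'" "U' = B \<inter> B'" "V' = C \<inter> C'" "X' = J \<inter> J'"
  shows "joint_entropy \<theta> U V X + joint_entropy \<theta> U' V' X'
    \<le> joint_entropy \<theta> B C J + joint_entropy \<theta> B' C' J'"
  using joint_entropy_submodular[OF assms(1-7)] assms(8-13) by simp

lemma entropy_packet: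
  assumes "k \<in> {1..K}" "i \<in> {1..F}"
  shows "\<H>(packet k i) = real (card (pkt k i))"
proof -
  have "\<H>(packet k i) = real (card (Pair k ` pkt k i))"
    by (rule entropy_of_symbols_eqI)
      (use assms pkt_subset[OF assms] in \<open>auto simp: packet_def restrict_eq_restrict_iff\<close>)
  then show ?thesis by (simp add: card_image inj_on_def)
qed

text \<open>Equal packet entropies are equal packet sizes; this justifies counting type sizes in one
  file.\<close>

lemma card_pkt:
  assumes "k \<in> {1..K}" "k' \<in> {1..K}" "i \<in> {1..F}"
  shows "card (pkt k i) = card (pkt k' i)"
  using packets_entropy[OF assms] entropy_packet assms by simp

lemma one_file: "1 \<in> {1..K}" using pos by simp

lemma card_UN_pkt:
  assumes "k \<in> {1..K}" "I \<subseteq> {1..F}"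
  shows "card (\<Union>i\<in>I. pkt k i) = (\<Sum>i\<in>I. card (pkt 1 i))"
proof -
  have "card (\<Union>i\<in>I. pkt k i) = (\<Sum>i\<in>I. card (pkt k i))"
  proof (rule card_UN_disjoint)
    show "finite I" using assms(2) finite_subset by blast
    show "\<forall>i\<in>I. finite (pkt k i)"
      using pkt_subset[OF assms(1)] assms(2) by (meson finite_atLeastAtMost finite_subset subsetD)
    show "\<forall>i\<in>I. \<forall>j\<in>I. i \<noteq> j \<longrightarrow> pkt k i \<inter> pkt k j = {}"
      using disjoint_pkt[OF assms(1)] assms(2) by blast
  qed
  also have "\<dots> = (\<Sum>i\<in>I. card (pkt 1 i))"
    by (rule sum.cong[OF refl], rule card_pkt[OF assms(1) one_file]) (use assms(2) in blast)
  finally show ?thesis .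
qed

lemma entropy_exclusive_part:
  assumes k: "k \<in> {1..K}"
  shows "\<H>(exclusive_part k S) = real (type_size S)"
proof -
  let ?J = "Pair k ` (\<Union>i\<in>exclusive S. pkt k i)"
  have sub: "exclusive S \<subseteq> {1..F}" by (auto simp: exclusive_def)
  have "pkt k i \<subseteq> {1..L}" if "i \<in> exclusive S" for i
    by (rule pkt_subset[OF k]) (use that sub in blast)
  then have "?J \<subseteq> all_symbols" using k by blast
  then have "\<H>(exclusive_part k S) = real (card ?J)"
    by (rule entropy_of_symbols_eqI)
      (auto simp: exclusive_part_def packet_def restrict_eq_restrict_iff)
  also have "card ?J = card (\<Union>i\<in>exclusive S. pkt k i)" by (simp add: card_image inj_on_def)
  also have "\<dots> = type_size S" unfolding type_size_def by (rule card_UN_pkt[OF k sub])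
  finally show ?thesis .
qed

text \<open>Every packet has exactly one type, so sums over packets can be grouped by type.\<close>

lemma sum_type_size_filter:
  "(\<Sum>S | S \<subseteq> {1..N} \<and> R S. type_size S) = (\<Sum>i | i \<in> {1..F} \<and> R (packet_type i). card (pkt 1 i))"
proof -
  have "(\<Sum>i | i \<in> {1..F} \<and> R (packet_type i). card (pkt 1 i)) =
     (\<Sum>S | S \<subseteq> {1..N} \<and> R S. \<Sum>i | i \<in> {i. i \<in> {1..F} \<and> R (packet_type i)} \<and> packet_type i = S. card (pkt 1 i))"
    by (rule sum.group[symmetric]) (auto simp: packet_type_def)
  also have "\<dots> = (\<Sum>S | S \<subseteq> {1..N} \<and> R S. type_size S)"
    unfolding type_size_def
    by (intro sum.cong refl) (auto simp: exclusive_eq_packet_type)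
  finally show ?thesis by simp
qed

lemma UN_pkt:
  assumes "k \<in> {1..K}"
  shows "(\<Union>i\<in>{1..F}. pkt k i) = {1..L}"
  using packets_partition[OF assms] unfolding partition_on_def by simp

lemma sum_type_size: "(\<Sum>S | S \<subseteq> {1..N}. type_size S) = L"
proof -
  have "{i. i \<in> {1..F} \<and> True} = {1..F}" by auto
  then show ?thesis
    using sum_type_size_filter[of "\<lambda>_. True"] card_UN_pkt[OF one_file, of "{1..F}"] UN_pkt[OF one_file]
    by simp
qed

lemma type_size_empty: "type_size {} = 0"
proof -
  have "exclusive {} = {}" using stored_packets by (auto simp: exclusive_def)
  then show ?thesis by (simp add: type_size_def)
qed

lemma card_stored:
  assumes n: "n \<in> {1..N}"
  shows "card (stored n) = K * (\<Sum>S | S \<subseteq> {1..N} \<and> n \<in> S. type_size S)"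
proof -
  have sub: "st n \<subseteq> {1..F}" by (rule st_subset[OF n])
  have "stored n = Sigma {1..K} (\<lambda>k. \<Union>i\<in>st n. pkt k i)"
    by (auto simp: stored_def)
  also have "card \<dots> = (\<Sum>k\<in>{1..K}. card (\<Union>i\<in>st n. pkt k i))"
  proof (rule card_SigmaI)
    show "\<forall>k\<in>{1..K}. finite (\<Union>i\<in>st n. pkt k i)"
      using pkt_subset sub by (metis UN_least finite_atLeastAtMost finite_subset subsetD)
  qed simp
  also have "\<dots> = (\<Sum>k\<in>{1..K}. \<Sum>i\<in>st n. card (pkt 1 i))"
    by (rule sum.cong[OF refl]) (rule card_UN_pkt[OF _ sub])
  also have "\<dots> = K * (\<Sum>i\<in>st n. card (pkt 1 i))" by simp
  also have "st n = {i. i \<in> {1..F} \<and> n \<in> packet_type i}"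
    using sub n by (auto simp: packet_type_def)
  finally show ?thesis using sum_type_size_filter[of "\<lambda>S. n \<in> S"] by simp
qed

lemma sum_type_size_server_le:
  assumes n: "n \<in> {1..N}"
  shows "real (\<Sum>S | S \<subseteq> {1..N} \<and> n \<in> S. type_size S) \<le> \<mu> * real L"
proof -
  have "\<H>(storage n) = real (card (stored n))"
    by (rule entropy_of_symbols_eqI[OF stored_subset[OF n] storage_eq_iff])
  then have "real K * real (\<Sum>S | S \<subseteq> {1..N} \<and> n \<in> S. type_size S) \<le> real K * (\<mu> * real L)"
    using storage_capacity[OF n] card_stored[OF n] by (simp add: mult_ac del: of_nat_sum)
  then show ?thesis using pos by (simp del: of_nat_sum)
qed

end

section \<open>Lower bound on the download cost\<close>

text \<open>The sum of \<open>1 / l ^ i\<close> over \<open>i = 1, \<dots>, r\<close>, in the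
  recursive form that averaging over the servers produces.\<close>

primrec weight :: "nat \<Rightarrow> nat \<Rightarrow> real" where
  "weight 0 l = 0"
| "weight (Suc r) l = (1 + weight r l) / real l"

lemma weight_eq_sum: "1 + weight r l = (\<Sum>i\<le>r. 1 / real l ^ i)"
proof (induction r)
  case (Suc r)
  have "(\<Sum>i\<le>Suc r. 1 / real l ^ i) = 1 + (\<Sum>i\<le>r. 1 / real l ^ Suc i)"
    by (subst sum.atMost_Suc_shift) simp
  also have "(\<Sum>i\<le>r. 1 / real l ^ Suc i) = (\<Sum>i\<le>r. 1 / real l ^ i) / real l"
    by (simp add: sum_divide_distrib mult.commute)
  finally show ?case using Suc by simp
qed simp

context sc_pir_scheme
begin

definition stored_at :: "nat set \<Rightarrow> (nat \<times> nat) set" where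
  "stored_at P = (\<Union>n\<in>P. stored n)"

definition files_upto :: "nat \<Rightarrow> (nat \<times> nat) set" where
  "files_upto k = {1..k} \<times> {1..L}"

definition residual :: "nat \<Rightarrow> nat set \<Rightarrow> real" where
  "residual k P = joint_entropy k {1..N} {1..N} (files_upto k \<union> stored_at P)
     - joint_entropy k {} {1..N} (files_upto k \<union> stored_at P)"

lemma stored_at_subset: "P \<subseteq> {1..N} \<Longrightarrow> stored_at P \<subseteq> all_symbols"
  unfolding stored_at_def using stored_subset by blast

lemma files_upto_subset: "k \<le> K \<Longrightarrow> files_upto k \<subseteq> all_symbols"
  unfolding files_upto_def by auto

section \<open>Independence of queries and files, determined answers and decoding\<close>

lemma joint_entropy_symbols:
  assumes "\<theta> \<in> {1..K}" "J \<subseteq> all_symbols"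
  shows "joint_entropy \<theta> {} {} J = real (card J)"
  unfolding joint_entropy_def
  by (rule entropy_of_symbols_eqI[OF assms(2)]) (auto simp: joint_eq_iff)

lemma joint_entropy_all_queries:
  assumes t: "\<theta> \<in> {1..K}"
  shows "joint_entropy \<theta> {} {1..N} all_symbols = joint_entropy \<theta> {} {1..N} {} + real (card all_symbols)"
proof -
  have q: "queries \<theta> \<omega> = queries \<theta> \<omega>' \<longleftrightarrow> (\<forall>n\<in>{1..N}. Q \<theta> n \<omega> = Q \<theta> n \<omega>')" for \<omega> \<omega>'
    unfolding queries_def restrict_eq_restrict_iff ..
  have f: "all_files \<omega> = all_files \<omega>' \<longleftrightarrow> (\<forall>(k, j)\<in>all_symbols. W k j \<omega> = W k j \<omega>')" for \<omega> \<omega>'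
    unfolding all_files_def file_rv_def restrict_eq_restrict_iff by blast
  have sf: "simple_function M all_files" and Hf: "\<H>(all_files) = real (card all_symbols)"
    using entropy_of_symbols_eqI[OF order_refl f] by blast+
  have dq: "determined_by (queries \<theta>) (joint \<theta> {} {1..N} {})"
    and dq': "determined_by (joint \<theta> {} {1..N} {}) (queries \<theta>)"
    by (auto intro!: determined_byI simp: q joint_eq_iff)
  have sj: "simple_function M (joint \<theta> {} {1..N} {})" by (rule simple_joint[OF t]) auto
  have sq: "simple_function M (queries \<theta>)" by (rule simple_function_determined_by[OF sj dq])
  have Hq: "\<H>(queries \<theta>) = joint_entropy \<theta> {} {1..N} {}"
    unfolding joint_entropy_def by (rule entropy_eqI[OF sj dq dq'])
  have "joint_entropy \<theta> {} {1..N} all_symbols = \<H>(\<lambda>\<omega>. (queries \<theta> \<omega>, all_files \<omega>))"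
    unfolding joint_entropy_def
    by (rule entropy_eqI) (use sq sf in \<open>auto intro!: determined_byI simp: q f joint_eq_iff\<close>)
  also have "\<dots> = \<H>(queries \<theta>) + \<H>(all_files)"
    using mutual_information_eq_zero_iff[OF sq sf] queries_indep_files[OF t] by simp
  finally show ?thesis by (simp add: Hq Hf)
qed

text \<open>Independence of the full queries and files passes to every part. Subadditivity gives one
  inequality; the other adds three submodular inequalities, which say that enlarging the queries or
  the symbols cannot lower their mutual information.\<close>

lemma joint_entropy_queries:
  assumes t: "\<theta> \<in> {1..K}" and C: "C \<subseteq> {1..N}" and J: "J \<subseteq> all_symbols"
  shows "joint_entropy \<theta> {} C J = joint_entropy \<theta> {} C {} + real (card J)"
proof (rule antisym)
  have "joint_entropy \<theta> {} C J + joint_entropy \<theta> {} {} {} \<le> joint_entropy \<theta> {} C {} + joint_entropy \<theta> {} {} J"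
    by (rule joint_entropy_submodular'[OF t]) (use C J in auto)
  then show "joint_entropy \<theta> {} C J \<le> joint_entropy \<theta> {} C {} + real (card J)"
    using joint_entropy_symbols[OF t] J by simp
next
  have "joint_entropy \<theta> {} {1..N} all_symbols + joint_entropy \<theta> {} C J
     \<le> joint_entropy \<theta> {} C all_symbols + joint_entropy \<theta> {} {1..N} J"
    by (rule joint_entropy_submodular'[OF t]) (use C J in auto)
  moreover have "joint_entropy \<theta> {} C all_symbols + joint_entropy \<theta> {} {} J
     \<le> joint_entropy \<theta> {} C J + joint_entropy \<theta> {} {} all_symbols"
    by (rule joint_entropy_submodular'[OF t]) (use C J in auto)
  moreover have "joint_entropy \<theta> {} {1..N} J + joint_entropy \<theta> {} C {}
     \<le> joint_entropy \<theta> {} C J + joint_entropy \<theta> {} {1..N} {}"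
    by (rule joint_entropy_submodular'[OF t]) (use C J in auto)
  ultimately show "joint_entropy \<theta> {} C {} + real (card J) \<le> joint_entropy \<theta> {} C J"
    using joint_entropy_symbols[OF t] J joint_entropy_all_queries[OF t] by simp
qed

lemma joint_entropy_answer_determined:
  assumes t: "\<theta> \<in> {1..K}" and m: "m \<in> {1..N}"
  shows "joint_entropy \<theta> {m} {m} (stored m) = joint_entropy \<theta> {} {m} (stored m)"
proof -
  note st = storage_eq_iff
  have sZ: "simple_function M (storage m)"
    by (rule entropy_of_symbols_eqI[OF stored_subset[OF m] st])
  have sQ: "simple_function M (Q \<theta> m)" and sA: "simple_function M (A \<theta> m)"
    using simple_Q[OF t m] simple_A[OF t m] by blast+
  have sQZ: "simple_function M (\<lambda>\<omega>. (Q \<theta> m \<omega>, storage m \<omega>))" using sQ sZ by auto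
  have "joint_entropy \<theta> {m} {m} (stored m) = \<H>(\<lambda>\<omega>. ((Q \<theta> m \<omega>, storage m \<omega>), A \<theta> m \<omega>))"
    unfolding joint_entropy_def
    by (rule entropy_eqI) (use sQZ sA in \<open>auto intro!: determined_byI simp: st joint_eq_iff\<close>)
  also have "\<dots> = \<H>(\<lambda>\<omega>. (Q \<theta> m \<omega>, storage m \<omega>))"
    using conditional_entropy_eq_diff[OF sA sQZ] answer_determined[OF t m] by simp
  also have "\<dots> = joint_entropy \<theta> {} {m} (stored m)"
    unfolding joint_entropy_def
    by (rule entropy_eqI)
      (use simple_joint[OF t, of "{}" "{m}" "stored m"] stored_subset[OF m] m in
        \<open>auto intro!: determined_byI simp: st joint_eq_iff\<close>)
  finally show ?thesis .
qed

text \<open>An answer is determined by the query to the server and its storage, and submodularity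
  carries this over to any larger collection that contains both.\<close>

lemma joint_entropy_insert_answer:
  assumes t: "\<theta> \<in> {1..K}" and m: "m \<in> C" and B: "B \<subseteq> {1..N}" and C: "C \<subseteq> {1..N}"
    and J: "stored m \<subseteq> J" "J \<subseteq> all_symbols"
  shows "joint_entropy \<theta> (insert m B) C J = joint_entropy \<theta> B C J"
proof (cases "m \<in> B")
  case True
  then show ?thesis by (simp add: insert_absorb)
next
  case False
  have mN: "m \<in> {1..N}" using m C by blast
  have "joint_entropy \<theta> (insert m B) C J + joint_entropy \<theta> {} {m} (stored m)
     \<le> joint_entropy \<theta> {m} {m} (stored m) + joint_entropy \<theta> B C J"
    by (rule joint_entropy_submodular'[OF t]) (use assms mN False in auto)
  moreover have "joint_entropy \<theta> B C J \<le> joint_entropy \<theta> (insert m B) C J"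
    by (rule joint_entropy_mono[OF t]) (use assms mN in auto)
  ultimately show ?thesis using joint_entropy_answer_determined[OF t mN] by simp
qed

lemma joint_entropy_union_answers:
  assumes t: "\<theta> \<in> {1..K}" and P: "P \<subseteq> {1..N}" and B: "B \<subseteq> {1..N}"
    and J: "stored_at P \<subseteq> J" "J \<subseteq> all_symbols"
  shows "joint_entropy \<theta> (P \<union> B) {1..N} J = joint_entropy \<theta> B {1..N} J"
proof -
  have "finite P" using P finite_subset by blast
  then show ?thesis
    using P J(1)
  proof (induction P)
    case (insert m P)
    have "joint_entropy \<theta> (insert m (P \<union> B)) {1..N} J = joint_entropy \<theta> (P \<union> B) {1..N} J"
      by (rule joint_entropy_insert_answer[OF t]) (use insert B J in \<open>auto simp: stored_at_def\<close>)
    then show ?case using insert by (simp add: stored_at_def)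
  qed simp
qed

text \<open>Given all answers and queries, the desired file adds no entropy; submodularity keeps
  this true in the presence of further symbols \<open>J\<close>.\<close>

lemma joint_entropy_decodability:
  assumes t: "\<theta> \<in> {1..K}" and J: "J \<subseteq> all_symbols"
  shows "joint_entropy \<theta> {1..N} {1..N} (J \<union> {\<theta>} \<times> {1..L}) = joint_entropy \<theta> {1..N} {1..N} J"
proof -
  let ?T = "{\<theta>} \<times> {1..L}"
  have T: "?T \<subseteq> all_symbols" using t by auto
  have f: "file_rv \<theta> \<omega> = file_rv \<theta> \<omega>' \<longleftrightarrow> (\<forall>(k, j)\<in>?T. W k j \<omega> = W k j \<omega>')" for \<omega> \<omega>'
    unfolding file_rv_def restrict_eq_restrict_iff by auto
  have sf: "simple_function M (file_rv \<theta>)"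
    by (rule entropy_of_symbols_eqI[OF T f])
  let ?X = "\<lambda>\<omega>. (answers \<theta> \<omega>, queries \<theta> \<omega>)"
  have X: "?X \<omega> = ?X \<omega>' \<longleftrightarrow> (\<forall>n\<in>{1..N}. A \<theta> n \<omega> = A \<theta> n \<omega>') \<and> (\<forall>n\<in>{1..N}. Q \<theta> n \<omega> = Q \<theta> n \<omega>')" for \<omega> \<omega>'
    unfolding answers_def queries_def restrict_eq_restrict_iff prod.inject ..
  have sj: "simple_function M (joint \<theta> {1..N} {1..N} {})" by (rule simple_joint[OF t]) auto
  have d: "determined_by ?X (joint \<theta> {1..N} {1..N} {})" "determined_by (joint \<theta> {1..N} {1..N} {}) ?X"
    by (rule determined_byI; unfold X joint_eq_iff; blast)+
  have sX: "simple_function M ?X"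
    by (rule simple_function_determined_by[OF sj d(1)])
  have "joint_entropy \<theta> {1..N} {1..N} ?T = \<H>(\<lambda>\<omega>. (?X \<omega>, file_rv \<theta> \<omega>))"
    unfolding joint_entropy_def
    by (rule entropy_eqI, use sX sf in simp; rule determined_byI)
      (unfold prod.inject[of "?X _"] X f joint_eq_iff, blast+)
  also have "\<dots> = \<H>(?X)"
    using conditional_entropy_eq_diff[OF sf sX] decodability[OF t] by simp
  also have "\<dots> = joint_entropy \<theta> {1..N} {1..N} {}"
    unfolding joint_entropy_def by (rule entropy_eqI[OF sj d])
  finally have *: "joint_entropy \<theta> {1..N} {1..N} ?T = joint_entropy \<theta> {1..N} {1..N} {}" .
  have "joint_entropy \<theta> {1..N} {1..N} (J \<union> ?T) + joint_entropy \<theta> {1..N} {1..N} (J \<inter> ?T)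
      \<le> joint_entropy \<theta> {1..N} {1..N} J + joint_entropy \<theta> {1..N} {1..N} ?T"
    by (rule joint_entropy_submodular'[OF t]) (use J T in auto)
  moreover have "joint_entropy \<theta> {1..N} {1..N} {} \<le> joint_entropy \<theta> {1..N} {1..N} (J \<inter> ?T)"
    by (rule joint_entropy_mono[OF t]) (use J in auto)
  moreover have "joint_entropy \<theta> {1..N} {1..N} J \<le> joint_entropy \<theta> {1..N} {1..N} (J \<union> ?T)"
    by (rule joint_entropy_mono[OF t]) (use J T in auto)
  ultimately show ?thesis using * by simp
qed

section \<open>Consequences of privacy\<close>

lemma joint_entropy_privacy_stored:
  assumes t: "\<theta> \<in> {1..K}" and t': "\<theta>' \<in> {1..K}" and m: "m \<in> {1..N}"
    and B: "B \<subseteq> {m}" and J: "J \<subseteq> stored m"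
  shows "joint_entropy \<theta> B {m} J = joint_entropy \<theta>' B {m} J"
proof -
  have "determined_by (symbols J) (storage m)"
    by (rule determined_byI) (use J in \<open>unfold storage_eq_iff symbols_eq_iff, blast\<close>)
  then obtain g where g: "\<And>\<omega>. \<omega> \<in> space M \<Longrightarrow> symbols J \<omega> = g (storage m \<omega>)"
    using determined_by_factor by blast
  \<comment> \<open>Privacy compares the triple of query, answer and storage at server
    \<open>m\<close>; \<open>f\<close> reads the entries of \<open>joint\<close> off that
    triple.\<close>
  define f where "f = (\<lambda>(q, a, z). (\<lambda>n\<in>B. a :: 'a, \<lambda>n\<in>{m}. q :: 'q, g z))"
  define X where "X \<tau> = (\<lambda>\<omega>. (Q \<tau> m \<omega>, A \<tau> m \<omega>, storage m \<omega>))" for \<tau>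
  have sZ: "simple_function M (storage m)"
    by (rule entropy_of_symbols_eqI[OF stored_subset[OF m] storage_eq_iff])
  have sX: "simple_function M (X \<tau>)" if "\<tau> \<in> {1..K}" for \<tau>
    unfolding X_def using simple_Q[OF that m] simple_A[OF that m] sZ by auto
  have je: "joint_entropy \<tau> B {m} J = \<H>(f \<circ> X \<tau>)" if "\<tau> \<in> {1..K}" for \<tau>
    unfolding joint_entropy_def
  proof (rule entropy_cong_space)
    fix \<omega> assume "\<omega> \<in> space M"
    then show "joint \<tau> B {m} J \<omega> = (f \<circ> X \<tau>) \<omega>"
      using B by (auto simp: joint_def f_def X_def g restrict_def fun_eq_iff)
  qed
  have "\<H>(f \<circ> X \<theta>) = \<H>(f \<circ> X \<theta>')"
  proof (rule entropy_eq_of_distr_eq)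
    have mX: "X \<tau> \<in> measurable M (count_space UNIV)" if "\<tau> \<in> {1..K}" for \<tau>
      using measurable_simple_function[OF sX[OF that]] .
    have "distr M (count_space UNIV) (f \<circ> X \<theta>) = distr (distr M (count_space UNIV) (X \<theta>)) (count_space UNIV) f"
      by (rule distr_distr[symmetric]) (use mX[OF t] in auto)
    also have "\<dots> = distr (distr M (count_space UNIV) (X \<theta>')) (count_space UNIV) f"
      using privacy[OF t t' m] by (simp add: X_def)
    also have "\<dots> = distr M (count_space UNIV) (f \<circ> X \<theta>')"
      by (rule distr_distr) (use mX[OF t'] in auto)
    finally show "distr M (count_space UNIV) (f \<circ> X \<theta>) = distr M (count_space UNIV) (f \<circ> X \<theta>')" .
  qed (use sX t t' in \<open>auto intro: simple_function_compose\<close>)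
  then show ?thesis using je t t' by simp
qed

text \<open>Symbols not stored at \<open>m\<close> are independent of the query, the answer and the
  stored symbols there. For the lower bound all of \<open>stored m\<close> is added: the answer
  becomes determined, and the entropy is known explicitly.\<close>

lemma joint_entropy_split_stored:
  assumes t: "\<theta> \<in> {1..K}" and m: "m \<in> {1..N}" and J: "J \<subseteq> all_symbols"
  shows "joint_entropy \<theta> {m} {m} J = joint_entropy \<theta> {m} {m} (J \<inter> stored m) + real (card (J - stored m))"
proof -
  have s: "stored m \<subseteq> all_symbols" by (rule stored_subset[OF m])
  have fin: "finite J" "finite (stored m)" using J s finite_subset by blast+
  have "joint_entropy \<theta> {m} {m} J + joint_entropy \<theta> {} {} {}
     \<le> joint_entropy \<theta> {m} {m} (J \<inter> stored m) + joint_entropy \<theta> {} {} (J - stored m)"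
    by (rule joint_entropy_submodular'[OF t]) (use m J in auto)
  moreover have "joint_entropy \<theta> {} {} {} = 0" "joint_entropy \<theta> {} {} (J - stored m) = real (card (J - stored m))"
    using joint_entropy_symbols[OF t, of "{}"] joint_entropy_symbols[OF t, of "J - stored m"] J by auto
  ultimately have 1: "joint_entropy \<theta> {m} {m} J \<le> joint_entropy \<theta> {m} {m} (J \<inter> stored m) + real (card (J - stored m))"
    by simp
  have "joint_entropy \<theta> {m} {m} (J \<union> stored m) + joint_entropy \<theta> {m} {m} (J \<inter> stored m)
     \<le> joint_entropy \<theta> {m} {m} J + joint_entropy \<theta> {m} {m} (stored m)"
    by (rule joint_entropy_submodular'[OF t]) (use m J s in auto)
  moreover have "joint_entropy \<theta> {m} {m} (J \<union> stored m) = joint_entropy \<theta> {} {m} (J \<union> stored m)"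
    by (rule joint_entropy_insert_answer[OF t]) (use m J s in auto)
  moreover have "real (card (J \<union> stored m)) = real (card (J - stored m)) + real (card (stored m))"
  proof -
    have "J \<union> stored m = (J - stored m) \<union> stored m" "(J - stored m) \<inter> stored m = {}" by blast+
    then show ?thesis using card_Un_disjoint[of "J - stored m" "stored m"] fin by (metis finite_Diff of_nat_add)
  qed
  moreover have "joint_entropy \<theta> {} {m} I = joint_entropy \<theta> {} {m} {} + real (card I)"
    if "I = stored m \<or> I = J \<union> stored m" for I
    by (rule joint_entropy_queries[OF t]) (use that m J s in blast)+
  note this[of "stored m"] this[of "J \<union> stored m"]
  ultimately show ?thesis
    using 1 joint_entropy_answer_determined[OF t m] by simp
qed

text \<open>The conditional entropy of an answer, given its query and arbitrary symbols
  \<open>J\<close>, does not reveal the desired file: the stored part of \<open>J\<close> is covered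
  by privacy, and the rest contributes only its size.\<close>

lemma joint_entropy_privacy:
  assumes t: "\<theta> \<in> {1..K}" and t': "\<theta>' \<in> {1..K}" and m: "m \<in> {1..N}" and J: "J \<subseteq> all_symbols"
  shows "joint_entropy \<theta> {m} {m} J - joint_entropy \<theta> {} {m} J
       = joint_entropy \<theta>' {m} {m} J - joint_entropy \<theta>' {} {m} J"
  using joint_entropy_split_stored[OF t m J] joint_entropy_split_stored[OF t' m J]
    joint_entropy_privacy_stored[OF t t' m, of "{m}" "J \<inter> stored m"]
    joint_entropy_privacy_stored[OF t t' m, of "{}" "{}"]
    joint_entropy_queries[OF t _ J, of "{m}"] joint_entropy_queries[OF t' _ J, of "{m}"] m
  by simp

text \<open>Given \<open>J\<close> and its own query, an answer is independent of the other queries.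
  Conditioning gives one inequality; for the other, revealing \<open>stored m\<close> makes the
  answer determined on both sides, and only query entropies remain.\<close>

lemma joint_entropy_answer_other_queries:
  assumes t: "\<theta> \<in> {1..K}" and m: "m \<in> {1..N}" and J: "J \<subseteq> all_symbols"
  shows "joint_entropy \<theta> {m} {m} J - joint_entropy \<theta> {} {m} J
       = joint_entropy \<theta> {m} {1..N} J - joint_entropy \<theta> {} {1..N} J"
proof -
  let ?J = "J \<union> stored m"
  have s: "?J \<subseteq> all_symbols" using J stored_subset[OF m] by simp
  have "joint_entropy \<theta> {m} {1..N} ?J + joint_entropy \<theta> {m} {m} J
     \<le> joint_entropy \<theta> {m} {1..N} J + joint_entropy \<theta> {m} {m} ?J"
    by (rule joint_entropy_submodular'[OF t]) (use m J s in auto)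
  moreover have "joint_entropy \<theta> {m} {1..N} ?J = joint_entropy \<theta> {} {1..N} ?J"
    "joint_entropy \<theta> {m} {m} ?J = joint_entropy \<theta> {} {m} ?J"
    by (rule joint_entropy_insert_answer[OF t]; use m J s in auto)+
  moreover have "joint_entropy \<theta> {m} {1..N} J + joint_entropy \<theta> {} {m} J
     \<le> joint_entropy \<theta> {m} {m} J + joint_entropy \<theta> {} {1..N} J"
    by (rule joint_entropy_submodular'[OF t]) (use m J in auto)
  moreover have "joint_entropy \<theta> {} C I = joint_entropy \<theta> {} C {} + real (card I)"
    if "C = {m} \<or> C = {1..N}" "I = J \<or> I = ?J" for C I
    by (rule joint_entropy_queries[OF t]) (use that m J s in blast)+
  note this[of "{m}" J] this[of "{m}" ?J] this[of "{1..N}" J] this[of "{1..N}" ?J]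
  ultimately show ?thesis by simp
qed

lemma joint_entropy_subadditive_answers:
  assumes t: "\<theta> \<in> {1..K}" and B: "B \<subseteq> {1..N}" and J: "J \<subseteq> all_symbols"
  shows "joint_entropy \<theta> B {1..N} J - joint_entropy \<theta> {} {1..N} J
     \<le> (\<Sum>m\<in>B. joint_entropy \<theta> {m} {1..N} J - joint_entropy \<theta> {} {1..N} J)"
proof -
  have "finite B" using B finite_subset by blast
  then show ?thesis
    using B
  proof (induction B)
    case (insert m B)
    have "joint_entropy \<theta> (insert m B) {1..N} J + joint_entropy \<theta> {} {1..N} J
       \<le> joint_entropy \<theta> {m} {1..N} J + joint_entropy \<theta> B {1..N} J"
      by (rule joint_entropy_submodular'[OF t]) (use insert J in auto)
    then show ?case using insert by simp
  qed simp
qed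

section \<open>Recursion for the residual entropy\<close>

lemma residual_nonneg: "k \<in> {1..K} \<Longrightarrow> P \<subseteq> {1..N} \<Longrightarrow> 0 \<le> residual k P"
  unfolding residual_def
  using joint_entropy_mono[of k "{1..N}" "{1..N}" "files_upto k \<union> stored_at P" "{}" "{1..N}" "files_upto k \<union> stored_at P"]
    files_upto_subset[of k] stored_at_subset[of P] by simp

text \<open>The answer of \<open>m\<close> is revealed first, then its whole storage. Together with
  the query the storage determines that answer, so nothing is counted twice.\<close>

lemma residual_ge_insert:
  assumes k: "k \<in> {1..K}" and P: "P \<subseteq> {1..N}" and m: "m \<in> {1..N}"
  defines "J \<equiv> files_upto k \<union> stored_at P"
  shows "joint_entropy k {m} {1..N} J - joint_entropy k {} {1..N} J + residual k (insert m P) \<le> residual k P"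
proof -
  let ?J = "J \<union> stored m"
  have J: "J \<subseteq> all_symbols" "?J \<subseteq> all_symbols"
    unfolding J_def using files_upto_subset[of k] stored_at_subset[OF P] stored_subset[OF m] k by auto
  have "joint_entropy k {1..N} {1..N} ?J + joint_entropy k {m} {1..N} J
    \<le> joint_entropy k {1..N} {1..N} J + joint_entropy k {m} {1..N} ?J"
    by (rule joint_entropy_submodular'[OF k]) (use m J in auto)
  moreover have "joint_entropy k {m} {1..N} ?J = joint_entropy k {} {1..N} ?J"
    by (rule joint_entropy_insert_answer[OF k]) (use m J in auto)
  moreover have "files_upto k \<union> stored_at (insert m P) = ?J"
    unfolding J_def stored_at_def by auto
  ultimately show ?thesis unfolding residual_def by (simp add: J_def[symmetric])
qed

lemma card_new_symbols:
  assumes k: "Suc k \<in> {1..K}" and P: "P \<subseteq> {1..N}"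
  shows "real (card (files_upto (Suc k) \<union> stored_at P)) - real (card (files_upto k \<union> stored_at P))
     = (\<Sum>S | S \<subseteq> {1..N} \<and> S \<inter> P = {}. real (type_size S))"
proof -
  let ?I = "{i. i \<in> {1..F} \<and> packet_type i \<inter> P = {}}"
  let ?new = "Pair (Suc k) ` (\<Union>i\<in>?I. pkt (Suc k) i)"
  have new: "files_upto (Suc k) \<union> stored_at P = (files_upto k \<union> stored_at P) \<union> ?new" (is "?l = ?r")
  proof
    have "pkt (Suc k) i \<subseteq> {1..L}" if "i \<in> ?I" for i
      by (rule pkt_subset[OF k]) (use that in blast)
    then show "?r \<subseteq> ?l" by (auto simp: files_upto_def)
    show "?l \<subseteq> ?r"
    proof
      fix p assume p: "p \<in> ?l"
      show "p \<in> ?r"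
      proof (cases "p \<in> files_upto k \<union> stored_at P")
        case False
        then obtain j where j: "p = (Suc k, j)" "j \<in> {1..L}"
          using p unfolding files_upto_def by (auto simp: le_Suc_eq)
        then obtain i where i: "i \<in> {1..F}" "j \<in> pkt (Suc k) i" using UN_pkt[OF k] by blast
        have "packet_type i \<inter> P = {}"
          using False i k j unfolding packet_type_def stored_at_def stored_def by blast
        then show ?thesis using i j by blast
      qed simp
    qed
  qed
  have disj: "(files_upto k \<union> stored_at P) \<inter> ?new = {}"
  proof -
    have False if i: "i \<in> ?I" "j \<in> pkt (Suc k) i" and s: "(Suc k, j) \<in> stored n" "n \<in> P" for i j n
    proof -
      obtain i' where i': "i' \<in> st n" "j \<in> pkt (Suc k) i'" using s unfolding stored_def by blast
      have "i' \<in> {1..F}" using i' s P st_subset by blast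
      then have "i = i'" using disjoint_pkt[OF k, of i i'] i i' by blast
      then show False using i i' s P unfolding packet_type_def by blast
    qed
    then show ?thesis unfolding stored_at_def files_upto_def by auto
  qed
  have "finite (files_upto (Suc k) \<union> stored_at P)"
    using finite_subset[OF stored_at_subset[OF P]] by (simp add: files_upto_def)
  then have fin: "finite (files_upto k \<union> stored_at P)" "finite ?new"
    unfolding new by blast+
  have "card ?new = card (\<Union>i\<in>?I. pkt (Suc k) i)" by (simp add: card_image inj_on_def)
  also have "\<dots> = (\<Sum>i\<in>?I. card (pkt 1 i))" by (rule card_UN_pkt[OF k]) auto
  also have "\<dots> = (\<Sum>S | S \<subseteq> {1..N} \<and> S \<inter> P = {}. type_size S)"
    by (rule sum_type_size_filter[symmetric])
  finally show ?thesis unfolding new using card_Un_disjoint[OF fin disj] by simp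
qed

text \<open>The answers for file \<open>k + 1\<close> yield the unknown part of that file by
  decoding and then \<open>residual (Suc k) P\<close>. Answers from \<open>P\<close> are determined
  by the known storage; the others are bounded one by one, and privacy trades each for the answer
  given when file \<open>k\<close> is desired.\<close>

lemma sum_residual_ge:
  assumes k: "k \<in> {1..K}" "Suc k \<in> {1..K}" and P: "P \<subseteq> {1..N}"
  shows "(\<Sum>S | S \<subseteq> {1..N} \<and> S \<inter> P = {}. real (type_size S)) + residual (Suc k) P
      + (\<Sum>m\<in>{1..N} - P. residual k (insert m P)) \<le> real (card ({1..N} - P)) * residual k P"
proof -
  let ?J = "files_upto k \<union> stored_at P" and ?J' = "files_upto (Suc k) \<union> stored_at P"
  have J: "?J \<subseteq> all_symbols" "?J' \<subseteq> all_symbols"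
    using files_upto_subset[of k] files_upto_subset[of "Suc k"] stored_at_subset[OF P] k by auto
  have "joint_entropy (Suc k) {1..N} {1..N} ?J' = joint_entropy (Suc k) {1..N} {1..N} (?J \<union> {Suc k} \<times> {1..L})"
    by (rule arg_cong[where f = "joint_entropy (Suc k) {1..N} {1..N}"])
      (auto simp: files_upto_def le_Suc_eq)
  also have "\<dots> = joint_entropy (Suc k) {1..N} {1..N} ?J"
    by (rule joint_entropy_decodability[OF k(2) J(1)])
  also have "\<dots> = joint_entropy (Suc k) (P \<union> ({1..N} - P)) {1..N} ?J"
    using P by (simp add: Un_absorb1)
  also have "\<dots> = joint_entropy (Suc k) ({1..N} - P) {1..N} ?J"
    by (rule joint_entropy_union_answers[OF k(2) P]) (use J in auto)
  finally have "residual (Suc k) P + (real (card ?J') - real (card ?J))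
      = joint_entropy (Suc k) ({1..N} - P) {1..N} ?J - joint_entropy (Suc k) {} {1..N} ?J"
    unfolding residual_def
    using joint_entropy_queries[OF k(2) order_refl J(1)] joint_entropy_queries[OF k(2) order_refl J(2)] by simp
  also have "\<dots> \<le> (\<Sum>m\<in>{1..N} - P. joint_entropy (Suc k) {m} {1..N} ?J - joint_entropy (Suc k) {} {1..N} ?J)"
    by (rule joint_entropy_subadditive_answers[OF k(2) _ J(1)]) auto
  also have "\<dots> = (\<Sum>m\<in>{1..N} - P. joint_entropy k {m} {1..N} ?J - joint_entropy k {} {1..N} ?J)"
  proof (rule sum.cong[OF refl])
    fix m assume "m \<in> {1..N} - P"
    then have m: "m \<in> {1..N}" by simp
    show "joint_entropy (Suc k) {m} {1..N} ?J - joint_entropy (Suc k) {} {1..N} ?J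
        = joint_entropy k {m} {1..N} ?J - joint_entropy k {} {1..N} ?J"
      using joint_entropy_answer_other_queries[OF k(1) m J(1)] joint_entropy_answer_other_queries[OF k(2) m J(1)]
        joint_entropy_privacy[OF k m J(1)] by simp
  qed
  also have "\<dots> \<le> (\<Sum>m\<in>{1..N} - P. residual k P - residual k (insert m P))"
    by (rule sum_mono) (use residual_ge_insert[OF k(1) P] in \<open>simp add: algebra_simps\<close>)
  also have "\<dots> = real (card ({1..N} - P)) * residual k P - (\<Sum>m\<in>{1..N} - P. residual k (insert m P))"
    by (simp add: sum_subtractf)
  finally show ?thesis using card_new_symbols[OF k(2) P] by simp
qed

text \<open>The outer induction is on the number \<open>r\<close> of files still to be decoded, the
  inner one on the number of servers outside \<open>P\<close>; \<open>sum_residual_ge\<close> uses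
  both hypotheses at once.\<close>

lemma residual_lower_bound:
  assumes "r < K" "P \<subseteq> {1..N}"
  shows "(\<Sum>S | S \<subseteq> {1..N} \<and> S \<inter> P = {}. real (type_size S) * weight r (card S)) \<le> residual (K - r) P"
  using assms
proof (induction r arbitrary: P)
  case 0
  then show ?case using residual_nonneg[of K P] pos by simp
next
  case (Suc r)
  let ?k = "K - Suc r"
  have k: "?k \<in> {1..K}" "Suc ?k \<in> {1..K}" and Suc_k: "Suc ?k = K - r" using Suc.prems by auto
  note IH_r = Suc.IH and Suc_r = Suc.prems(1)
  from Suc.prems(2) show ?case
  proof (induction "card ({1..N} - P)" arbitrary: P)
    case 0
    then have "P = {1..N}" by auto
    \<comment> \<open>Only the empty type avoids all servers, and it holds no packet.\<close>
    then have "{S. S \<subseteq> {1..N} \<and> S \<inter> P = {}} = {{}}" by auto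
    then show ?case using residual_nonneg[OF k(1) 0(2)] by (simp add: type_size_empty)
  next
    case (Suc c)
    let ?D = "\<lambda>P. {S. S \<subseteq> {1..N} \<and> S \<inter> P = {}}"
    let ?w = "\<lambda>S. real (type_size S) * weight (Suc r) (card S)"
    have fin: "finite (?D P)" by simp
    have IH: "(\<Sum>S\<in>?D (insert m P). ?w S) \<le> residual ?k (insert m P)" if m: "m \<in> {1..N} - P" for m
    proof (rule Suc.hyps(1))
      have "{1..N} - insert m P = ({1..N} - P) - {m}" by auto
      then show "c = card ({1..N} - insert m P)" using m Suc.hyps(2) by simp
    qed (use m Suc.prems in auto)
    \<comment> \<open>Each \<open>S\<close> splits the factor \<open>Suc c\<close> into its
      \<open>card S\<close> members and the servers outside both \<open>P\<close> and
      \<open>S\<close>; the recursion of \<open>weight\<close> turns the first share into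
      \<open>1 + weight r (card S)\<close>.\<close>
    have total: "real (Suc c) * (\<Sum>S\<in>?D P. ?w S)
        = (\<Sum>S\<in>?D P. real (type_size S)) + (\<Sum>S\<in>?D P. real (type_size S) * weight r (card S))
          + (\<Sum>S\<in>?D P. real (card ({1..N} - P - S)) * ?w S)"
    proof -
      have "real (Suc c) * ?w S = real (type_size S) + real (type_size S) * weight r (card S)
            + real (card ({1..N} - P - S)) * ?w S" if S: "S \<in> ?D P" for S
      proof (cases "S = {}")
        case True
        then show ?thesis by (simp add: type_size_empty)
      next
        case False
        have finS: "finite S" using S finite_subset by blast
        then have cS: "0 < card S" using False by (simp add: card_gt_0_iff)
        have "card ({1..N} - P - S) = Suc c - card S"
          unfolding Suc.hyps(2) by (rule card_Diff_subset[OF finS]) (use S in auto)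
        moreover have "card S \<le> Suc c"
          unfolding Suc.hyps(2) by (rule card_mono) (use S in auto)
        ultimately have "real (card ({1..N} - P - S)) = real (Suc c) - real (card S)" by simp
        moreover have "real (card S) * ?w S = real (type_size S) * (1 + weight r (card S))"
          using cS by simp
        ultimately show ?thesis by (simp only: left_diff_distrib distrib_left)
      qed
      then show ?thesis by (simp add: sum_distrib_left sum.distrib)
    qed
    \<comment> \<open>Double counting of the pairs of a type \<open>S\<close> avoiding
      \<open>P\<close> and a server \<open>m\<close> outside both \<open>P\<close> and
      \<open>S\<close>.\<close>
    have "(\<Sum>S\<in>?D P. real (card ({1..N} - P - S)) * ?w S) = (\<Sum>m\<in>{1..N} - P. \<Sum>S\<in>?D (insert m P). ?w S)"
    proof -
      have "(\<Sum>S\<in>?D P. real (card ({1..N} - P - S)) * ?w S) = (\<Sum>S\<in>?D P. \<Sum>m | m \<in> {1..N} - P \<and> m \<notin> S. ?w S)"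
        by (rule sum.cong) (simp_all add: set_diff_eq)
      also have "\<dots> = (\<Sum>m\<in>{1..N} - P. \<Sum>S | S \<in> ?D P \<and> m \<notin> S. ?w S)"
        by (rule sum.swap_restrict) auto
      also have "\<dots> = (\<Sum>m\<in>{1..N} - P. \<Sum>S\<in>?D (insert m P). ?w S)"
        by (intro sum.cong refl) auto
      finally show ?thesis .
    qed
    also have "\<dots> \<le> (\<Sum>m\<in>{1..N} - P. residual ?k (insert m P))"
      by (rule sum_mono) (rule IH)
    finally have "(\<Sum>S\<in>?D P. real (card ({1..N} - P - S)) * ?w S) \<le> (\<Sum>m\<in>{1..N} - P. residual ?k (insert m P))" .
    moreover have "(\<Sum>S\<in>?D P. real (type_size S) * weight r (card S)) \<le> residual (Suc ?k) P"
      unfolding Suc_k by (rule IH_r) (use Suc_r Suc.prems in auto)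
    ultimately have "real (Suc c) * (\<Sum>S\<in>?D P. ?w S) \<le> real (Suc c) * residual ?k P"
      using sum_residual_ge[OF k Suc.prems] unfolding total Suc.hyps(2)[symmetric] by linarith
    then show ?case by (simp del: of_nat_Suc weight.simps)
  qed
qed

text \<open>Decoding file \<open>1\<close> accounts for \<open>L\<close> symbols of the download and
  leaves \<open>residual 1 {}\<close>, which is bounded below with the remaining
  \<open>K - 1\<close> files.\<close>

theorem download_lower_bound:
  "(\<Sum>S | S \<subseteq> {1..N}. real (type_size S) * (\<Sum>i<K. 1 / real (card S) ^ i)) \<le> download 1"
proof -
  have s: "(\<Sum>i<K. 1 / real (card S) ^ i) = 1 + weight (K - 1) (card S)" for S
    using weight_eq_sum[of "K - 1" "card S"] pos lessThan_Suc_atMost[of "K - 1"] by simp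
  have f1: "files_upto 1 \<subseteq> all_symbols" using files_upto_subset[of 1] pos by simp
  have card1: "real (card (files_upto 1)) = real L" by (simp add: files_upto_def)
  have "joint_entropy 1 {1..N} {1..N} {} = joint_entropy 1 {1..N} {1..N} ({} \<union> {1} \<times> {1..L})"
    by (rule joint_entropy_decodability[OF one_file, symmetric]) simp
  also have "{} \<union> {1} \<times> {1..L} = files_upto 1 \<union> stored_at {}"
    by (simp add: files_upto_def stored_at_def)
  finally have "residual 1 {} + real L = joint_entropy 1 {1..N} {1..N} {} - joint_entropy 1 {} {1..N} {}"
    unfolding residual_def
    using joint_entropy_queries[OF one_file order_refl f1] card1 by (simp add: stored_at_def)
  also have "\<dots> \<le> (\<Sum>m\<in>{1..N}. joint_entropy 1 {m} {1..N} {} - joint_entropy 1 {} {1..N} {})"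
    by (rule joint_entropy_subadditive_answers[OF one_file]) auto
  also have "\<dots> \<le> (\<Sum>m\<in>{1..N}. \<H>(A 1 m))"
  proof (rule sum_mono)
    fix m assume m: "m \<in> {1..N}"
    have "joint_entropy 1 {m} {1..N} {} + joint_entropy 1 {} {} {} \<le> joint_entropy 1 {m} {} {} + joint_entropy 1 {} {1..N} {}"
      by (rule joint_entropy_submodular'[OF one_file]) (use m in auto)
    moreover have "joint_entropy 1 {m} {} {} = \<H>(A 1 m)"
      unfolding joint_entropy_def
      by (rule entropy_eqI[OF simple_A[OF one_file m]]) (auto intro!: determined_byI simp: joint_eq_iff)
    ultimately show "joint_entropy 1 {m} {1..N} {} - joint_entropy 1 {} {1..N} {} \<le> \<H>(A 1 m)"
      using joint_entropy_symbols[OF one_file, of "{}"] by simp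
  qed
  finally have "real L + residual 1 {} \<le> download 1" by (simp add: download_def)
  moreover have "(\<Sum>S | S \<subseteq> {1..N}. real (type_size S) * weight (K - 1) (card S)) \<le> residual 1 {}"
    using residual_lower_bound[of "K - 1" "{}"] pos by simp
  moreover have "(\<Sum>S | S \<subseteq> {1..N}. real (type_size S)) = real L"
    using sum_type_size by (metis of_nat_sum)
  ultimately have "(\<Sum>S | S \<subseteq> {1..N}. real (type_size S) + real (type_size S) * weight (K - 1) (card S)) \<le> download 1"
    by (simp only: sum.distrib)
  then show ?thesis by (simp only: s distrib_left mult_1_right)
qed

end

section \<open>Convexity and the optimal storage\<close>

text \<open>The graph of \<open>1 / l ^ i\<close> lies above its tangent at \<open>m\<close>. With
  \<open>x = m / l\<close> this follows from Bernoulli's inequality for \<open>x ^ i\<close> and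
  from \<open>1 - 1 / x \<le> x - 1\<close>.\<close>

lemma power_inverse_ge_tangent:
  fixes l m :: real
  assumes "l > 0" "m > 0"
  shows "1 / m ^ i - real i * (l - m) / m ^ Suc i \<le> 1 / l ^ i"
proof -
  define x where "x = m / l"
  have x: "x > 0" and inv: "l / m = 1 / x" using assms by (auto simp: x_def)
  have "0 \<le> (x - 1)\<^sup>2 / x" using x by simp
  also have "(x - 1)\<^sup>2 / x = (x - 1) - (1 - 1 / x)" using x by (simp add: field_simps power2_eq_square)
  finally have "1 - 1 / x \<le> x - 1" by simp
  then have "1 + real i * (1 - 1 / x) \<le> 1 + real i * (x - 1)" by (simp add: mult_left_mono)
  also have "\<dots> \<le> (1 + (x - 1)) ^ i" by (rule Bernoulli_inequality) (use x in simp)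
  finally have "1 + real i * (1 - l / m) \<le> x ^ i" by (simp add: inv)
  then have "(1 + real i * (1 - l / m)) / m ^ i \<le> x ^ i / m ^ i"
    using assms by (simp add: divide_right_mono)
  also have "x ^ i / m ^ i = 1 / l ^ i" using assms by (simp add: x_def power_divide)
  finally show ?thesis using assms by (simp add: field_simps)
qed

text \<open>The reciprocal of the claimed capacity, that is, the optimal download per file
  symbol.\<close>

definition inverse_capacity :: "nat \<Rightarrow> nat \<Rightarrow> real" where
  "inverse_capacity K m = (\<Sum>i<K. 1 / real m ^ i)"

definition slope :: "nat \<Rightarrow> nat \<Rightarrow> real" where
  "slope K m = (\<Sum>i<K. real i / real m ^ Suc i)"

text \<open>
  \<open>inverse_capacity K\<close> is strictly convex and strictly decreasing; \<open>tangent_gap K m l\<close> is the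
  distance at \<open>l\<close> to its tangent at \<open>m\<close>, whose slope is \<open>- slope K m\<close>.
\<close>

definition tangent_gap :: "nat \<Rightarrow> nat \<Rightarrow> nat \<Rightarrow> real" where
  "tangent_gap K m l = inverse_capacity K l - inverse_capacity K m + slope K m * (real l - real m)"

lemma inverse_capacity_pos: "1 \<le> K \<Longrightarrow> 0 < inverse_capacity K m"
  unfolding inverse_capacity_def by (rule sum_pos2[of _ 0]) auto

lemma slope_pos: "2 \<le> K \<Longrightarrow> 1 \<le> m \<Longrightarrow> 0 < slope K m"
  unfolding slope_def by (rule sum_pos2[of _ 1]) auto

text \<open>The gap is a sum of convexity gaps of the functions \<open>1 / l ^ i\<close>. Strictness
  comes from the term \<open>i = 1\<close>, present because \<open>2 \<le> K\<close>, which equals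
  \<open>(l - m)^2 / (l * m^2)\<close>.\<close>

lemma
  assumes "2 \<le> K" "0 < l" "0 < m"
  shows tangent_gap_nonneg: "0 \<le> tangent_gap K m l"
    and tangent_gap_pos: "l \<noteq> m \<Longrightarrow> 0 < tangent_gap K m l"
proof -
  let ?t = "\<lambda>i. 1 / real l ^ i - (1 / real m ^ i - real i * (real l - real m) / real m ^ Suc i)"
  have eq: "tangent_gap K m l = (\<Sum>i<K. ?t i)"
    unfolding tangent_gap_def slope_def inverse_capacity_def
    by (simp add: sum_subtractf sum.distrib sum_distrib_right)
  have ge: "0 \<le> ?t i" for i
    using power_inverse_ge_tangent[of "real l" "real m" i] assms by simp
  show "0 \<le> tangent_gap K m l"
    unfolding eq by (rule sum_nonneg) (rule ge)
  assume ne: "l \<noteq> m"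
  have "0 < (real l - real m)\<^sup>2 / (real l * (real m)\<^sup>2)" using ne assms by simp
  also have "\<dots> = ?t 1"
    using assms by (simp add: field_simps power2_eq_square)
  finally have "0 < ?t 1" .
  then show "0 < tangent_gap K m l"
    unfolding eq by (rule sum_pos2[of _ 1, rotated 2]) (use assms ge in auto)
qed

lemma sum_over_members:
  fixes f :: "nat set \<Rightarrow> real"
  shows "(\<Sum>n\<in>{1..N}. \<Sum>S | S \<subseteq> {1..N} \<and> n \<in> S. f S) = (\<Sum>S | S \<subseteq> {1..N}. real (card S) * f S)"
proof -
  have "(\<Sum>n\<in>{1..N}. \<Sum>S | S \<in> {S. S \<subseteq> {1..N}} \<and> n \<in> S. f S) = (\<Sum>S | S \<subseteq> {1..N}. \<Sum>n | n \<in> {1..N} \<and> n \<in> S. f S)"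
    by (rule sum.swap_restrict) auto
  also have "\<dots> = (\<Sum>S | S \<subseteq> {1..N}. real (card S) * f S)"
  proof (rule sum.cong[OF refl])
    fix S assume "S \<in> {S. S \<subseteq> {1..N}}"
    then have "{n. n \<in> {1..N} \<and> n \<in> S} = S" by auto
    then show "(\<Sum>n | n \<in> {1..N} \<and> n \<in> S. f S) = real (card S) * f S" by simp
  qed
  finally show ?thesis by simp
qed

section \<open>Slack in the download bound and the case of equality\<close>

context sc_pir_scheme
begin

lemma download_slack:
  assumes m: "real m = \<mu> * real N"
  shows "real L * inverse_capacity K m
      + (\<Sum>S | S \<subseteq> {1..N}. real (type_size S) * tangent_gap K m (card S))
      + slope K m * (\<Sum>n\<in>{1..N}. \<mu> * real L - real (\<Sum>S | S \<subseteq> {1..N} \<and> n \<in> S. type_size S))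
    \<le> download 1"
proof -
  define P where "P = {S. S \<subseteq> {1..N}}"
  have "(\<Sum>S\<in>P. real (type_size S) * tangent_gap K m (card S))
      = (\<Sum>S\<in>P. real (type_size S) * inverse_capacity K (card S)
          - real (type_size S) * inverse_capacity K m
          + slope K m * (real (card S) * real (type_size S)) - slope K m * real m * real (type_size S))"
    by (rule sum.cong) (auto simp: algebra_simps tangent_gap_def)
  also have "\<dots> = (\<Sum>S\<in>P. real (type_size S) * inverse_capacity K (card S))
      - (\<Sum>S\<in>P. real (type_size S)) * inverse_capacity K m
      + slope K m * (\<Sum>S\<in>P. real (card S) * real (type_size S))
      - slope K m * real m * (\<Sum>S\<in>P. real (type_size S))"
    by (simp only: sum_subtractf sum.distrib sum_distrib_left sum_distrib_right)
  also have "(\<Sum>S\<in>P. real (type_size S)) = real L"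
    using sum_type_size unfolding P_def by (metis of_nat_sum)
  finally have 1: "(\<Sum>S\<in>P. real (type_size S) * tangent_gap K m (card S))
      = (\<Sum>S\<in>P. real (type_size S) * inverse_capacity K (card S)) - real L * inverse_capacity K m
      + slope K m * (\<Sum>S\<in>P. real (card S) * real (type_size S)) - slope K m * real m * real L" .
  have "(\<Sum>n\<in>{1..N}. \<mu> * real L - real (\<Sum>S | S \<subseteq> {1..N} \<and> n \<in> S. type_size S))
      = real N * (\<mu> * real L) - (\<Sum>S\<in>P. real (card S) * real (type_size S))"
    unfolding sum_subtractf of_nat_sum sum_over_members P_def by simp
  also have "real N * (\<mu> * real L) = real m * real L" by (simp add: m)
  finally have 2: "slope K m * (\<Sum>n\<in>{1..N}. \<mu> * real L - real (\<Sum>S | S \<subseteq> {1..N} \<and> n \<in> S. type_size S))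
      = slope K m * real m * real L - slope K m * (\<Sum>S\<in>P. real (card S) * real (type_size S))"
    by (simp add: right_diff_distrib)
  have 3: "(\<Sum>S\<in>P. real (type_size S) * inverse_capacity K (card S)) \<le> download 1"
    using download_lower_bound unfolding inverse_capacity_def P_def .
  show ?thesis unfolding P_def[symmetric] 1 2 using 3 by linarith
qed

text \<open>Tangent gaps are controlled only at positive arguments; the empty type has size zero,
  which settles the product there.\<close>

lemma
  assumes K: "2 \<le> K" and m: "1 \<le> m" and S: "S \<subseteq> {1..N}"
  shows weighted_gap_nonneg: "0 \<le> real (type_size S) * tangent_gap K m (card S)"
    and weighted_gap_pos: "card S \<noteq> m \<Longrightarrow> type_size S \<noteq> 0 \<Longrightarrow>
      0 < real (type_size S) * tangent_gap K m (card S)"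
proof -
  have card: "0 < card S" if "type_size S \<noteq> 0"
    using that type_size_empty finite_subset[OF S] by (auto simp: card_gt_0_iff)
  show "0 \<le> real (type_size S) * tangent_gap K m (card S)"
  proof (cases "type_size S = 0")
    case False
    then show ?thesis using tangent_gap_nonneg[OF K card[OF False], of m] m by simp
  qed simp
  show "0 < real (type_size S) * tangent_gap K m (card S)" if "card S \<noteq> m" "type_size S \<noteq> 0"
    using tangent_gap_pos[OF K card[OF that(2)] _ that(1)] m that(2) by simp
qed

lemma server_slack_nonneg:
  "n \<in> {1..N} \<Longrightarrow> 0 \<le> \<mu> * real L - real (\<Sum>S | S \<subseteq> {1..N} \<and> n \<in> S. type_size S)"
  using sum_type_size_server_le[of n] by linarith

lemma download_ge:
  assumes K: "2 \<le> K" and m: "real m = \<mu> * real N" "1 \<le> m"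
  shows "real L * inverse_capacity K m \<le> download 1"
proof -
  have "0 \<le> (\<Sum>S | S \<subseteq> {1..N}. real (type_size S) * tangent_gap K m (card S))"
    by (rule sum_nonneg) (use weighted_gap_nonneg[OF K m(2)] in blast)
  moreover have "0 \<le> (\<Sum>n\<in>{1..N}. \<mu> * real L - real (\<Sum>S | S \<subseteq> {1..N} \<and> n \<in> S. type_size S))"
    by (rule sum_nonneg) (rule server_slack_nonneg)
  ultimately show ?thesis
    using download_slack[OF m(1)] mult_nonneg_nonneg[OF less_imp_le[OF slope_pos[OF K m(2)]]]
    by (smt (verit))
qed

lemma rate_le:
  assumes "2 \<le> K" "real m = \<mu> * real N" "1 \<le> m"
  shows "rate \<le> 1 / inverse_capacity K m"
proof -
  have ic: "0 < inverse_capacity K m" using inverse_capacity_pos pos by blast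
  have "0 < real L * inverse_capacity K m" using ic pos by simp
  then have "rate \<le> real L / (real L * inverse_capacity K m)"
    unfolding rate_def using download_ge[OF assms] by (intro divide_left_mono) auto
  then show ?thesis using pos by simp
qed

text \<open>At the optimal rate all nonnegative terms of \<open>download_slack\<close> vanish.
  Strictly positive gaps empty every type of cardinality other than \<open>m\<close>, and the
  positive slope forces all servers to be full.\<close>

lemma optimal_rate_storage:
  assumes K: "2 \<le> K" and m: "real m = \<mu> * real N" "1 \<le> m"
    and opt: "rate = 1 / inverse_capacity K m"
  shows "\<And>S. S \<subseteq> {1..N} \<Longrightarrow> card S \<noteq> m \<Longrightarrow> type_size S = 0"
    and "\<And>n. n \<in> {1..N} \<Longrightarrow> real (\<Sum>S | S \<subseteq> {1..N} \<and> n \<in> S. type_size S) = \<mu> * real L"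
proof -
  let ?f = "\<lambda>S. real (type_size S) * tangent_gap K m (card S)"
  let ?g = "\<lambda>n. \<mu> * real L - real (\<Sum>S | S \<subseteq> {1..N} \<and> n \<in> S. type_size S)"
  have ic: "0 < inverse_capacity K m" using inverse_capacity_pos pos by blast
  have L: "0 < real L" using pos by simp
  have c: "0 < slope K m" by (rule slope_pos[OF K m(2)])
  \<comment> \<open>As division by zero gives rate zero, positivity is needed to turn the equation
    of rates into one of downloads.\<close>
  have "0 < download 1" using download_ge[OF K m] mult_pos_pos[OF L ic] by linarith
  then have eq: "real L * inverse_capacity K m = download 1"
    using opt ic by (simp add: rate_def field_simps)
  have f: "0 \<le> (\<Sum>S | S \<subseteq> {1..N}. ?f S)"
    by (rule sum_nonneg) (use weighted_gap_nonneg[OF K m(2)] in blast)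
  have g: "0 \<le> (\<Sum>n\<in>{1..N}. ?g n)" by (rule sum_nonneg) (rule server_slack_nonneg)
  have cg: "0 \<le> slope K m * (\<Sum>n\<in>{1..N}. ?g n)"
    by (rule mult_nonneg_nonneg[OF less_imp_le[OF c] g])
  have "(\<Sum>S | S \<subseteq> {1..N}. ?f S) = 0" and "slope K m * (\<Sum>n\<in>{1..N}. ?g n) = 0"
    using download_slack[OF m(1)] f cg eq by linarith+
  then have f0: "\<forall>S\<in>{S. S \<subseteq> {1..N}}. ?f S = 0" and "(\<Sum>n\<in>{1..N}. ?g n) = 0"
    using sum_nonneg_eq_0_iff[of "{S. S \<subseteq> {1..N}}" ?f] weighted_gap_nonneg[OF K m(2)] c by force+
  then have g0: "\<forall>n\<in>{1..N}. ?g n = 0"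
    using sum_nonneg_eq_0_iff[of "{1..N}" ?g] server_slack_nonneg by blast
  show "type_size S = 0" if "S \<subseteq> {1..N}" "card S \<noteq> m" for S
    using weighted_gap_pos[OF K m(2) that] f0 that by (metis less_irrefl mem_Collect_eq)
  show "real (\<Sum>S | S \<subseteq> {1..N} \<and> n \<in> S. type_size S) = \<mu> * real L" if "n \<in> {1..N}" for n
    using bspec[OF g0 that] by linarith
qed

lemma optimal_rate_design:
  assumes "2 \<le> K" "real m = \<mu> * real N" "1 \<le> m"
    and "rate = 1 / inverse_capacity K m" and design: "storage_design \<alpha>"
  shows "stored_at_exactly m N \<alpha> \<and> storage_used_up \<mu> N \<alpha>"
proof -
  note o = optimal_rate_storage[OF assms(1-4)]
  have L: "real L > 0" using pos by simp
  have a: "real (type_size S) = \<alpha> S * real L" if S: "S \<subseteq> {1..N}" for S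
  proof -
    have "\<H>(exclusive_part 1 S) = \<alpha> S * real L"
      using design S one_file unfolding storage_design_def by blast
    then show ?thesis using entropy_exclusive_part[OF one_file, of S] by linarith
  qed
  have "stored_at_exactly m N \<alpha>"
    unfolding stored_at_exactly_def
  proof (intro allI impI)
    fix S assume "S \<subseteq> {1..N} \<and> card S \<noteq> m"
    then show "\<alpha> S = 0" using o(1)[of S] a[of S] L by simp
  qed
  moreover have "storage_used_up \<mu> N \<alpha>"
    unfolding storage_used_up_def
  proof
    fix n assume n: "n \<in> {1..N}"
    have "(\<Sum>S | S \<subseteq> {1..N} \<and> n \<in> S. \<alpha> S) * real L = real (\<Sum>S | S \<subseteq> {1..N} \<and> n \<in> S. type_size S)"
      unfolding sum_distrib_right of_nat_sum by (rule sum.cong) (use a in auto)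
    then show "(\<Sum>S | S \<subseteq> {1..N} \<and> n \<in> S. \<alpha> S) = \<mu>" using o(2)[OF n] L by simp
  qed
  ultimately show ?thesis ..
qed

end

section \<open>Parameters of the capacity-achieving scheme\<close>

lemma ex_add_mod_eq:
  fixes m x y :: nat
  assumes "y < m"
  shows "\<exists>p<m. (x + p) mod m = y"
proof -
  let ?p = "(y + (m - x mod m)) mod m"
  have "x mod m < m" using assms by simp
  have "(x + ?p) mod m = (x mod m + (y + (m - x mod m))) mod m"
    by (metis mod_add_left_eq mod_add_right_eq)
  also have "x mod m + (y + (m - x mod m)) = y + m" using \<open>x mod m < m\<close> by simp
  finally have "(x + ?p) mod m = y" using assms by simp
  moreover have "?p < m" using assms by simp
  ultimately show ?thesis by blast
qed

lemma inj_on_add_mod: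
  fixes m :: nat
  assumes "x < m" "y < m" "(x + c) mod m = (y + c) mod m"
  shows "x = y"
proof -
  have "int m dvd int (x + c) - int (y + c)"
    using assms(3) by (metis mod_eq_dvd_iff of_nat_mod)
  then have "int x - int y = 0" using dvd_imp_le_int[of "int x - int y" "int m"] assms(1,2) by force
  then show ?thesis by simp
qed

section \<open>Index sets of the scheme\<close>

definition tuples :: "nat \<Rightarrow> nat \<Rightarrow> (nat \<Rightarrow> nat) set" where
  "tuples K m = {1..K} \<rightarrow>\<^sub>E {..<m}"

text \<open>
  A place \<open>(i, c, t, j)\<close> of a file is symbol \<open>j\<close> of block \<open>t\<close> in the \<open>c\<close>-th copy of packet \<open>i\<close>; the number
  \<open>a i\<close> of copies fixes the size of packet \<open>i\<close>.
\<close>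

definition places :: "nat set \<Rightarrow> nat \<Rightarrow> nat \<Rightarrow> (nat \<Rightarrow> nat) \<Rightarrow> (nat \<times> nat \<times> (nat \<Rightarrow> nat) \<times> nat) set" where
  "places I K m a = Sigma I (\<lambda>i. {..<a i} \<times> tuples K m \<times> {1..<m})"

text \<open>Both the randomness and the queries live here: one vector of residues modulo
  \<open>m\<close> for every packet.\<close>

definition query_space :: "nat \<Rightarrow> nat \<Rightarrow> nat \<Rightarrow> (nat \<times> nat \<Rightarrow> nat) set" where
  "query_space F K m = {1..F} \<times> {1..K} \<rightarrow>\<^sub>E {..<m}"

text \<open>The all-zero vector asks for zero symbols only, so its answer is known and not
  downloaded; this is the \<open>- 1\<close> in the symbol count \<open>m ^ K - 1\<close>.\<close>

definition requests :: "nat set \<Rightarrow> nat \<Rightarrow> nat \<Rightarrow> (nat \<Rightarrow> nat) \<Rightarrow> (nat \<times> nat \<times> (nat \<Rightarrow> nat)) set" where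
  "requests I K m a = Sigma I (\<lambda>i. {..<a i} \<times> (tuples K m - {\<lambda>k\<in>{1..K}. 0}))"

lemma finite_tuples: "finite (tuples K m)"
  unfolding tuples_def by (intro finite_PiE) auto

lemma card_tuples: "card (tuples K m) = m ^ K"
  unfolding tuples_def by (simp add: card_PiE)

lemma card_places: "finite I \<Longrightarrow> card (places I K m a) = (\<Sum>i\<in>I. a i) * (m ^ K * (m - 1))"
  unfolding places_def
  by (subst card_SigmaI) (auto simp: finite_tuples card_cartesian_product card_tuples sum_distrib_right)

lemma finite_requests: "finite I \<Longrightarrow> finite (requests I K m a)"
  unfolding requests_def by (auto intro!: finite_SigmaI simp: finite_tuples)

lemma card_requests:
  assumes "finite I" "0 < m"
  shows "card (requests I K m a) = (\<Sum>i\<in>I. a i) * (m ^ K - 1)"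
proof -
  have "(\<lambda>k\<in>{1..K}. 0) \<in> tuples K m" using assms(2) by (auto simp: tuples_def)
  then have "card (tuples K m - {\<lambda>k\<in>{1..K}. 0}) = m ^ K - 1"
    by (simp add: card_Diff_singleton card_tuples)
  then show ?thesis
    unfolding requests_def using assms(1)
    by (subst card_SigmaI) (auto simp: finite_tuples card_cartesian_product sum_distrib_right)
qed

text \<open>A geometric series. On the left, the number of file symbols per copy times the optimal
  download per symbol; on the right, \<open>m\<close> answers of \<open>m ^ K - 1\<close> symbols
  each.\<close>

lemma inverse_capacity_closed_form:
  assumes "2 \<le> m"
  shows "real (m ^ K * (m - 1)) * inverse_capacity K m = real (m * (m ^ K - 1))"
proof (induction K)
  case (Suc K)
  have "real (m ^ Suc K * (m - 1)) * inverse_capacity (Suc K) m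
      = real m * (real (m ^ K * (m - 1)) * inverse_capacity K m) + real m * real (m - 1)"
    using assms by (simp add: inverse_capacity_def algebra_simps)
  also have "\<dots> = real (m * (m ^ Suc K - 1))"
    unfolding Suc using assms by (simp add: of_nat_diff algebra_simps)
  finally show ?case .
qed (simp add: inverse_capacity_def)

section \<open>Uniform sample spaces and the data of the scheme\<close>

lemma distr_uniform_count_measure_eq:
  assumes "finite A" "bij_betw \<phi> A A" "\<And>x. x \<in> A \<Longrightarrow> g x = f (\<phi> x)"
  shows "distr (uniform_count_measure A) (count_space UNIV) g = distr (uniform_count_measure A) (count_space UNIV) f"
proof (rule measure_eqI)
  fix X
  have meas: "h \<in> measurable (uniform_count_measure A) (count_space UNIV)" for h :: "'a \<Rightarrow> 'b"
    by (auto simp: measurable_def sets_uniform_count_measure space_uniform_count_measure)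
  have "bij_betw \<phi> (g -` X \<inter> A) (f -` X \<inter> A)"
  proof (rule bij_betw_subset[OF assms(2)])
    show "\<phi> ` (g -` X \<inter> A) = f -` X \<inter> A"
    proof (intro equalityI subsetI)
      fix y assume y: "y \<in> f -` X \<inter> A"
      then obtain x where x: "x \<in> A" "y = \<phi> x" using bij_betw_imp_surj_on[OF assms(2)] by blast
      then have "x \<in> g -` X \<inter> A" using assms(3)[OF x(1)] y by simp
      then show "y \<in> \<phi> ` (g -` X \<inter> A)" using x(2) by blast
    next
      fix y assume "y \<in> \<phi> ` (g -` X \<inter> A)"
      then obtain x where x: "x \<in> A" "g x \<in> X" "y = \<phi> x" by blast
      then show "y \<in> f -` X \<inter> A"
        using assms(3)[OF x(1)] bij_betw_imp_surj_on[OF assms(2)] by force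
    qed
  qed auto
  then have "card (g -` X \<inter> A) = card (f -` X \<inter> A)" by (rule bij_betw_same_card)
  then show "emeasure (distr (uniform_count_measure A) (count_space UNIV) g) X
      = emeasure (distr (uniform_count_measure A) (count_space UNIV) f) X"
    using assms(1) by (simp add: emeasure_distr[OF meas] space_uniform_count_measure emeasure_uniform_count_measure)
qed simp

lemma simple_function_uniform_count_measure:
  "finite A \<Longrightarrow> simple_function (uniform_count_measure A) f"
  by (auto simp: simple_function_def space_uniform_count_measure sets_uniform_count_measure)

text \<open>Packet \<open>i\<close> sits at \<open>servers i\<close>, numbered from \<open>0\<close>
  by \<open>rank i\<close>; \<open>loc\<close> numbers the places of a file, and
  \<open>sample\<close> lists all pairs of file contents and query randomness. \<open>encq\<close>
  and \<open>enca\<close> code queries and answers as naturals, as the existential definitions of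
  schemes demand. \<open>load\<close> is (P2) with denominators cleared.\<close>

locale pir_construction =
  fixes N K m F L :: nat and a :: "nat \<Rightarrow> nat" and servers :: "nat \<Rightarrow> nat set"
    and rank :: "nat \<Rightarrow> nat \<Rightarrow> nat"
    and loc :: "nat \<times> nat \<times> (nat \<Rightarrow> nat) \<times> nat \<Rightarrow> nat"
    and sample :: "nat \<Rightarrow> (nat \<times> nat \<Rightarrow> 'f::{field,finite}) \<times> (nat \<times> nat \<Rightarrow> nat)"
    and encq :: "(nat \<times> nat \<Rightarrow> nat) \<Rightarrow> nat"
    and enca :: "nat \<Rightarrow> (nat \<times> nat \<times> (nat \<Rightarrow> nat) \<Rightarrow> 'f) \<Rightarrow> nat"
  assumes K: "2 \<le> K" and m: "2 \<le> m" "m \<le> N" and F: "1 \<le> F"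
    and copies: "\<And>i. i \<in> {1..F} \<Longrightarrow> 0 < a i"
    and servers: "\<And>i. i \<in> {1..F} \<Longrightarrow> servers i \<subseteq> {1..N}"
    and rank: "\<And>i. i \<in> {1..F} \<Longrightarrow> bij_betw (rank i) (servers i) {..<m}"
    and load: "\<And>n. n \<in> {1..N} \<Longrightarrow> N * (\<Sum>i | i \<in> {1..F} \<and> n \<in> servers i. a i) = m * (\<Sum>i=1..F. a i)"
    and loc: "bij_betw loc (places {1..F} K m a) {1..L}"
    and sample: "bij_betw sample {..<card ((({1..K} \<times> {1..L}) \<rightarrow>\<^sub>E (UNIV :: 'f set)) \<times> query_space F K m)}
      ((({1..K} \<times> {1..L}) \<rightarrow>\<^sub>E UNIV) \<times> query_space F K m)"
    and encq: "inj_on encq (query_space F K m)"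
    and enca: "\<And>n. n \<in> {1..N} \<Longrightarrow> inj_on (enca n) (requests {i \<in> {1..F}. n \<in> servers i} K m a \<rightarrow>\<^sub>E UNIV)"
begin

definition file_space :: "(nat \<times> nat \<Rightarrow> 'f) set" where
  "file_space = ({1..K} \<times> {1..L}) \<rightarrow>\<^sub>E UNIV"

definition samples :: "nat set" where
  "samples = {..<card (file_space \<times> query_space F K m)}"

definition P :: "nat measure" where
  "P = uniform_count_measure samples"

definition W :: "nat \<Rightarrow> nat \<Rightarrow> nat \<Rightarrow> 'f" where
  "W k j \<omega> = fst (sample \<omega>) (k, j)"

definition pkt :: "nat \<Rightarrow> nat \<Rightarrow> nat set" where
  "pkt k i = loc ` places {i} K m a"

definition st :: "nat \<Rightarrow> nat set" where
  "st n = {i \<in> {1..F}. n \<in> servers i}"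

definition query :: "nat \<Rightarrow> nat \<Rightarrow> (nat \<times> nat \<Rightarrow> nat) \<Rightarrow> nat \<times> nat \<Rightarrow> nat" where
  "query \<theta> n R = (\<lambda>(i, k)\<in>{1..F} \<times> {1..K}. (R (i, k) + (if k = \<theta> then rank i n else 0)) mod m)"

definition val :: "(nat \<times> nat \<Rightarrow> 'f) \<Rightarrow> nat \<Rightarrow> nat \<Rightarrow> nat \<Rightarrow> (nat \<Rightarrow> nat) \<Rightarrow> nat \<Rightarrow> 'f" where
  "val w k i c t j = (if j = 0 then 0 else w (k, loc (i, c, t, j)))"

text \<open>The block index \<open>t + v\<close> modulo \<open>m\<close>, common to the symbols
  requested from all files.\<close>

definition shift :: "(nat \<times> nat \<Rightarrow> nat) \<Rightarrow> nat \<Rightarrow> (nat \<Rightarrow> nat) \<Rightarrow> nat \<Rightarrow> nat" where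
  "shift v i t = (\<lambda>k\<in>{1..K}. (t k + v (i, k)) mod m)"

definition answer :: "nat \<Rightarrow> (nat \<times> nat \<Rightarrow> nat) \<Rightarrow> (nat \<times> nat \<Rightarrow> 'f) \<Rightarrow> nat \<times> nat \<times> (nat \<Rightarrow> nat) \<Rightarrow> 'f" where
  "answer n v w = (\<lambda>(i, c, t)\<in>requests (st n) K m a. \<Sum>k=1..K. val w k i c (shift v i t) (t k))"

definition Q :: "nat \<Rightarrow> nat \<Rightarrow> nat \<Rightarrow> nat" where
  "Q \<theta> n \<omega> = encq (query \<theta> n (snd (sample \<omega>)))"

definition A :: "nat \<Rightarrow> nat \<Rightarrow> nat \<Rightarrow> nat" where
  "A \<theta> n \<omega> = enca n (answer n (query \<theta> n (snd (sample \<omega>))) (fst (sample \<omega>)))"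

lemma finite_file_space: "finite file_space"
  unfolding file_space_def by (intro finite_PiE) auto

lemma finite_query_space: "finite (query_space F K m)"
  unfolding query_space_def by (intro finite_PiE) auto

lemma query_space_nonempty: "query_space F K m \<noteq> {}"
  unfolding query_space_def using m by (auto simp: PiE_eq_empty_iff lessThan_empty_iff)

lemma file_space_nonempty: "file_space \<noteq> {}"
  unfolding file_space_def by (simp add: PiE_eq_empty_iff)

lemma sample_bij: "bij_betw sample samples (file_space \<times> query_space F K m)"
  using sample unfolding samples_def file_space_def .

lemma sample_mem:
  assumes "\<omega> \<in> samples"
  shows "fst (sample \<omega>) \<in> file_space" "snd (sample \<omega>) \<in> query_space F K m"
proof -
  have "sample \<omega> \<in> file_space \<times> query_space F K m"
    using bij_betw_imp_surj_on[OF sample_bij] assms by blast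
  then show "fst (sample \<omega>) \<in> file_space" "snd (sample \<omega>) \<in> query_space F K m"
    by (simp_all add: mem_Times_iff)
qed

lemma finite_samples: "finite samples"
  unfolding samples_def by simp

lemma samples_nonempty: "samples \<noteq> {}"
  unfolding samples_def
  using file_space_nonempty query_space_nonempty finite_file_space finite_query_space
  by (simp add: lessThan_empty_iff card_cartesian_product)

lemma space_P: "space P = samples"
  unfolding P_def by (simp add: space_uniform_count_measure)

lemma simple_function_P: "simple_function P f"
  unfolding P_def by (rule simple_function_uniform_count_measure[OF finite_samples])

text \<open>File contents and randomness form a product sample space, so events about one are
  independent of events about the other.\<close>

lemma measure_P:
  "measure P {\<omega> \<in> samples. p (fst (sample \<omega>)) \<and> r (snd (sample \<omega>))} =
     (real (card {w \<in> file_space. p w}) / real (card file_space)) *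
     (real (card {R \<in> query_space F K m. r R}) / real (card (query_space F K m)))"
proof -
  let ?X = "{\<omega> \<in> samples. p (fst (sample \<omega>)) \<and> r (snd (sample \<omega>))}"
  let ?Y = "{w \<in> file_space. p w} \<times> {R \<in> query_space F K m. r R}"
  have "bij_betw sample ?X ?Y"
  proof (rule bij_betw_subset[OF sample_bij])
    show "sample ` ?X = ?Y"
    proof (intro equalityI subsetI)
      fix x assume x: "x \<in> ?Y"
      then have "x \<in> sample ` samples" unfolding bij_betw_imp_surj_on[OF sample_bij] by blast
      then obtain \<omega> where "\<omega> \<in> samples" "x = sample \<omega>" by blast
      then have "\<omega> \<in> ?X" using x by (simp add: mem_Times_iff)
      then show "x \<in> sample ` ?X" using \<open>x = sample \<omega>\<close> by blast
    qed (use sample_mem in \<open>auto simp: mem_Times_iff\<close>)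
  qed auto
  then have "card ?X = card ?Y" by (rule bij_betw_same_card)
  then have "measure P ?X = real (card ?Y) / real (card samples)"
    unfolding P_def by (subst measure_uniform_count_measure[OF finite_samples]) auto
  then show ?thesis
    by (simp add: samples_def card_cartesian_product)
qed

lemma prob_space_P: "prob_space P"
  unfolding P_def by (rule prob_space_uniform_count_measure[OF finite_samples samples_nonempty])

lemma measure_symbols:
  "measure P {\<omega> \<in> samples. \<forall>p\<in>{1..K} \<times> {1..L}. fst (sample \<omega>) p \<in> B p} =
    (\<Prod>p\<in>{1..K} \<times> {1..L}. real (card (B p)) / real CARD('f))"
proof -
  have "{w \<in> file_space. \<forall>p\<in>{1..K} \<times> {1..L}. w p \<in> B p} = PiE ({1..K} \<times> {1..L}) B"
    unfolding file_space_def PiE_def Pi_def by blast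
  then have "card {w \<in> file_space. \<forall>p\<in>{1..K} \<times> {1..L}. w p \<in> B p} = (\<Prod>p\<in>{1..K} \<times> {1..L}. card (B p))"
    by (simp add: card_PiE)
  moreover have "card file_space = (\<Prod>p\<in>{1..K} \<times> {1..L}. CARD('f))"
    unfolding file_space_def by (simp add: card_PiE)
  moreover have "card (query_space F K m) \<noteq> 0"
    using query_space_nonempty finite_query_space by simp
  ultimately show ?thesis
    using measure_P[of "\<lambda>w. \<forall>p\<in>{1..K} \<times> {1..L}. w p \<in> B p" "\<lambda>_. True"]
    by (simp add: prod_dividef)
qed

lemma measure_symbol:
  assumes "p \<in> {1..K} \<times> {1..L}"
  shows "measure P {\<omega> \<in> samples. fst (sample \<omega>) p \<in> B} = real (card B) / real CARD('f)"
proof -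
  let ?B = "\<lambda>p'. if p' = p then B else UNIV"
  have "{\<omega> \<in> samples. fst (sample \<omega>) p \<in> B} = {\<omega> \<in> samples. \<forall>p'\<in>{1..K} \<times> {1..L}. fst (sample \<omega>) p' \<in> ?B p'}"
    using assms by auto
  then have "measure P {\<omega> \<in> samples. fst (sample \<omega>) p \<in> B} = (\<Prod>p'\<in>{1..K} \<times> {1..L}. real (card (?B p')) / real CARD('f))"
    using measure_symbols[of ?B] by simp
  also have "\<dots> = (\<Prod>p'\<in>{1..K} \<times> {1..L}. if p' = p then real (card B) / real CARD('f) else 1)"
    by (rule prod.cong) auto
  also have "\<dots> = real (card B) / real CARD('f)"
    using assms by (subst prod.delta) auto
  finally show ?thesis .
qed

lemma symbols_indep_P:
  "prob_space.indep_vars P (\<lambda>_. count_space UNIV) (\<lambda>(k, j). W k j) ({1..K} \<times> {1..L})"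
\<comment> \<open>Independence over an empty index set is trivial; the finite product criterion used
  otherwise asks for a nonempty one.\<close>
proof (cases "L = 0")
  case True
  then show ?thesis
    using prob_space_P by (simp add: prob_space.indep_vars_def prob_space.indep_sets_def)
next
  case False
  interpret prob_space P by (rule prob_space_P)
  let ?G = "{1..K} \<times> {1..L}"
  have "indep_vars (\<lambda>_. count_space UNIV) (\<lambda>(k, j). W k j) ?G \<longleftrightarrow>
    (\<forall>B\<in>(\<Pi> p\<in>?G. UNIV). prob (\<Inter>p\<in>?G. (\<lambda>(k, j). W k j) p -` B p \<inter> space P)
        = (\<Prod>p\<in>?G. prob ((\<lambda>(k, j). W k j) p -` B p \<inter> space P)))"
  proof (rule indep_vars_finite)
    show "?G \<noteq> {}" using False K by auto
    show "sets (count_space UNIV) = sigma_sets (space (count_space UNIV)) (UNIV :: 'f set set)"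
      using sets.sigma_sets_eq[of "count_space (UNIV :: 'f set)"] by simp
    show "random_variable (count_space UNIV) ((\<lambda>(k, j). W k j) p)" for p
      by (rule measurable_simple_function[OF simple_function_P])
  qed (auto simp: Int_stable_def)
  moreover have "prob (\<Inter>p\<in>?G. (\<lambda>(k, j). W k j) p -` B p \<inter> space P)
        = (\<Prod>p\<in>?G. prob ((\<lambda>(k, j). W k j) p -` B p \<inter> space P))" for B
  proof -
    have "?G \<noteq> {}" using False K by auto
    then have "(\<Inter>p\<in>?G. (\<lambda>(k, j). W k j) p -` B p \<inter> space P) = {\<omega> \<in> samples. \<forall>p\<in>?G. fst (sample \<omega>) p \<in> B p}"
      unfolding space_P W_def by (auto simp: case_prod_beta)
    moreover have "(\<lambda>(k, j). W k j) p -` B p \<inter> space P = {\<omega> \<in> samples. fst (sample \<omega>) p \<in> B p}" for p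
      unfolding space_P W_def by (auto simp: case_prod_beta)
    ultimately show ?thesis
      by (simp only: measure_symbols measure_symbol cong: prod.cong)
  qed
  ultimately show ?thesis by blast
qed

lemma symbols_uniform_P:
  assumes "k \<in> {1..K}" "j \<in> {1..L}"
  shows "distr P (count_space UNIV) (W k j) = uniform_count_measure UNIV"
proof (rule measure_eqI)
  interpret prob_space P by (rule prob_space_P)
  fix B
  have rv: "random_variable (count_space UNIV) (W k j)"
    by (rule measurable_simple_function[OF simple_function_P])
  have "W k j -` B \<inter> space P = {\<omega> \<in> samples. fst (sample \<omega>) (k, j) \<in> B}"
    unfolding space_P W_def by auto
  then have "prob (W k j -` B \<inter> space P) = real (card B) / real CARD('f)"
    using measure_symbol[of "(k, j)" B] assms by simp
  then show "emeasure (distr P (count_space UNIV) (W k j)) B = emeasure (uniform_count_measure UNIV) B"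
    by (simp add: emeasure_distr[OF rv] emeasure_eq_measure emeasure_uniform_count_measure
        ennreal_of_nat_eq_real_of_nat divide_ennreal)
qed (simp add: sets_uniform_count_measure)

lemma card_UNIV_gt_1: "1 < CARD('f)"
proof -
  have "card {0, 1 :: 'f} \<le> CARD('f)" by (rule card_mono) auto
  then show ?thesis by simp
qed

sublocale sc_pir_symbols P "real CARD('f)" "real m / real N" N K L F W pkt st Q A
proof (intro sc_pir_symbols.intro sc_pir_symbols_axioms.intro)
  show "sc_pir P (real CARD('f))"
    unfolding sc_pir_def information_space_def information_space_axioms_def
    using prob_space_P card_UNIV_gt_1 by simp
qed (use symbols_indep_P symbols_uniform_P in blast)+

end

section \<open>Correctness and rate of the scheme\<close>

context pir_construction
begin

section \<open>Queries, packets and decoding\<close>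

lemma query_mem: "query \<theta> n R \<in> query_space F K m"
  unfolding query_def query_space_def using m by auto

lemma query_inj: "inj_on (query \<theta> n) (query_space F K m)"
proof (rule inj_onI)
  fix R R' assume R: "R \<in> query_space F K m" "R' \<in> query_space F K m" and eq: "query \<theta> n R = query \<theta> n R'"
  show "R = R'"
  proof (rule PiE_ext[OF R[unfolded query_space_def]])
    fix p assume p: "p \<in> {1..F} \<times> {1..K}"
    obtain i k where ik: "p = (i, k)" by fastforce
    have "query \<theta> n R (i, k) = query \<theta> n R' (i, k)" using eq by simp
    then have "(R p + (if k = \<theta> then rank i n else 0)) mod m = (R' p + (if k = \<theta> then rank i n else 0)) mod m"
      using p unfolding query_def ik by simp
    moreover have "R p < m" "R' p < m" using R p unfolding query_space_def by (auto dest: PiE_mem)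
    ultimately show "R p = R' p" by (rule inj_on_add_mod[rotated 2])
  qed
qed

text \<open>For a fixed desired file and a fixed server, uniform randomness yields a uniform query;
  privacy rests on this.\<close>

lemma query_bij: "bij_betw (query \<theta> n) (query_space F K m) (query_space F K m)"
  unfolding bij_betw_def
  using query_inj endo_inj_surj[OF finite_query_space _ query_inj] query_mem by blast

lemma places_mono: "I \<subseteq> J \<Longrightarrow> places I K m a \<subseteq> places J K m a"
  unfolding places_def by blast

lemma loc_inj: "inj_on loc (places {1..F} K m a)"
  using loc by (rule bij_betw_imp_inj_on)

lemma loc_image: "loc ` places {1..F} K m a = {1..L}"
  using loc by (rule bij_betw_imp_surj_on)

lemma UN_pkt: "(\<Union>i\<in>I. pkt k i) = loc ` places I K m a"
  unfolding pkt_def places_def by blast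

lemma card_UN_pkt:
  assumes "I \<subseteq> {1..F}"
  shows "card (\<Union>i\<in>I. pkt k i) = (\<Sum>i\<in>I. a i) * (m ^ K * (m - 1))"
proof -
  have "card (loc ` places I K m a) = card (places I K m a)"
    by (rule card_image) (rule inj_on_subset[OF loc_inj places_mono[OF assms]])
  moreover have "finite I" using assms finite_subset by blast
  ultimately show ?thesis unfolding UN_pkt by (simp add: card_places)
qed

lemma card_pkt: "i \<in> {1..F} \<Longrightarrow> card (pkt k i) = a i * (m ^ K * (m - 1))"
  using card_UN_pkt[of "{i}" k] by simp

lemma L_eq: "L = (\<Sum>i=1..F. a i) * (m ^ K * (m - 1))"
  using card_UN_pkt[of "{1..F}" 1] unfolding UN_pkt loc_image by simp

lemma copies_total_pos: "0 < (\<Sum>i=1..F. a i)"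
  using copies F by (intro sum_pos) auto

lemma L_pos: "1 \<le> L"
  unfolding L_eq using copies_total_pos m by simp

lemma pkt_subset: "i \<in> {1..F} \<Longrightarrow> pkt k i \<subseteq> {1..L}"
  using places_mono[of "{i}" "{1..F}"] unfolding pkt_def loc_image[symmetric] by blast

lemma pkt_disjoint:
  assumes "i \<in> {1..F}" "i' \<in> {1..F}" "i \<noteq> i'"
  shows "pkt k i \<inter> pkt k i' = {}"
proof -
  have "pkt k i \<inter> pkt k i' = loc ` (places {i} K m a \<inter> places {i'} K m a)"
    unfolding pkt_def
    by (rule inj_on_image_Int[OF loc_inj, symmetric]; rule places_mono; use assms in simp)
  also have "places {i} K m a \<inter> places {i'} K m a = {}"
    using assms(3) unfolding places_def by blast
  finally show ?thesis by simp
qed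

lemma pkt_nonempty:
  assumes "i \<in> {1..F}"
  shows "pkt k i \<noteq> {}"
proof -
  have "card (pkt k i) \<noteq> 0"
    unfolding card_pkt[OF assms] using copies[OF assms] m by simp
  then show ?thesis by auto
qed

lemma packets_partition_P: "partition_on {1..L} (pkt k ` {1..F}) \<and> inj_on (pkt k) {1..F}"
proof
  have "disjoint (pkt k ` {1..F})"
    unfolding disjoint_def using pkt_disjoint by blast
  moreover have "{} \<notin> pkt k ` {1..F}" using pkt_nonempty by blast
  ultimately show "partition_on {1..L} (pkt k ` {1..F})"
    unfolding partition_on_def using UN_pkt[of k "{1..F}"] loc_image by simp
  show "inj_on (pkt k) {1..F}"
    by (rule inj_onI) (use pkt_disjoint pkt_nonempty in blast)
qed

lemma loc_in_pkt:
  assumes "i \<in> {1..F}" "c < a i" "t \<in> tuples K m" "j \<in> {1..<m}"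
  shows "loc (i, c, t, j) \<in> pkt k i"
  unfolding pkt_def places_def using assms by blast

lemma shift_mem: "shift v i t \<in> tuples K m"
  unfolding shift_def tuples_def using m by auto

lemma st_subset: "st n \<subseteq> {1..F}"
  unfolding st_def by blast

lemma stored_subset: "stored n \<subseteq> {1..K} \<times> {1..L}"
  unfolding stored_def using pkt_subset st_subset by fast

text \<open>A nonzero symbol requested from a packet at server \<open>n\<close> lies in its storage,
  and the zero symbol reads nothing.\<close>

lemma answer_cong:
  assumes w: "\<And>k j. (k, j) \<in> stored n \<Longrightarrow> w (k, j) = w' (k, j)"
  shows "answer n v w = answer n v w'"
proof -
  have "val w k i c (shift v i t) (t k) = val w' k i c (shift v i t) (t k)"
    if r: "(i, c, t) \<in> requests (st n) K m a" and k: "k \<in> {1..K}" for i c t k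
  proof (cases "t k = 0")
    case False
    have i: "i \<in> st n" "i \<in> {1..F}" "c < a i" "t \<in> tuples K m" using r st_subset[of n] unfolding requests_def by auto
    have "t k < m" using PiE_mem[OF i(4)[unfolded tuples_def] k] by simp
    then have "t k \<in> {1..<m}" using False by simp
    then have "loc (i, c, shift v i t, t k) \<in> pkt k i" using i shift_mem loc_in_pkt by blast
    then have "(k, loc (i, c, shift v i t, t k)) \<in> stored n" unfolding stored_def using i k by blast
    then show ?thesis unfolding val_def using w by simp
  qed (simp add: val_def)
  then show ?thesis
    unfolding answer_def by (auto simp: fun_eq_iff restrict_def intro!: sum.cong)
qed

text \<open>
  Two servers of suitable ranks have requests that refer to the same block \<open>\<tau>\<close> and to the same symbols
  \<open>s k\<close> of the other files, one to symbol \<open>j\<close> and one to the zero symbol of file \<open>\<theta>\<close>.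
\<close>

lemma decode:
  assumes \<theta>: "\<theta> \<in> {1..K}"
    and ans: "\<And>n. n \<in> {1..N} \<Longrightarrow> answer n (query \<theta> n R) w = answer n (query \<theta> n R) w'"
    and l: "l \<in> {1..L}"
  shows "w (\<theta>, l) = w' (\<theta>, l)"
proof -
  obtain i c \<tau> j where x: "(i, c, \<tau>, j) \<in> places {1..F} K m a" "l = loc (i, c, \<tau>, j)"
    using l unfolding loc_image[symmetric] by auto
  then have i: "i \<in> {1..F}" "c < a i" and \<tau>: "\<tau> \<in> tuples K m" and j: "0 < j" "j < m"
    unfolding places_def by auto
  have "\<forall>k\<in>{1..K}. \<exists>p<m. (R (i, k) + p) mod m = \<tau> k"
    using ex_add_mod_eq PiE_mem[OF \<tau>[unfolded tuples_def]] by simp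
  \<comment> \<open>\<open>s k\<close> is the symbol index that moves coordinate \<open>k\<close> of
    the randomness to that of block \<open>\<tau>\<close>; for files other than
    \<open>\<theta>\<close> it is the same at every server.\<close>
  then obtain s where s: "\<And>k. k \<in> {1..K} \<Longrightarrow> s k < m \<and> (R (i, k) + s k) mod m = \<tau> k"
    by metis
  have sum_eq: "(\<Sum>k=1..K. val w k i c \<tau> (if k = \<theta> then r else s k)) =
      (\<Sum>k=1..K. val w' k i c \<tau> (if k = \<theta> then r else s k))" if r: "r < m" for r
  proof -
    define t where "t = (\<lambda>k\<in>{1..K}. if k = \<theta> then r else s k)"
    have t: "t \<in> tuples K m" unfolding t_def tuples_def using r s by auto
    have "\<tau> \<theta> < m" using PiE_mem[OF \<tau>[unfolded tuples_def] \<theta>] by simp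
    \<comment> \<open>The server whose rank \<open>p\<close> compensates the choice of symbol
      \<open>r\<close> in file \<open>\<theta>\<close> reaches the same block
      \<open>\<tau>\<close>.\<close>
    then obtain p where p: "p < m" "(r + R (i, \<theta>) + p) mod m = \<tau> \<theta>" using ex_add_mod_eq by blast
    then obtain n where n: "n \<in> servers i" "rank i n = p"
      using bij_betw_imp_surj_on[OF rank[OF i(1)]] by (metis imageE lessThan_iff)
    let ?v = "query \<theta> n R"
    have "shift ?v i t = \<tau>"
    proof (rule PiE_ext[OF shift_mem[unfolded tuples_def] \<tau>[unfolded tuples_def]])
      fix k assume k: "k \<in> {1..K}"
      have "shift ?v i t k = (t k + (R (i, k) + (if k = \<theta> then p else 0))) mod m"
        unfolding shift_def query_def using k i n by (simp add: mod_add_right_eq)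
      also have "\<dots> = \<tau> k"
        using k s[OF k] p(2) unfolding t_def by (auto simp: ac_simps)
      finally show "shift ?v i t k = \<tau> k" .
    qed
    then have a: "(\<Sum>k=1..K. val u k i c (shift ?v i t) (t k)) =
        (\<Sum>k=1..K. val u k i c \<tau> (if k = \<theta> then r else s k))" for u
      by (auto simp: t_def intro!: sum.cong)
    show ?thesis
    \<comment> \<open>The zero vector is never requested, but its sum consists of zero symbols for
      both contents.\<close>
    proof (cases "t = (\<lambda>k\<in>{1..K}. 0)")
      case True
      have "(if k = \<theta> then r else s k) = 0" if k: "k \<in> {1..K}" for k
        using fun_cong[OF True, of k] k unfolding t_def by (simp only: restrict_apply if_True)
      then have "val u k i c \<tau> (if k = \<theta> then r else s k) = 0" if "k \<in> {1..K}" for u k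
        using that by (simp add: val_def)
      then show ?thesis by (simp only: cong: sum.cong)
    next
      case False
      have nN: "n \<in> {1..N}" using n servers[OF i(1)] by blast
      have "(i, c, t) \<in> requests (st n) K m a"
        using False i n t unfolding requests_def st_def by auto
      then show ?thesis
        using fun_cong[OF ans[OF nN], of "(i, c, t)"] unfolding answer_def a[symmetric] by simp
    qed
  qed
  have split: "(\<Sum>k=1..K. val u k i c \<tau> (if k = \<theta> then r else s k)) =
     val u \<theta> i c \<tau> r + (\<Sum>k\<in>{1..K} - {\<theta>}. val u k i c \<tau> (s k))" for u r
    using \<theta> by (subst sum.remove[of _ \<theta>]) (auto intro!: sum.cong)
  \<comment> \<open>The choice \<open>r = 0\<close> isolates the interference of the other files,
    which then cancels in the choice \<open>r = j\<close>.\<close>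
  have "(\<Sum>k\<in>{1..K} - {\<theta>}. val w k i c \<tau> (s k)) = (\<Sum>k\<in>{1..K} - {\<theta>}. val w' k i c \<tau> (s k))"
    using sum_eq[of 0] m unfolding split by (simp add: val_def)
  then have "val w \<theta> i c \<tau> j = val w' \<theta> i c \<tau> j"
    using sum_eq[OF j(2)] unfolding split by simp
  then show ?thesis using j unfolding val_def x(2) by simp
qed

section \<open>Verification of the scheme axioms\<close>

lemma packet_entropy_P:
  assumes "k \<in> {1..K}" "i \<in> {1..F}"
  shows "entropy_Pow (packet k i) = real (a i * (m ^ K * (m - 1)))"
proof -
  have "Pair k ` pkt k i \<subseteq> {1..K} \<times> {1..L}" using pkt_subset[OF assms(2), of k] assms(1) by auto
  then have "entropy_Pow (packet k i) = real (card (Pair k ` pkt k i))"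
    by (rule entropy_of_symbols_eqI(2)[OF _ packet_eq_iff])
  then show ?thesis by (simp add: card_image inj_on_def card_pkt[OF assms(2)])
qed

text \<open>By \<open>load\<close>, the packets at server \<open>n\<close> make up exactly the
  fraction \<open>m / N\<close> of all copies.\<close>

lemma storage_entropy_P:
  assumes n: "n \<in> {1..N}"
  shows "entropy_Pow (storage n) = real m / real N * real K * real L"
proof -
  have "entropy_Pow (storage n) = real (card (stored n))"
    by (rule entropy_of_symbols_eqI(2)[OF stored_subset storage_eq_iff])
  also have "stored n = {1..K} \<times> loc ` places (st n) K m a"
    unfolding stored_def using UN_pkt[of _ "st n"] by blast
  also have "card \<dots> = K * card (\<Union>i\<in>st n. pkt 1 i)"
    by (simp add: card_cartesian_product UN_pkt)
  also have "\<dots> = K * ((\<Sum>i\<in>st n. a i) * (m ^ K * (m - 1)))"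
    by (simp only: card_UN_pkt[OF st_subset])
  finally have 1: "entropy_Pow (storage n) = real K * (real (\<Sum>i\<in>st n. a i) * real (m ^ K * (m - 1)))"
    by (simp only: of_nat_mult)
  have "real N * real (\<Sum>i\<in>st n. a i) = real m * real (\<Sum>i=1..F. a i)"
    using load[OF n] unfolding st_def by (metis of_nat_mult)
  moreover have "0 < real N" using m by simp
  ultimately have "real (\<Sum>i\<in>st n. a i) = real m / real N * real (\<Sum>i=1..F. a i)"
    by (simp add: field_simps del: of_nat_sum)
  then show ?thesis unfolding 1 by (subst L_eq) (simp del: of_nat_sum)
qed

text \<open>Queries depend on the randomness only and files on the contents only;
  \<open>measure_P\<close> factors their joint law.\<close>

lemma queries_indep_P: "mutual_information_Pow (queries \<theta>) all_files = 0"
proof -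
  let ?f = "\<lambda>R. \<lambda>n\<in>{1..N}. encq (query \<theta> n R)"
  let ?g = "\<lambda>w. \<lambda>k\<in>{1..K}. \<lambda>j\<in>{1..L}. w (k, j) :: 'f"
  have q: "queries \<theta> \<omega> = ?f (snd (sample \<omega>))" for \<omega> by (simp add: queries_def Q_def)
  have f: "all_files \<omega> = ?g (fst (sample \<omega>))" for \<omega> by (simp add: all_files_def file_rv_def W_def)
  have nz: "real (card file_space) \<noteq> 0" "real (card (query_space F K m)) \<noteq> 0"
    using finite_file_space file_space_nonempty finite_query_space query_space_nonempty by auto
  show ?thesis
  proof (rule mutual_information_eq_0_simple; (rule simple_distributedI[OF simple_function_P measure_nonneg refl])?)
    show "\<forall>\<omega>\<in>space P. prob ((\<lambda>\<omega>. (queries \<theta> \<omega>, all_files \<omega>)) -` {(queries \<theta> \<omega>, all_files \<omega>)} \<inter> space P) =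
        prob (queries \<theta> -` {queries \<theta> \<omega>} \<inter> space P) * prob (all_files -` {all_files \<omega>} \<inter> space P)"
    proof
      fix \<omega>
      let ?p = "\<lambda>w. ?g w = all_files \<omega>" and ?r = "\<lambda>R. ?f R = queries \<theta> \<omega>"
      have "(\<lambda>\<omega>. (queries \<theta> \<omega>, all_files \<omega>)) -` {(queries \<theta> \<omega>, all_files \<omega>)} \<inter> space P =
          {\<omega> \<in> samples. ?p (fst (sample \<omega>)) \<and> ?r (snd (sample \<omega>))}"
        unfolding space_P q f by blast
      moreover have "queries \<theta> -` {queries \<theta> \<omega>} \<inter> space P = {\<omega> \<in> samples. True \<and> ?r (snd (sample \<omega>))}"
        unfolding space_P q f by blast
      moreover have "all_files -` {all_files \<omega>} \<inter> space P = {\<omega> \<in> samples. ?p (fst (sample \<omega>)) \<and> True}"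
        unfolding space_P q f by blast
      ultimately show "prob ((\<lambda>\<omega>. (queries \<theta> \<omega>, all_files \<omega>)) -` {(queries \<theta> \<omega>, all_files \<omega>)} \<inter> space P) =
        prob (queries \<theta> -` {queries \<theta> \<omega>} \<inter> space P) * prob (all_files -` {all_files \<omega>} \<inter> space P)"
        using measure_P[of ?p ?r] measure_P[of "\<lambda>_. True" ?r] measure_P[of ?p "\<lambda>_. True"] nz
        by (simp only: Collect_mem_eq simp_thms divide_self mult_1_left mult_1_right mult.commute)
    qed
  qed
qed

lemma answer_determined_P:
  assumes n: "n \<in> {1..N}"
  shows "conditional_entropy_Pow (A \<theta> n) (\<lambda>\<omega>. (Q \<theta> n \<omega>, storage n \<omega>)) = 0"
proof (rule conditional_entropy_determined_by[OF simple_function_P simple_function_P], rule determined_byI)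
  fix \<omega> \<omega>' assume "(Q \<theta> n \<omega>, storage n \<omega>) = (Q \<theta> n \<omega>', storage n \<omega>')"
  then have q: "Q \<theta> n \<omega> = Q \<theta> n \<omega>'" and z: "\<forall>(k, j)\<in>stored n. W k j \<omega> = W k j \<omega>'"
    by (simp_all add: storage_eq_iff)
  have "query \<theta> n (snd (sample \<omega>)) = query \<theta> n (snd (sample \<omega>'))"
    using q inj_onD[OF encq _ query_mem query_mem] unfolding Q_def by blast
  moreover have "answer n v (fst (sample \<omega>)) = answer n v (fst (sample \<omega>'))" for v
    by (rule answer_cong) (use z in \<open>auto simp: W_def\<close>)
  ultimately show "A \<theta> n \<omega> = A \<theta> n \<omega>'" unfolding A_def by simp
qed

lemma answer_mem: "answer n v w \<in> requests (st n) K m a \<rightarrow>\<^sub>E UNIV"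
  unfolding answer_def by simp

lemma decodability_P:
  assumes \<theta>: "\<theta> \<in> {1..K}"
  shows "conditional_entropy_Pow (file_rv \<theta>) (\<lambda>\<omega>. (answers \<theta> \<omega>, queries \<theta> \<omega>)) = 0"
proof (rule conditional_entropy_determined_by[OF simple_function_P simple_function_P], rule determined_byI)
  fix \<omega> \<omega>'
  assume "(answers \<theta> \<omega>, queries \<theta> \<omega>) = (answers \<theta> \<omega>', queries \<theta> \<omega>')"
  then have eq: "A \<theta> n \<omega> = A \<theta> n \<omega>'" "Q \<theta> n \<omega> = Q \<theta> n \<omega>'" if "n \<in> {1..N}" for n
    using that unfolding answers_def queries_def prod.inject restrict_eq_restrict_iff by blast+
  have "answer n (query \<theta> n (snd (sample \<omega>))) (fst (sample \<omega>)) = answer n (query \<theta> n (snd (sample \<omega>))) (fst (sample \<omega>'))"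
    if n: "n \<in> {1..N}" for n
  proof -
    have "query \<theta> n (snd (sample \<omega>)) = query \<theta> n (snd (sample \<omega>'))"
      using eq(2)[OF n] inj_onD[OF encq _ query_mem query_mem] unfolding Q_def by blast
    then show ?thesis
      using eq(1)[OF n] inj_onD[OF enca[OF n, folded st_def] _ answer_mem answer_mem] unfolding A_def by metis
  qed
  then show "file_rv \<theta> \<omega> = file_rv \<theta> \<omega>'"
    unfolding file_rv_def restrict_eq_restrict_iff W_def using decode[OF \<theta>] by blast
qed

text \<open>For a single server the randomness can be renamed by a bijection \<open>\<psi>\<close>
  so that the query for \<open>\<theta>'\<close> becomes the one for \<open>\<theta>\<close>. The
  contents stay fixed, hence so do answer and storage, and a bijection of sample points preserves
  the uniform law.\<close>

lemma privacy_P: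
  "distr P (count_space UNIV) (\<lambda>\<omega>. (Q \<theta> n \<omega>, A \<theta> n \<omega>, storage n \<omega>)) =
   distr P (count_space UNIV) (\<lambda>\<omega>. (Q \<theta>' n \<omega>, A \<theta>' n \<omega>, storage n \<omega>))"
proof -
  let ?qs = "query_space F K m"
  define \<psi> where "\<psi> = inv_into ?qs (query \<theta>' n) \<circ> query \<theta> n"
  have \<psi>: "bij_betw \<psi> ?qs ?qs"
    unfolding \<psi>_def by (rule bij_betw_trans[OF query_bij bij_betw_inv_into[OF query_bij]])
  have q\<psi>: "query \<theta>' n (\<psi> R) = query \<theta> n R" for R
    unfolding \<psi>_def comp_def using query_mem bij_betw_imp_surj_on[OF query_bij]
    by (metis f_inv_into_f)
  have pp: "bij_betw (map_prod id \<psi>) (file_space \<times> ?qs) (file_space \<times> ?qs)"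
    by (rule bij_betw_map_prod) (use \<psi> in auto)
  \<comment> \<open>The same renaming, transported to the numbers of the sample points.\<close>
  define \<phi> where "\<phi> = inv_into samples sample \<circ> map_prod id \<psi> \<circ> sample"
  have \<phi>: "bij_betw \<phi> samples samples"
    unfolding \<phi>_def
    by (rule bij_betw_trans[OF sample_bij bij_betw_trans[OF pp bij_betw_inv_into[OF sample_bij], unfolded comp_assoc[symmetric]]])
  have s\<phi>: "sample (\<phi> \<omega>) = (fst (sample \<omega>), \<psi> (snd (sample \<omega>)))" if "\<omega> \<in> samples" for \<omega>
  proof -
    have "map_prod id \<psi> (sample \<omega>) \<in> file_space \<times> ?qs"
      by (rule bij_betw_apply[OF pp bij_betw_apply[OF sample_bij that]])
    then have "sample (\<phi> \<omega>) = map_prod id \<psi> (sample \<omega>)"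
      unfolding \<phi>_def comp_def using bij_betw_imp_surj_on[OF sample_bij] by (metis f_inv_into_f)
    then show ?thesis by (simp add: prod_eq_iff)
  qed
  have st: "storage n \<omega> = storage n \<omega>'" if "fst (sample \<omega>) = fst (sample \<omega>')" for \<omega> \<omega>'
    using that by (simp add: storage_eq_iff W_def)
  show ?thesis
    unfolding P_def
  proof (rule distr_uniform_count_measure_eq[OF finite_samples \<phi>])
    fix \<omega> assume \<omega>: "\<omega> \<in> samples"
    show "(Q \<theta> n \<omega>, A \<theta> n \<omega>, storage n \<omega>) = (Q \<theta>' n (\<phi> \<omega>), A \<theta>' n (\<phi> \<omega>), storage n (\<phi> \<omega>))"
      using s\<phi>[OF \<omega>] st[of \<omega> "\<phi> \<omega>"] by (simp add: Q_def A_def q\<psi>)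
  qed
qed

sublocale scheme: sc_pir_scheme P "real CARD('f)" "real m / real N" N K L F W pkt st Q A
proof (intro sc_pir_scheme.intro sc_pir_scheme_axioms.intro)
  show "sc_pir P (real CARD('f))" by unfold_locales
  show "1 \<le> N" "1 \<le> K" "1 \<le> L" using m K L_pos by auto
  show "1 / real N \<le> real m / real N" "real m / real N \<le> 1" using m by (auto simp: divide_simps)
  show "(\<Union>n\<in>{1..N}. st n) = {1..F}"
  proof
    show "{1..F} \<subseteq> (\<Union>n\<in>{1..N}. st n)"
    proof
      fix i assume i: "i \<in> {1..F}"
      have "0 \<in> rank i ` servers i" using bij_betw_imp_surj_on[OF rank[OF i]] m by auto
      then show "i \<in> (\<Union>n\<in>{1..N}. st n)" using servers[OF i] i unfolding st_def by blast
    qed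
  qed (use st_subset in blast)
  show "partition_on {1..L} (pkt k ` {1..F}) \<and> inj_on (pkt k) {1..F}" for k
    by (rule packets_partition_P)
  show "prob_space.indep_vars P (\<lambda>_. count_space UNIV) (\<lambda>(k, j). W k j) ({1..K} \<times> {1..L})"
    by (rule symbols_indep_P)
  show "entropy_Pow (storage n) \<le> real m / real N * real K * real L" if "n \<in> {1..N}" for n
    using storage_entropy_P[OF that] by simp
qed (simp_all add: symbols_uniform_P packet_entropy_P simple_function_P
    queries_indep_P answer_determined_P decodability_P privacy_P)

text \<open>The entropy of an answer is at most its number of symbols. Summing over the servers
  counts every packet \<open>m\<close> times, and the closed form of \<open>inverse_capacity\<close>
  turns the total into the optimum.\<close>

lemma download_le: "download 1 \<le> real L * inverse_capacity K m"
proof -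
  have "entropy_Pow (A 1 n) \<le> real ((\<Sum>i\<in>st n. a i) * (m ^ K - 1))" if n: "n \<in> {1..N}" for n
  proof -
    let ?T = "requests (st n) K m a \<rightarrow>\<^sub>E (UNIV :: 'f set)"
    have fst: "finite (st n)" using st_subset finite_subset by blast
    have fr: "finite (requests (st n) K m a)" by (rule finite_requests[OF fst])
    have fT: "finite ?T" using fr by (intro finite_PiE) auto
    have "entropy_Pow (A 1 n) \<le> log (real CARD('f)) (real (card (enca n ` ?T)))"
      by (rule entropy_le_log_card[OF simple_function_P]) (use fT answer_mem in \<open>auto simp: A_def\<close>)
    also have "card (enca n ` ?T) = card ?T"
      by (rule card_image[OF enca[OF n, folded st_def]])
    also have "card ?T = CARD('f) ^ card (requests (st n) K m a)"
      by (simp add: card_PiE fr)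
    also have "log (real CARD('f)) (real (CARD('f) ^ card (requests (st n) K m a))) = real (card (requests (st n) K m a))"
      using card_UNIV_gt_1 by (simp add: log_nat_power)
    also have "card (requests (st n) K m a) = (\<Sum>i\<in>st n. a i) * (m ^ K - 1)"
      by (rule card_requests[OF fst]) (use m in simp)
    finally show ?thesis .
  qed
  then have "download 1 \<le> (\<Sum>n=1..N. real ((\<Sum>i\<in>st n. a i) * (m ^ K - 1)))"
    unfolding download_def by (rule sum_mono)
  also have "\<dots> = real (\<Sum>n=1..N. \<Sum>i\<in>st n. a i) * real (m ^ K - 1)"
    by (simp only: of_nat_sum of_nat_mult sum_distrib_right)
  also have "(\<Sum>n=1..N. \<Sum>i\<in>st n. a i) = (\<Sum>n=1..N. \<Sum>i | i \<in> {1..F} \<and> n \<in> servers i. a i)"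
    unfolding st_def by simp
  also have "\<dots> = (\<Sum>i=1..F. \<Sum>n | n \<in> {1..N} \<and> n \<in> servers i. a i)"
    by (rule sum.swap_restrict) auto
  also have "\<dots> = (\<Sum>i=1..F. m * a i)"
  proof (rule sum.cong[OF refl])
    fix i assume i: "i \<in> {1..F}"
    have "{n. n \<in> {1..N} \<and> n \<in> servers i} = servers i" using servers[OF i] by blast
    moreover have "card (servers i) = m" using bij_betw_same_card[OF rank[OF i]] by simp
    ultimately show "(\<Sum>n | n \<in> {1..N} \<and> n \<in> servers i. a i) = m * a i" by simp
  qed
  also have "\<dots> = m * (\<Sum>i=1..F. a i)" by (simp add: sum_distrib_left)
  also have "real (m * (\<Sum>i=1..F. a i)) * real (m ^ K - 1) = real (\<Sum>i=1..F. a i) * real (m * (m ^ K - 1))"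
    by (simp only: of_nat_mult mult_ac)
  also have "\<dots> = real L * inverse_capacity K m"
    unfolding inverse_capacity_closed_form[OF m(1), symmetric] by (subst L_eq) (simp only: of_nat_mult mult_ac)
  finally show ?thesis .
qed

text \<open>The converse supplies the opposite inequality, so the answer entropies need no exact
  computation.\<close>

lemma rate_eq: "rate = 1 / inverse_capacity K m"
proof -
  have "real m = real m / real N * real N" using m by simp
  then have "download 1 = real L * inverse_capacity K m"
    using scheme.download_ge[OF K, of m] download_le m by linarith
  then show ?thesis using L_pos by (simp add: rate_def)
qed

lemma storage_design_P:
  assumes \<alpha>: "\<And>S. S \<subseteq> {1..N} \<Longrightarrow> \<alpha> S * real (\<Sum>i=1..F. a i) = real (\<Sum>i | i \<in> {1..F} \<and> servers i = S. a i)"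
  shows "storage_design \<alpha>"
  unfolding storage_design_def
proof (intro ballI allI impI)
  fix k S assume k: "k \<in> {1..K}" and S: "S \<subseteq> {1..N}"
  have "packet_type i = servers i" if "i \<in> {1..F}" for i
    using that servers[OF that] unfolding packet_type_def st_def by auto
  then have "exclusive S = {i. i \<in> {1..F} \<and> servers i = S}"
    unfolding exclusive_eq_packet_type[OF S] by blast
  then have "type_size S = (\<Sum>i | i \<in> {1..F} \<and> servers i = S. a i * (m ^ K * (m - 1)))"
    unfolding type_size_def by (auto intro!: sum.cong simp: card_pkt)
  also have "\<dots> = (\<Sum>i | i \<in> {1..F} \<and> servers i = S. a i) * (m ^ K * (m - 1))"
    by (simp only: sum_distrib_right)
  finally have "entropy_Pow (exclusive_part k S) = real (\<Sum>i | i \<in> {1..F} \<and> servers i = S. a i) * real (m ^ K * (m - 1))"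
    using scheme.entropy_exclusive_part[OF k, of S] by (simp only: of_nat_mult)
  also have "\<dots> = \<alpha> S * real L"
    unfolding \<alpha>[OF S, symmetric] by (subst L_eq) (simp only: of_nat_mult mult_ac)
  finally show "entropy_Pow (exclusive_part k S) = \<alpha> S * real L" .
qed

end

section \<open>Necessary and sufficient storage conditions\<close>

lemma ex_optimal_scheme:
  fixes N K m :: nat and c :: "nat set \<Rightarrow> nat" and \<alpha> :: "nat set \<Rightarrow> real"
  assumes K: "2 \<le> K" and m: "2 \<le> m" "m \<le> N"
    and size: "\<And>S. S \<subseteq> {1..N} \<Longrightarrow> card S \<noteq> m \<Longrightarrow> c S = 0"
    and load: "\<And>n. n \<in> {1..N} \<Longrightarrow>
      N * (\<Sum>S | S \<subseteq> {1..N} \<and> n \<in> S. c S) = m * (\<Sum>S | S \<subseteq> {1..N}. c S)"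
    and total: "0 < (\<Sum>S | S \<subseteq> {1..N}. c S)"
    and \<alpha>: "\<And>S. S \<subseteq> {1..N} \<Longrightarrow> \<alpha> S * real (\<Sum>S | S \<subseteq> {1..N}. c S) = real (c S)"
  shows "\<exists>(M :: nat measure) b L F (W :: nat \<Rightarrow> nat \<Rightarrow> nat \<Rightarrow> 'f::{field,finite}) pkt st
        (Q :: nat \<Rightarrow> nat \<Rightarrow> nat \<Rightarrow> nat) (A :: nat \<Rightarrow> nat \<Rightarrow> nat \<Rightarrow> nat).
        sc_pir_scheme M b (real m / real N) N K L F W pkt st Q A \<and>
        sc_pir.rate M b N L A = 1 / inverse_capacity K m \<and>
        sc_pir.storage_design M b N K L F W pkt st \<alpha>"
proof -
  \<comment> \<open>One packet is formed for each \<open>S\<close> with \<open>c S > 0\<close>, in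
    \<open>c S\<close> copies; the other sets are left out because packets must be nonempty.\<close>
  define T where "T = {S. S \<subseteq> {1..N} \<and> 0 < c S}"
  define F where "F = card T"
  have fin: "finite T" unfolding T_def by simp
  obtain servers where servers: "bij_betw servers {1..F} T"
    using ex_bij_betw_nat_finite_1[OF fin] unfolding F_def by blast
  define a where "a i = c (servers i)" for i
  have sT: "servers i \<subseteq> {1..N} \<and> 0 < c (servers i)" if "i \<in> {1..F}" for i
    using bij_betw_apply[OF servers that] unfolding T_def by simp
  have sum_a: "(\<Sum>i | i \<in> {1..F} \<and> R (servers i). a i) = (\<Sum>S | S \<subseteq> {1..N} \<and> R S. c S)" for R
  proof -
    have "servers ` {i. i \<in> {1..F} \<and> R (servers i)} = {S \<in> T. R S}"
      unfolding bij_betw_imp_surj_on[OF servers, symmetric] by blast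
    then have "bij_betw servers {i. i \<in> {1..F} \<and> R (servers i)} {S \<in> T. R S}"
      by (intro bij_betw_subset[OF servers]) auto
    then have "(\<Sum>i | i \<in> {1..F} \<and> R (servers i). a i) = (\<Sum>S | S \<in> T \<and> R S. c S)"
      unfolding a_def by (rule sum.reindex_bij_betw)
    also have "\<dots> = (\<Sum>S | S \<subseteq> {1..N} \<and> R S. c S)"
      by (rule sum.mono_neutral_left) (auto simp: T_def)
    finally show ?thesis .
  qed
  have sum_a_all: "(\<Sum>i=1..F. a i) = (\<Sum>S | S \<subseteq> {1..N}. c S)"
    using sum_a[of "\<lambda>_. True"] by (simp add: atLeastAtMost_def atLeast_def atMost_def Int_def)
  have "\<exists>r. bij_betw r (servers i) {..<m}" if i: "i \<in> {1..F}" for i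
  proof -
    have "card (servers i) = m" using size[of "servers i"] sT[OF i] by fastforce
    moreover have "finite (servers i)" using sT[OF i] finite_subset by blast
    ultimately show ?thesis using ex_bij_betw_finite_nat[of "servers i"] by (simp add: lessThan_atLeast0)
  qed
  then obtain rank where rank: "\<And>i. i \<in> {1..F} \<Longrightarrow> bij_betw (rank i) (servers i) {..<m}" by metis
  have fin_places: "finite (places {1..F} K m a)"
    unfolding places_def using finite_tuples by blast
  define L where "L = card (places {1..F} K m a)"
  obtain loc where loc: "bij_betw loc (places {1..F} K m a) {1..L}"
    using ex_bij_betw_nat_finite_1[OF fin_places] bij_betw_inv unfolding L_def by blast
  have fin_q: "finite (query_space F K m)" unfolding query_space_def by (intro finite_PiE) auto
  let ?\<Omega> = "(({1..K} \<times> {1..L}) \<rightarrow>\<^sub>E (UNIV :: 'f set)) \<times> query_space F K m"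
  have "finite ?\<Omega>" using fin_q by (intro finite_cartesian_product finite_PiE) auto
  then obtain sample where sample: "bij_betw sample {..<card ?\<Omega>} ?\<Omega>"
    using ex_bij_betw_nat_finite[of ?\<Omega>] by (auto simp: lessThan_atLeast0)
  obtain encq :: "(nat \<times> nat \<Rightarrow> nat) \<Rightarrow> nat" where encq: "inj_on encq (query_space F K m)"
    using finite_imp_inj_to_nat_seg[OF fin_q] by blast
  have "\<forall>n. \<exists>e :: _ \<Rightarrow> nat. inj_on e (requests {i \<in> {1..F}. n \<in> servers i} K m a \<rightarrow>\<^sub>E (UNIV :: 'f set))"
  proof
    fix n
    have "finite (requests {i \<in> {1..F}. n \<in> servers i} K m a \<rightarrow>\<^sub>E (UNIV :: 'f set))"
      by (intro finite_PiE finite_requests) auto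
    from finite_imp_inj_to_nat_seg[OF this]
    show "\<exists>e :: _ \<Rightarrow> nat. inj_on e (requests {i \<in> {1..F}. n \<in> servers i} K m a \<rightarrow>\<^sub>E (UNIV :: 'f set))"
      by blast
  qed
  from choice[OF this] obtain enca :: "nat \<Rightarrow> (nat \<times> nat \<times> (nat \<Rightarrow> nat) \<Rightarrow> 'f) \<Rightarrow> nat" where enca:
    "\<forall>n. inj_on (enca n) (requests {i \<in> {1..F}. n \<in> servers i} K m a \<rightarrow>\<^sub>E (UNIV :: 'f set))" ..
  have F: "1 \<le> F"
  proof -
    have "T \<noteq> {}"
    proof
      assume "T = {}"
      then have "(\<Sum>S | S \<subseteq> {1..N}. c S) = 0" unfolding T_def by (intro sum.neutral) auto
      then show False using total by simp
    qed
    then show ?thesis unfolding F_def using fin by (simp add: Suc_le_eq card_gt_0_iff)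
  qed
  interpret pir_construction N K m F L a servers rank loc sample encq enca
  proof
    show "2 \<le> K" "2 \<le> m" "m \<le> N" "1 \<le> F" by fact+
    show "0 < a i" "servers i \<subseteq> {1..N}" "bij_betw (rank i) (servers i) {..<m}" if "i \<in> {1..F}" for i
      using sT[OF that] rank[OF that] by (simp_all add: a_def)
    show "N * (\<Sum>i | i \<in> {1..F} \<and> n \<in> servers i. a i) = m * (\<Sum>i=1..F. a i)" if "n \<in> {1..N}" for n
      unfolding sum_a sum_a_all by (rule load[OF that])
    show "inj_on (enca n) (requests {i \<in> {1..F}. n \<in> servers i} K m a \<rightarrow>\<^sub>E UNIV)" for n
      using enca by (rule spec)
  qed fact+
  have "\<alpha> S * real (\<Sum>i=1..F. a i) = real (\<Sum>i | i \<in> {1..F} \<and> servers i = S. a i)" if S: "S \<subseteq> {1..N}" for S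
  proof -
    have "{S'. S' \<subseteq> {1..N} \<and> S' = S} = {S}" using S by blast
    then show ?thesis unfolding sum_a[of "\<lambda>S'. S' = S"] sum_a_all using \<alpha>[OF S] by simp
  qed
  then have "storage_design \<alpha>" by (rule storage_design_P)
  then show ?thesis using scheme.sc_pir_scheme_axioms rate_eq by blast
qed

text \<open>The converse bounds all rates, and the symmetric design with one copy for each set of
  \<open>m\<close> servers attains the bound, so the supremum is a maximum.\<close>

lemma capacity_value:
  assumes K: "2 \<le> K" and m: "2 \<le> m" "m \<le> N"
  shows "capacity TYPE('f::{field,finite}) (real m / real N) N K = 1 / inverse_capacity K m"
proof -
  define c :: "nat set \<Rightarrow> nat" where "c S = (if card S = m then 1 else 0)" for S
  have count: "(\<Sum>S | S \<subseteq> X \<and> R S. c S) = card {S. S \<subseteq> X \<and> R S \<and> card S = m}" if "finite X" for X R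
  proof -
    have "finite {S. S \<subseteq> X \<and> R S}" using that by simp
    then have "(\<Sum>S | S \<subseteq> X \<and> R S. c S) = card {S \<in> {S. S \<subseteq> X \<and> R S}. card S = m}"
      unfolding c_def by (subst sum.inter_filter[symmetric]) simp_all
    then show ?thesis by (simp add: conj_assoc)
  qed
  have total: "(\<Sum>S | S \<subseteq> {1..N}. c S) = N choose m"
    using count[of "{1..N}" "\<lambda>_. True"] n_subsets[of "{1..N}" m] by simp
  have member: "(\<Sum>S | S \<subseteq> {1..N} \<and> n \<in> S. c S) = (N - 1) choose (m - 1)" if n: "n \<in> {1..N}" for n
  proof -
    have fin: "finite S" if "S \<subseteq> {1..N}" for S using that finite_subset by blast
    have "bij_betw (insert n) {S. S \<subseteq> {1..N} - {n} \<and> card S = m - 1} {S. S \<subseteq> {1..N} \<and> n \<in> S \<and> card S = m}"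
    proof (rule bij_betwI[where g = "\<lambda>S. S - {n}"])
      show "insert n \<in> {S. S \<subseteq> {1..N} - {n} \<and> card S = m - 1} \<rightarrow> {S. S \<subseteq> {1..N} \<and> n \<in> S \<and> card S = m}"
      proof
        fix S assume S: "S \<in> {S. S \<subseteq> {1..N} - {n} \<and> card S = m - 1}"
        then have "finite S" "n \<notin> S" using fin by blast+
        then show "insert n S \<in> {S. S \<subseteq> {1..N} \<and> n \<in> S \<and> card S = m}" using S n m by auto
      qed
    qed (use fin in auto)
    then have "card {S. S \<subseteq> {1..N} \<and> n \<in> S \<and> card S = m} = card {S. S \<subseteq> {1..N} - {n} \<and> card S = m - 1}"
      by (rule bij_betw_same_card[symmetric])
    also have "\<dots> = (N - 1) choose (m - 1)"
      using n_subsets[of "{1..N} - {n}" "m - 1"] n by simp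
    finally show ?thesis using count[of "{1..N}" "\<lambda>S. n \<in> S"] by simp
  qed
  have size: "c S = 0" if "S \<subseteq> {1..N}" "card S \<noteq> m" for S
    using that unfolding c_def by simp
  \<comment> \<open>The absorption identity
    \<open>N * ((N - 1) choose (m - 1)) = m * (N choose m)\<close>.\<close>
  have load: "N * (\<Sum>S | S \<subseteq> {1..N} \<and> n \<in> S. c S) = m * (\<Sum>S | S \<subseteq> {1..N}. c S)" if "n \<in> {1..N}" for n
    unfolding member[OF that] total using binomial_absorption[of "m - 1" N] m by simp
  have pos: "0 < (\<Sum>S | S \<subseteq> {1..N}. c S)" unfolding total using m by simp
  have frac: "real (c S) / real (N choose m) * real (\<Sum>S | S \<subseteq> {1..N}. c S) = real (c S)" for S
    unfolding total using m by simp
  have "achievable_rate TYPE('f) (real m / real N) N K (1 / inverse_capacity K m)"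
    using ex_optimal_scheme[OF K m size load pos frac, where 'f = 'f] unfolding achievable_rate_def by blast
  moreover have "R \<le> 1 / inverse_capacity K m" if R: "achievable_rate TYPE('f) (real m / real N) N K R" for R
  proof -
    have "real m = real m / real N * real N" "1 \<le> m" using m by simp_all
    then show ?thesis
      using R sc_pir_scheme.rate_le[OF _ K, of _ _ _ N _ _ _ _ _ _ _ m] unfolding achievable_rate_def by blast
  qed
  ultimately show ?thesis
    unfolding capacity_def by (intro cSup_eq_maximum) auto
qed

lemma capacity_achieving_design_imp:
  assumes K: "2 \<le> K" and m: "2 \<le> m" "m \<le> N"
    and "capacity_achieving_design TYPE('f::{field,finite}) (real m / real N) N K \<alpha>"
  shows "stored_at_exactly m N \<alpha> \<and> storage_used_up (real m / real N) N \<alpha>"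
proof -
  obtain M :: "nat measure" and b L F and W :: "nat \<Rightarrow> nat \<Rightarrow> nat \<Rightarrow> 'f" and pkt st
    and Q A :: "nat \<Rightarrow> nat \<Rightarrow> nat \<Rightarrow> nat"
    where s: "sc_pir_scheme M b (real m / real N) N K L F W pkt st Q A"
      "sc_pir.rate M b N L A = capacity TYPE('f) (real m / real N) N K"
      "sc_pir.storage_design M b N K L F W pkt st \<alpha>"
    using assms(4) unfolding capacity_achieving_design_def by blast
  have "real m = real m / real N * real N" "1 \<le> m" using m by simp_all
  then show ?thesis
    using sc_pir_scheme.optimal_rate_design[OF s(1) K _ _ s(2)[unfolded capacity_value[OF K m]] s(3)] by blast
qed

section \<open>Rational parameters, approximation and limits\<close>

lemma sum_storage_fractions:
  assumes m: "0 < m" "0 < N"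
    and \<alpha>: "stored_at_exactly m N \<alpha>" "storage_used_up (real m / real N) N \<alpha>"
  shows "(\<Sum>S | S \<subseteq> {1..N}. \<alpha> S) = 1"
proof -
  \<comment> \<open>Double counting of members: only sets of cardinality \<open>m\<close>
    contribute, and the \<open>N\<close> server loads of \<open>m / N\<close> add up to
    \<open>m\<close>.\<close>
  have "real m * (\<Sum>S | S \<subseteq> {1..N}. \<alpha> S) = (\<Sum>S | S \<subseteq> {1..N}. real (card S) * \<alpha> S)"
    unfolding sum_distrib_left by (rule sum.cong) (use \<alpha>(1) in \<open>auto simp: stored_at_exactly_def\<close>)
  also have "\<dots> = (\<Sum>n\<in>{1..N}. \<Sum>S | S \<subseteq> {1..N} \<and> n \<in> S. \<alpha> S)"
    by (rule sum_over_members[symmetric])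
  also have "\<dots> = (\<Sum>n\<in>{1..N}. real m / real N)"
    by (rule sum.cong) (use \<alpha>(2) in \<open>auto simp: storage_used_up_def\<close>)
  also have "\<dots> = real m" using m by simp
  finally show ?thesis using m by simp
qed

lemma ex_common_denominator:
  assumes "finite X" "\<And>x. x \<in> X \<Longrightarrow> f x \<in> \<rat>" "\<And>x. x \<in> X \<Longrightarrow> 0 \<le> (f x :: real)"
  shows "\<exists>B>0. \<forall>x\<in>X. \<exists>k. f x * real B = real (k :: nat)"
  using assms
proof (induction X)
  case (insert y X)
  then obtain B where B: "B > 0" "\<forall>x\<in>X. \<exists>k. f x * real B = real (k :: nat)" by auto
  have "f y \<in> \<rat>" "0 \<le> f y" using insert.prems by simp_all
  then obtain p q :: nat where q: "q \<noteq> 0" "\<bar>f y\<bar> = real p / real q"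
    using Rats_abs_nat_div_natE by metis
  have "\<exists>k. f x * real (B * q) = real (k :: nat)" if "x \<in> insert y X" for x
  proof (cases "x = y")
    case True
    then have "f x * real (B * q) = real (p * B)" using q \<open>0 \<le> f y\<close> by simp
    then show ?thesis by blast
  next
    case False
    then have "x \<in> X" using that by simp
    then obtain k :: nat where "f x * real B = real k" using B(2) by blast
    then have "f x * real (B * q) = real (k * q)" by simp
    then show ?thesis by blast
  qed
  then show ?case using B(1) q(1) by (intro exI[of _ "B * q"]) auto
qed auto

text \<open>With a common denominator \<open>B\<close>, the integers
  \<open>c S = \<alpha> S * B\<close> serve as copy numbers; their total is \<open>B\<close> because
  the fractions sum to \<open>1\<close>.\<close>

lemma capacity_achieving_design_rational:
  assumes K: "2 \<le> K" and m: "2 \<le> m" "m \<le> N"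
    and \<alpha>: "\<And>S. S \<subseteq> {1..N} \<Longrightarrow> \<alpha> S \<in> \<rat>" "\<And>S. S \<subseteq> {1..N} \<Longrightarrow> 0 \<le> \<alpha> S"
    and P: "stored_at_exactly m N \<alpha>" "storage_used_up (real m / real N) N \<alpha>"
  shows "capacity_achieving_design TYPE('f::{field,finite}) (real m / real N) N K \<alpha>"
proof -
  have "\<exists>B>0. \<forall>S\<in>{S. S \<subseteq> {1..N}}. \<exists>k. \<alpha> S * real B = real (k :: nat)"
    by (rule ex_common_denominator) (use \<alpha> in auto)
  then obtain B and c :: "nat set \<Rightarrow> nat" where B: "B > 0"
    and c: "\<And>S. S \<subseteq> {1..N} \<Longrightarrow> \<alpha> S * real B = real (c S)" by (simp, metis)
  have sum_c: "real (\<Sum>S | S \<subseteq> {1..N} \<and> R S. c S) = (\<Sum>S | S \<subseteq> {1..N} \<and> R S. \<alpha> S) * real B" for R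
    unfolding of_nat_sum sum_distrib_right by (rule sum.cong) (use c in auto)
  have "real (\<Sum>S | S \<subseteq> {1..N}. c S) = real B"
    using sum_c[of "\<lambda>_. True"] sum_storage_fractions[OF _ _ P] m by simp
  then have total: "(\<Sum>S | S \<subseteq> {1..N}. c S) = B" by linarith
  have load: "N * (\<Sum>S | S \<subseteq> {1..N} \<and> n \<in> S. c S) = m * B" if n: "n \<in> {1..N}" for n
  proof -
    have "real (\<Sum>S | S \<subseteq> {1..N} \<and> n \<in> S. c S) = real m / real N * real B"
      using sum_c[of "\<lambda>S. n \<in> S"] P(2) n unfolding storage_used_up_def by simp
    then have "real N * real (\<Sum>S | S \<subseteq> {1..N} \<and> n \<in> S. c S) = real m * real B" using m by (simp del: of_nat_sum)
    then show ?thesis by (metis of_nat_eq_iff of_nat_mult)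
  qed
  have size: "c S = 0" if "S \<subseteq> {1..N}" "card S \<noteq> m" for S
    using c[OF that(1)] P(1) that unfolding stored_at_exactly_def by simp
  show ?thesis
    unfolding capacity_achieving_design_def capacity_value[OF K m]
  proof (rule ex_optimal_scheme[OF K m size])
    show "N * (\<Sum>S | S \<subseteq> {1..N} \<and> n \<in> S. c S) = m * (\<Sum>S | S \<subseteq> {1..N}. c S)" if "n \<in> {1..N}" for n
      unfolding total by (rule load[OF that])
    show "0 < (\<Sum>S | S \<subseteq> {1..N}. c S)" unfolding total by (rule B)
    show "\<alpha> S * real (\<Sum>S | S \<subseteq> {1..N}. c S) = real (c S)" if "S \<subseteq> {1..N}" for S
      unfolding total by (rule c[OF that])
  qed
qed

text \<open>Simultaneous approximation rounds all \<open>q * N * \<alpha> S\<close> to integers.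
  Nonnegativity, (P1) and (P2), once multiplied out, are relations between integers, and rounding
  errors below \<open>1\<close> cannot break them.\<close>

lemma ex_rational_design_near:
  assumes m: "0 < m" "0 < N" and \<epsilon>: "0 < \<epsilon>"
    and \<alpha>: "\<And>S. S \<subseteq> {1..N} \<Longrightarrow> 0 \<le> \<alpha> S"
    and P: "stored_at_exactly m N \<alpha>" "storage_used_up (real m / real N) N \<alpha>"
  obtains \<beta> where "\<And>S. S \<subseteq> {1..N} \<Longrightarrow> \<beta> S \<in> \<rat>" "\<And>S. S \<subseteq> {1..N} \<Longrightarrow> 0 \<le> \<beta> S"
    "stored_at_exactly m N \<beta>" "storage_used_up (real m / real N) N \<beta>"
    "\<And>S. S \<subseteq> {1..N} \<Longrightarrow> \<bar>\<beta> S - \<alpha> S\<bar> \<le> \<epsilon>"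
proof -
  define X where "X = {S. S \<subseteq> {1..N}}"
  have fin: "finite X" unfolding X_def by simp
  obtain g where g: "bij_betw g {0..<card X} X" using ex_bij_betw_nat_finite[OF fin] by blast
  \<comment> \<open>Exceeding the number of sets keeps summed rounding errors below
    \<open>1\<close>; exceeding \<open>1 / \<epsilon>\<close> gives closeness.\<close>
  obtain D where D: "real D > max (real (card X)) (1 / \<epsilon>)" using reals_Archimedean2 by blast
  have "0 < 1 / \<epsilon>" using \<epsilon> by simp
  then have D0: "D > 0" using D by (metis less_trans max_less_iff_conj of_nat_0_less_iff)
  have DX: "real (card X) < real D" and De: "1 / real D < \<epsilon>"
    using D \<epsilon> D0 by (simp_all add: field_simps)
  \<comment> \<open>The factor \<open>N\<close> makes the target
    \<open>q * N * (m / N) = q * m\<close> of (P2) an integer.\<close>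
  obtain q p where q: "0 < q" and p: "\<And>i. i < card X \<Longrightarrow> \<bar>of_int q * (real N * \<alpha> (g i)) - of_int (p i)\<bar> < 1 / real D"
    using Dirichlet_approx_simult[OF D0, of "card X" "\<lambda>i. real N * \<alpha> (g i)"] by blast
  define r where "r S = p (inv_into {0..<card X} g S)" for S
  have r: "\<bar>of_int q * real N * \<alpha> S - of_int (r S)\<bar> < 1 / real D" if S: "S \<subseteq> {1..N}" for S
  proof -
    have "S \<in> g ` {0..<card X}" using S bij_betw_imp_surj_on[OF g] unfolding X_def by simp
    then show ?thesis
      using p[of "inv_into {0..<card X} g S"] inv_into_into[of S g "{0..<card X}"]
      by (simp add: r_def f_inv_into_f mult.assoc)
  qed
  have D1: "1 / real D \<le> 1" using D0 by simp
  define \<beta> where "\<beta> S = of_int (r S) / (of_int q * real N)" for S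
  have qN: "0 < of_int q * real N" using q m by simp
  show thesis
  proof
    show "\<beta> S \<in> \<rat>" for S unfolding \<beta>_def by simp
    show "0 \<le> \<beta> S" if S: "S \<subseteq> {1..N}" for S
    proof -
      have "0 \<le> of_int q * real N * \<alpha> S" using qN \<alpha>[OF S] by simp
      then have "- 1 < real_of_int (r S)" using r[OF S] D1 by linarith
      then have "0 \<le> r S" by linarith
      then show ?thesis unfolding \<beta>_def using qN by simp
    qed
    show "stored_at_exactly m N \<beta>"
      unfolding stored_at_exactly_def
    proof (intro allI impI)
      fix S assume S: "S \<subseteq> {1..N} \<and> card S \<noteq> m"
      then have "\<alpha> S = 0" using P(1) unfolding stored_at_exactly_def by blast
      then have "\<bar>real_of_int (r S)\<bar> < 1" using r[of S] S D1 by simp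
      then have "r S = 0" by linarith
      then show "\<beta> S = 0" unfolding \<beta>_def by simp
    qed
    show "storage_used_up (real m / real N) N \<beta>"
      unfolding storage_used_up_def
    proof
      fix n assume n: "n \<in> {1..N}"
      let ?Y = "{S. S \<subseteq> {1..N} \<and> n \<in> S}"
      have Y: "finite ?Y" "card ?Y \<le> card X"
        using fin unfolding X_def by (auto intro!: card_mono)
      have "(\<Sum>S\<in>?Y. of_int q * real N * \<alpha> S) = of_int q * real N * (real m / real N)"
        using P(2) n unfolding storage_used_up_def by (simp add: sum_distrib_left[symmetric])
      then have eq: "(\<Sum>S\<in>?Y. of_int q * real N * \<alpha> S) = real_of_int (q * int m)" using m by simp
      have "\<bar>real_of_int (q * int m) - real_of_int (\<Sum>S\<in>?Y. r S)\<bar> = \<bar>\<Sum>S\<in>?Y. of_int q * real N * \<alpha> S - of_int (r S)\<bar>"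
        unfolding eq[symmetric] by (simp add: sum_subtractf)
      also have "\<dots> \<le> (\<Sum>S\<in>?Y. \<bar>of_int q * real N * \<alpha> S - of_int (r S)\<bar>)" by (rule sum_abs)
      also have "\<dots> \<le> (\<Sum>S\<in>?Y. 1 / real D)" by (rule sum_mono) (use r less_imp_le in blast)
      also have "\<dots> = real (card ?Y) / real D" by simp
      also have "\<dots> < 1" using Y(2) DX D0 by (simp add: divide_less_eq)
      finally have "(\<Sum>S\<in>?Y. r S) = q * int m" by linarith
      then have "real_of_int (\<Sum>S\<in>?Y. r S) = of_int q * real m" by simp
      then have "(\<Sum>S\<in>?Y. \<beta> S) = of_int q * real m / (of_int q * real N)"
        unfolding \<beta>_def sum_divide_distrib[symmetric] by simp
      then show "(\<Sum>S\<in>?Y. \<beta> S) = real m / real N" using q by simp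
    qed
    show "\<bar>\<beta> S - \<alpha> S\<bar> \<le> \<epsilon>" if S: "S \<subseteq> {1..N}" for S
    proof -
      have "\<alpha> S - \<beta> S = (of_int q * real N * \<alpha> S - of_int (r S)) / (of_int q * real N)"
        unfolding \<beta>_def using q m by (simp add: field_simps)
      then have "\<bar>\<alpha> S - \<beta> S\<bar> = \<bar>of_int q * real N * \<alpha> S - of_int (r S)\<bar> / (of_int q * real N)"
        using qN by (simp only: abs_divide abs_of_pos)
      also have "\<dots> \<le> \<bar>of_int q * real N * \<alpha> S - of_int (r S)\<bar> / 1"
      proof (rule divide_left_mono)
        have "1 \<le> real_of_int q" "1 \<le> real N" using q m by simp_all
        then show "1 \<le> of_int q * real N" using mult_mono[of 1 "real_of_int q" 1 "real N"] by simp
      qed (use qN in auto)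
      also have "\<dots> \<le> \<epsilon>" using r[OF S] De by simp
      finally show ?thesis by (simp only: abs_minus_commute)
    qed
  qed
qed

text \<open>Both conditions are finitely many linear equations in the parameters, hence closed under
  limits.\<close>

lemma limit_design_properties:
  assumes lim: "\<And>\<epsilon>. 0 < \<epsilon> \<Longrightarrow> \<exists>\<beta>. stored_at_exactly m N \<beta> \<and> storage_used_up \<mu> N \<beta> \<and>
      (\<forall>S. S \<subseteq> {1..N} \<longrightarrow> \<bar>\<beta> S - \<alpha> S\<bar> \<le> \<epsilon>)"
  shows "stored_at_exactly m N \<alpha> \<and> storage_used_up \<mu> N \<alpha>"
proof
  show "stored_at_exactly m N \<alpha>"
    unfolding stored_at_exactly_def
  proof (intro allI impI)
    fix S assume S: "S \<subseteq> {1..N} \<and> card S \<noteq> m"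
    have "\<bar>\<alpha> S\<bar> \<le> 0 + \<epsilon>" if \<epsilon>: "0 < \<epsilon>" for \<epsilon>
    proof -
      obtain \<beta> where "stored_at_exactly m N \<beta>" "\<bar>\<beta> S - \<alpha> S\<bar> \<le> \<epsilon>" using lim[OF \<epsilon>] S by blast
      then show ?thesis using S unfolding stored_at_exactly_def by simp
    qed
    then have "\<bar>\<alpha> S\<bar> \<le> 0" by (rule field_le_epsilon)
    then show "\<alpha> S = 0" by simp
  qed
  show "storage_used_up \<mu> N \<alpha>"
    unfolding storage_used_up_def
  proof
    fix n assume n: "n \<in> {1..N}"
    let ?Y = "{S. S \<subseteq> {1..N} \<and> n \<in> S}"
    have "\<bar>(\<Sum>S\<in>?Y. \<alpha> S) - \<mu>\<bar> \<le> 0 + \<epsilon>" if \<epsilon>: "0 < \<epsilon>" for \<epsilon>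
    proof -
      \<comment> \<open>The \<open>+ 1\<close> keeps the denominator positive without counting
        \<open>?Y\<close>; \<open>card ?Y\<close> errors of size \<open>\<delta>\<close> still add
        up to at most \<open>\<epsilon>\<close>.\<close>
      define \<delta> where "\<delta> = \<epsilon> / (real (card ?Y) + 1)"
      have \<delta>: "0 < \<delta>" unfolding \<delta>_def using \<epsilon> by simp
      obtain \<beta> where \<beta>: "storage_used_up \<mu> N \<beta>" "\<forall>S. S \<subseteq> {1..N} \<longrightarrow> \<bar>\<beta> S - \<alpha> S\<bar> \<le> \<delta>" using lim[OF \<delta>] by blast
      have "\<bar>(\<Sum>S\<in>?Y. \<alpha> S) - \<mu>\<bar> = \<bar>\<Sum>S\<in>?Y. \<beta> S - \<alpha> S\<bar>"
        using \<beta>(1) n unfolding storage_used_up_def sum_subtractf by (simp add: abs_minus_commute)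
      also have "\<dots> \<le> (\<Sum>S\<in>?Y. \<bar>\<beta> S - \<alpha> S\<bar>)" by (rule sum_abs)
      also have "\<dots> \<le> (\<Sum>S\<in>?Y. \<delta>)" by (rule sum_mono) (use \<beta>(2) in blast)
      also have "\<dots> = real (card ?Y) * \<delta>" by simp
      also have "\<dots> \<le> (real (card ?Y) + 1) * \<delta>" using \<delta> by simp
      also have "\<dots> = \<epsilon>" unfolding \<delta>_def by simp
      finally show ?thesis by simp
    qed
    then have "\<bar>(\<Sum>S\<in>?Y. \<alpha> S) - \<mu>\<bar> \<le> 0" by (rule field_le_epsilon)
    then show "(\<Sum>S\<in>?Y. \<alpha> S) = \<mu>" by simp
  qed
qed

text \<open>In an exact design the values \<open>\<alpha> S * L\<close> are integers, so exact
  designs have rational parameters and general real ones are reached as limits. For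
  \<open>K = 1\<close> the reciprocal capacity is constant in the replication number and does not
  constrain the storage, whence \<open>2 \<le> K\<close>.\<close>

theorem corollary1:
  fixes \<mu> :: real and N K M :: nat and \<alpha> :: "nat set \<Rightarrow> real"
  assumes "2 \<le> K"
    and "real M = \<mu> * real N" and "M \<in> {2..N}"
    and "\<And>S. S \<subseteq> {1..N} \<Longrightarrow> \<alpha> S \<in> {0..1}"
  shows "((\<forall>S. S \<subseteq> {1..N} \<longrightarrow> \<alpha> S \<in> \<rat>) \<longrightarrow>
            (capacity_achieving_design TYPE('f::{field,finite}) \<mu> N K \<alpha> \<longleftrightarrow>
               stored_at_exactly M N \<alpha> \<and> storage_used_up \<mu> N \<alpha>)) \<and>
         (limit_capacity_achieving_design TYPE('f) \<mu> N K \<alpha> \<longleftrightarrow>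
            stored_at_exactly M N \<alpha> \<and> storage_used_up \<mu> N \<alpha>)"
proof -
  have M: "2 \<le> M" "M \<le> N" "0 < M" "0 < N" using assms(3) by auto
  have \<mu>: "\<mu> = real M / real N" using assms(2) M by simp
  have nonneg: "0 \<le> \<alpha> S" if "S \<subseteq> {1..N}" for S using assms(4)[OF that] by simp
  note necessary = capacity_achieving_design_imp[OF assms(1) M(1,2), where 'f = 'f]
  note sufficient = capacity_achieving_design_rational[OF assms(1) M(1,2), where 'f = 'f]
  have "limit_capacity_achieving_design TYPE('f) \<mu> N K \<alpha>"
    if P: "stored_at_exactly M N \<alpha>" "storage_used_up \<mu> N \<alpha>"
    unfolding limit_capacity_achieving_design_def
  proof (intro allI impI)
    fix \<epsilon> :: real assume "0 < \<epsilon>"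
    then obtain \<beta> where \<beta>: "\<And>S. S \<subseteq> {1..N} \<Longrightarrow> \<beta> S \<in> \<rat>" "\<And>S. S \<subseteq> {1..N} \<Longrightarrow> 0 \<le> \<beta> S"
      "stored_at_exactly M N \<beta>" "storage_used_up (real M / real N) N \<beta>"
      "\<And>S. S \<subseteq> {1..N} \<Longrightarrow> \<bar>\<beta> S - \<alpha> S\<bar> \<le> \<epsilon>"
      using ex_rational_design_near[OF M(3,4) _ nonneg P(1) P(2)[unfolded \<mu>]] by blast
    then show "\<exists>\<beta>. capacity_achieving_design TYPE('f) \<mu> N K \<beta> \<and> (\<forall>S. S \<subseteq> {1..N} \<longrightarrow> \<bar>\<beta> S - \<alpha> S\<bar> \<le> \<epsilon>)"
      unfolding \<mu> using sufficient[OF \<beta>(1-4)] by blast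
  qed
  moreover have "stored_at_exactly M N \<alpha> \<and> storage_used_up \<mu> N \<alpha>"
    if "limit_capacity_achieving_design TYPE('f) \<mu> N K \<alpha>"
    using that necessary unfolding limit_capacity_achieving_design_def \<mu> by (intro limit_design_properties) blast
  moreover have "capacity_achieving_design TYPE('f) \<mu> N K \<alpha> \<longleftrightarrow> stored_at_exactly M N \<alpha> \<and> storage_used_up \<mu> N \<alpha>"
    if rat: "\<forall>S. S \<subseteq> {1..N} \<longrightarrow> \<alpha> S \<in> \<rat>"
  proof
    show "stored_at_exactly M N \<alpha> \<and> storage_used_up \<mu> N \<alpha>"
      if "capacity_achieving_design TYPE('f) \<mu> N K \<alpha>"
      using necessary[OF that[unfolded \<mu>]] unfolding \<mu> .
    show "capacity_achieving_design TYPE('f) \<mu> N K \<alpha>"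
      if "stored_at_exactly M N \<alpha> \<and> storage_used_up \<mu> N \<alpha>"
      using sufficient[of \<alpha>] rat nonneg that unfolding \<mu> by simp
  qed
  ultimately show ?thesis by blast
qed

end
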